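(* $\mathsf{Asym}\in\mathsf{dAMAM}[O(\log n)]$, where $\mathsf{Asym}$ is the language of (connected) $n$-vertex communication graphs $G$ that have no non-trivial automorphism.
   Context: Distributed interactive proofs (model). An instance consists of a connected communication graph $G=(V,E)$ with $|V|=n$, where each node has a unique identifier of $O(\log n)$ bits, knows $n$, knows its own identifier, its local input (if the problem has local inputs), and the identifiers of its neighbours (with an arbitrary port numbering of its incident edges). A prover, who sees the whole instance, interacts with all nodes in $r$ alternating messages. In a verifier (node) message each node independently samples fresh uniformly random bits and sends them to the prover (public coins). In a prover message the prover sends each node a string. Nodes may additionally exchange the strings they received from the prover with their neighbours in $G$. At the end each node deterministically accepts or rejects as a function of its local information, its own random bits, the strings it received from the prover and those its neighbours received; the instance is accepted iff all nodes accept. The proof size is the maximum number of bits in any single message between the prover and any node. A language $\mathcal L$ (set of instances) is in $\mathsf{dIP}[r,\ell]$ if there is an $r$-message protocol of proof size $\ell=\ell(n)$ such that (completeness) for every instance in $\mathcal L$ some prover makes all nodes accept with probability $>2/3$, and (soundness) for every instance not in $\mathcal L$ and every prover, all nodes accept with probability $<1/3$ (probabilities over the nodes' coins). $\mathsf{dAM}[\ell]$, $\mathsf{dMAM}[\ell]$, $\mathsf{dAMAM}[\ell]$, $\mathsf{dMAMAM}[\ell]$ denote the cases of 2, 3, 4, 5 messages, where the letters indicate who sends each message in order (A = nodes send random coins, M = prover). An automorphism of $G=(V,E)$ is a permutation $\sigma$ of $V$ with $(u,v)\in E\iff(\sigma(u),\sigma(v))\in E$; it is non-trivial if it is not the identity.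 *)

theory Defs
  imports Main "HOL-Library.FuncSet" "HOL-Library.Landau_Symbols"
begin

section \<open>Instances: connected simple graphs whose vertices are their node identifiers\<close>

text \<open>A node is identified with its (unique) identifier, a natural number.
  Identifiers have O(log n) bits: for a fixed constant c every identifier is below n^c.\<close>

definition is_instance :: "nat \<Rightarrow> nat set \<Rightarrow> (nat \<times> nat) set \<Rightarrow> bool" where
  "is_instance c V E \<longleftrightarrow>
     finite V \<and> V \<noteq> {} \<and> E \<subseteq> V \<times> V \<and> sym E \<and> (\<forall>v. (v, v) \<notin> E) \<and>
     (\<forall>u\<in>V. \<forall>v\<in>V. (u, v) \<in> E\<^sup>*) \<and>
     (\<forall>v\<in>V. v < card V ^ c)"

definition is_automorphism :: "nat set \<Rightarrow> (nat \<times> nat) set \<Rightarrow> (nat \<Rightarrow> nat) \<Rightarrow> bool" where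
  "is_automorphism V E \<sigma> \<longleftrightarrow>
     bij_betw \<sigma> V V \<and> (\<forall>u\<in>V. \<forall>v\<in>V. (u, v) \<in> E \<longleftrightarrow> (\<sigma> u, \<sigma> v) \<in> E)"

text \<open>The language Asym: graphs without a non-trivial automorphism.\<close>
definition Asym :: "nat set \<Rightarrow> (nat \<times> nat) set \<Rightarrow> bool" where
  "Asym V E \<longleftrightarrow> \<not> (\<exists>\<sigma>. is_automorphism V E \<sigma> \<and> (\<exists>v\<in>V. \<sigma> v \<noteq> v))"

definition nbrs :: "nat set \<Rightarrow> (nat \<times> nat) set \<Rightarrow> nat \<Rightarrow> nat set" where
  "nbrs V E v = {u \<in> V. (v, u) \<in> E}"

section \<open>Four-message (AMAM) distributed interactive protocols\<close>

text \<open>Random coins of all nodes in one verifier round: each node gets a uniformly random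
  bit string of length k.\<close>
definition coins :: "nat set \<Rightarrow> nat \<Rightarrow> (nat \<Rightarrow> bool list) set" where
  "coins V k = PiE V (\<lambda>_. {xs. length xs = k})"

text \<open>Local decision of a node: arguments are n, own identifier, identifiers of the neighbours,
  own coins of round 1 and round 3, own prover strings of round 2 and round 4, and the
  prover strings (rounds 2 and 4) received by each neighbour (indexed by neighbour identifier;
  non-neighbours are mapped to empty strings).\<close>
type_synonym decision =
  "nat \<Rightarrow> nat \<Rightarrow> nat set \<Rightarrow> bool list \<Rightarrow> bool list \<Rightarrow> bool list \<Rightarrow> bool list
     \<Rightarrow> (nat \<Rightarrow> bool list \<times> bool list) \<Rightarrow> bool"

definition all_accept ::
  "nat set \<Rightarrow> (nat \<times> nat) set \<Rightarrow> decision \<Rightarrow> (nat \<Rightarrow> bool list) \<Rightarrow> (nat \<Rightarrow> bool list)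
     \<Rightarrow> (nat \<Rightarrow> bool list) \<Rightarrow> (nat \<Rightarrow> bool list) \<Rightarrow> bool" where
  "all_accept V E D r1 r2 m1 m2 \<longleftrightarrow>
     (\<forall>v\<in>V. D (card V) v (nbrs V E v) (r1 v) (r2 v) (m1 v) (m2 v)
               (\<lambda>u. if u \<in> nbrs V E v then (m1 u, m2 u) else ([], [])))"

text \<open>A (deterministic, adaptive) prover for a fixed instance: the round-2 message depends on
  all round-1 coins, the round-4 message on all coins of rounds 1 and 3.\<close>
definition accept_prob ::
  "nat set \<Rightarrow> (nat \<times> nat) set \<Rightarrow> nat \<Rightarrow> decision
     \<Rightarrow> ((nat \<Rightarrow> bool list) \<Rightarrow> nat \<Rightarrow> bool list)
     \<Rightarrow> ((nat \<Rightarrow> bool list) \<Rightarrow> (nat \<Rightarrow> bool list) \<Rightarrow> nat \<Rightarrow> bool list) \<Rightarrow> real" where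
  "accept_prob V E k D P1 P2 =
     real (card {(r1, r2). r1 \<in> coins V k \<and> r2 \<in> coins V k \<and>
                    all_accept V E D r1 r2 (P1 r1) (P2 r1 r2)})
     / real (card (coins V k \<times> coins V k))"

definition valid_prover ::
  "nat set \<Rightarrow> nat \<Rightarrow> nat
     \<Rightarrow> ((nat \<Rightarrow> bool list) \<Rightarrow> nat \<Rightarrow> bool list)
     \<Rightarrow> ((nat \<Rightarrow> bool list) \<Rightarrow> (nat \<Rightarrow> bool list) \<Rightarrow> nat \<Rightarrow> bool list) \<Rightarrow> bool" where
  "valid_prover V k l P1 P2 \<longleftrightarrow>
     (\<forall>r1\<in>coins V k. \<forall>r2\<in>coins V k. \<forall>v\<in>V.
        length (P1 r1 v) \<le> l \<and> length (P2 r1 r2 v) \<le> l)"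

text \<open>(l, k, D) is a dAMAM protocol of proof size l for language L on instances with
  identifiers below n^c; k n is the number of random bits each node sends per round.\<close>
definition dAMAM_protocol ::
  "nat \<Rightarrow> (nat set \<Rightarrow> (nat \<times> nat) set \<Rightarrow> bool) \<Rightarrow> (nat \<Rightarrow> nat) \<Rightarrow> (nat \<Rightarrow> nat) \<Rightarrow> decision \<Rightarrow> bool" where
  "dAMAM_protocol c L l k D \<longleftrightarrow>
     (\<forall>n. k n \<le> l n) \<and>
     (\<forall>V E. is_instance c V E \<longrightarrow>
        (L V E \<longrightarrow> (\<exists>P1 P2. valid_prover V (k (card V)) (l (card V)) P1 P2 \<and>
                              accept_prob V E (k (card V)) D P1 P2 > 2/3)) \<and>
        (\<not> L V E \<longrightarrow> (\<forall>P1 P2. valid_prover V (k (card V)) (l (card V)) P1 P2 \<longrightarrow>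
                              accept_prob V E (k (card V)) D P1 P2 < 1/3)))"

definition in_dAMAM_log :: "nat \<Rightarrow> (nat set \<Rightarrow> (nat \<times> nat) set \<Rightarrow> bool) \<Rightarrow> bool" where
  "in_dAMAM_log c L \<longleftrightarrow>
     (\<exists>l k D. (\<lambda>n. real (l n)) \<in> O(\<lambda>n. ln (real n)) \<and> dAMAM_protocol c L l k D)"

end

theory Submission
  imports Defs "HOL-Number_Theory.Cong" "HOL-Computational_Algebra.Polynomial"
    "HOL-Computational_Algebra.Primes"
begin

text \<open>This is a distributed Goldwasser--Sipser lower bound protocol for the number of relabelled copies
  of the graph on {0,...,n-1}: it is n! if the graph is asymmetric and at most n!/2 otherwise, and
  eight independent copies turn the factor 2 into 256.

  A copy is hashed in two stages over the integers modulo a prime q of size polynomial in n. Row i of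
  its adjacency matrix becomes the value of a polynomial of degree below n at a random point that
  belongs to the label i. At most n^|D| copies differ from a given one exactly in the rows D, and the
  rows in D collide with probability at most (2n/q)^|D|; hence almost all copies keep distinct
  hashes. The resulting vector of length N = 8n is multiplied by a random Toeplitz matrix and compared
  with a random offset, up to a box chosen such that the expected number of hits is between 16 and 32
  for an asymmetric graph. The second moment method gives completeness, the union bound soundness.

  In round 2 the prover commits to the labellings, to the evaluation points moved to their new
  owners, to the ranks of the nodes (which index the Toeplitz entries) and to the coefficients of the
  product of the Toeplitz polynomial and the hash polynomial. All these claims are identities between
  polynomials of degree at most 24n whose coefficients are spread over the nodes. They are tested at
  the sum of the coins of round 3, each as a statement that a sum over all nodes vanishes, which is
  certified in round 4 by partial sums along a spanning tree.\<close>

section \<open>Primes of polynomial size\<close>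

text \<open>With O(log n) bits per node the whole seed of the hash consists of O(n) numbers modulo
  \<open>q\<close>, while a copy has n^2 bits. Compressing every row at a single point fits this
  budget, but a row then collides with probability 1/poly(n), and a union bound over about n!^2
  pairs of copies is hopeless. Grouping the pairs by the set D of differing rows repairs this: n^|D|
  copies meet a probability of (2n/q)^|D|, and the sum over all nonempty D is small once q is a
  large multiple of n^3. The few copies that still collide are discarded.

  The coins of round 1 are public before the prover commits. If the prover could choose which coin
  carries which index, the union bound would also run over n! arrangements of the coins, far more
  than a gap of 2^8 pays for. Hence the indices are the ranks of the identifiers, which the graph
  determines. Conversely, the test point must be unknown at the time of the commitment, hence the
  second round of coins.\<close>

lemma leibniz_triangle_dvd_Lcm:
  "k \<le> n \<Longrightarrow> Suc n * (n choose k) dvd Lcm {1..Suc n}"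
proof (induction n arbitrary: k)
  case 0
  then show ?case by simp
next
  case (Suc m)
  let ?L = "Lcm {1..Suc (Suc m)}"
  have L0: "?L \<noteq> 0" by (simp add: Lcm_0_iff)
  from Suc.prems show ?case
  proof (induction k)
    case 0
    have "Suc (Suc m) \<in> {1..Suc (Suc m)}" by simp
    then show ?case using dvd_Lcm by fastforce
  next
    case (Suc k)
    \<comment> \<open>The reciprocals of \<open>?a\<close>, \<open>?b\<close> and \<open>?d\<close>
      are three adjacent entries of the harmonic triangle. \<open>?a\<close> divides
      \<open>?L\<close> by the induction on \<open>k\<close> and \<open>?d\<close> by the induction
      on the row, so the quotient of \<open>?L\<close> by \<open>?b\<close> is the difference
      \<open>w - u\<close> of two integers.\<close>
    let ?a = "Suc (Suc m) * (Suc m choose k)" and ?b = "Suc (Suc m) * (Suc m choose Suc k)"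
      and ?d = "Suc m * (m choose k)"
    have "?a dvd ?L" using Suc by simp
    then obtain u where u: "?L = ?a * u" by blast
    have "?d dvd Lcm {1..Suc m}" using Suc.IH Suc.prems \<open>\<And>k. k \<le> m \<Longrightarrow> Suc m * (m choose k) dvd Lcm {1..Suc m}\<close> by simp
    also have "\<dots> dvd ?L" by (rule Lcm_subset) auto
    finally obtain w where w: "?L = ?d * w" by blast
    have km: "k \<le> m" using Suc.prems by simp
    have e1: "(Suc m - k) * (Suc m choose k) = Suc m * (m choose k)"
      using binomial_absorb_comp[of "Suc m" k] by simp
    have e2: "Suc k * (Suc m choose Suc k) = Suc m * (m choose k)"
      using binomial_absorption[of k "Suc m"] by simp
    have pos: "0 < real (m choose k)" "0 < real (Suc m choose k)" "0 < real (Suc m choose Suc k)"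
      using km Suc.prems by (simp_all only: of_nat_0_less_iff zero_less_binomial_iff)
    \<comment> \<open>The relation 1/a + 1/b = 1/d of the harmonic triangle, cleared of denominators.\<close>
    have "(real (Suc m) - real k) * real (Suc m choose k) = real (Suc m) * real (m choose k)"
      using e1 km by (metis (no_types, lifting) le_SucI of_nat_diff of_nat_mult)
    then have a: "(real (Suc m) - real k) * real ?a = real (Suc (Suc m)) * real ?d"
      by (simp add: algebra_simps)
    have b: "real (Suc k) * real ?b = real (Suc (Suc m)) * real ?d"
      using e2 by (metis of_nat_mult mult.left_commute)
    have "(real ?a + real ?b) * real ?d * real (Suc (Suc m)) = real ?a * real ?b * real (Suc (Suc m))"
    proof -
      have "real ?a * (real (Suc (Suc m)) * real ?d) + real ?b * (real (Suc (Suc m)) * real ?d)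
          = real ?a * (real (Suc k) * real ?b) + real ?b * ((real (Suc m) - real k) * real ?a)"
        using a b by presburger
      also have "\<dots> = real ?a * real ?b * real (Suc (Suc m))" by (simp add: algebra_simps)
      finally show ?thesis by (simp only: algebra_simps)
    qed
    then have abd: "(real ?a + real ?b) * real ?d = real ?a * real ?b" by simp
    define A where "A = real ?a"
    define B where "B = real ?b"
    define D where "D = real ?d"
    define L where "L = real ?L"
    have P: "A > 0" "B > 0" "D > 0" unfolding A_def B_def D_def of_nat_mult
      using pos by (auto intro!: mult_pos_pos simp del: binomial_Suc_Suc)
    have abd': "(A + B) * D = A * B" using abd unfolding A_def B_def D_def .
    have U: "L = A * real u" unfolding L_def A_def using u by (metis of_nat_mult)
    have W: "L = D * real w" unfolding L_def D_def using w by (metis of_nat_mult)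
    have "B * (real w - real u) * (A * D) = B * A * (D * real w) - B * D * (A * real u)"
      by (simp add: algebra_simps)
    also have "\<dots> = B * A * L - B * D * L" using U W by simp
    also have "\<dots> = L * (A * B - B * D)" by (simp add: algebra_simps)
    also have "A * B - B * D = A * D" using abd' by (simp add: algebra_simps)
    finally have BL: "B * (real w - real u) = L" using P by simp
    have "L > 0" unfolding L_def using L0 by (metis of_nat_0_less_iff not_gr_zero)
    then have "real w - real u > 0" using BL P by (metis zero_less_mult_pos)
    then have "real (?b * (w - u)) = real ?L" using BL unfolding B_def L_def
      by (simp only: of_nat_mult of_nat_diff)
    then have "?b * (w - u) = ?L" using of_nat_eq_iff by blast
    then show ?case by (metis dvd_triv_left)
  qed
qed

text \<open>The n + 1 numbers in row n of the triangle have average 2^n, and each of them divides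
  the lcm. This is the only analytic input for the existence of a prime of suitable size.\<close>

lemma Lcm_lower_bound: "2 ^ n \<le> Lcm {1..Suc n}"
proof -
  have L0: "Lcm {1..Suc n} \<noteq> 0" by (simp add: Lcm_0_iff)
  have "\<exists>k\<le>n. 2 ^ n \<le> Suc n * (n choose k)"
  proof (rule ccontr)
    assume "\<not> ?thesis"
    then have *: "\<And>k. k \<le> n \<Longrightarrow> Suc n * (n choose k) < 2 ^ n" by force
    have "Suc n * 2 ^ n = (\<Sum>k\<le>n. Suc n * (n choose k))"
      using choose_row_sum[of n] by (simp only: sum_distrib_left[symmetric])
    also have "\<dots> < (\<Sum>k\<le>n. 2 ^ n)" by (rule sum_strict_mono) (use * in auto)
    finally show False by simp
  qed
  then obtain k where "k \<le> n" "2 ^ n \<le> Suc n * (n choose k)" by blast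
  with leibniz_triangle_dvd_Lcm[of k n] L0 show ?thesis
    by (meson dvd_imp_le le_trans not_gr_zero)
qed

text \<open>The exponent of a prime in an lcm is the maximum of its exponents in the members.
  Consequently the \<open>p\<close>-part of the lcm of 1..n is at most n.\<close>

lemma prime_power_dvd_Lcm:
  fixes p :: nat
  assumes "prime p" "p ^ Suc k dvd Lcm {1..n}"
  shows "\<exists>m\<in>{1..n}. p ^ Suc k dvd m"
  using assms(2)
proof (induction n)
  case 0
  then show ?case using assms(1) by (simp add: prime_nat_iff)
next
  case (Suc n)
  have eq: "Lcm {1..Suc n} = lcm (Suc n) (Lcm {1..n})"
    by (subst atLeastAtMostSuc_conv) auto
  have L0: "Lcm {1..n} \<noteq> 0" by (simp add: Lcm_0_iff)
  have np: "\<not> is_unit p" using assms(1) by auto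
  have "Suc k \<le> multiplicity p (lcm (Suc n) (Lcm {1..n}))"
    using Suc.prems eq L0 np by (subst (asm) power_dvd_iff_le_multiplicity) auto
  also have "\<dots> = max (multiplicity p (Suc n)) (multiplicity p (Lcm {1..n}))"
    using L0 assms(1) by (intro multiplicity_lcm) auto
  finally consider "Suc k \<le> multiplicity p (Suc n)" | "Suc k \<le> multiplicity p (Lcm {1..n})"
    by linarith
  then show ?case
  proof cases
    case 1
    then have "p ^ Suc k dvd Suc n" by (rule multiplicity_dvd')
    then show ?thesis by force
  next
    case 2
    then have "p ^ Suc k dvd Lcm {1..n}" by (rule multiplicity_dvd')
    then obtain m where "m\<in>{1..n}" "p ^ Suc k dvd m" using Suc.IH by blast
    then show ?thesis by force
  qed
qed

text \<open>Put N = 4^j. If every prime up to N were at most 2^j, the square root of N, then the lcm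
  of 1..N would be a product of at most 2^j prime powers, each at most N. That is too small for the
  lower bound 2^(N-1).\<close>

lemma exists_prime_between_powers:
  assumes "4 \<le> j"
  shows "\<exists>p::nat. prime p \<and> 2 ^ j < p \<and> p \<le> 4 ^ j"
proof (rule ccontr)
  assume no: "\<not> ?thesis"
  define N :: nat where "N = 4 ^ j"
  define L where "L = Lcm {1..N}"
  have L0: "L \<noteq> 0" unfolding L_def by (simp add: Lcm_0_iff)
  have N1: "N \<ge> 1" unfolding N_def by simp
  have N2: "N = 2 ^ (2 * j)" unfolding N_def by (simp add: power_mult)
  have pf: "p ^ multiplicity p L \<le> N \<and> p \<le> 2 ^ j" if "p \<in> prime_factors L" for p
  proof -
    have p: "prime p" "p dvd L" using that by auto
    then have "multiplicity p L > 0"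
      using L0 by (simp add: prime_multiplicity_gt_zero_iff)
    then obtain k where k: "multiplicity p L = Suc k"
      using gr0_implies_Suc by blast
    have "p ^ Suc k dvd L" using k by (metis multiplicity_dvd)
    then obtain m where m: "m \<in> {1..N}" "p ^ Suc k dvd m"
      using prime_power_dvd_Lcm[OF p(1)] unfolding L_def by blast
    have le: "p ^ Suc k \<le> N" using m by (auto dest!: dvd_imp_le)
    have "p dvd m" using m(2) by (meson dvd_power dvd_trans zero_less_Suc)
    then have "p \<le> N" using m(1) by (auto dest!: dvd_imp_le)
    then have "p \<le> 2 ^ j" using no p(1) unfolding N_def by (meson not_le)
    with le k show ?thesis by simp
  qed
  have "L = (\<Prod>p\<in>prime_factors L. p ^ multiplicity p L)"
    using L0 by (simp add: prod_prime_factors)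
  also have "\<dots> \<le> (\<Prod>p\<in>prime_factors L. N)" by (rule prod_mono) (use pf in auto)
  also have "\<dots> = N ^ card (prime_factors L)" by simp
  also have "\<dots> \<le> N ^ (2 ^ j)"
  proof (rule power_increasing[OF _ N1])
    have "1 \<le> p" if "p \<in> prime_factors L" for p
      using prime_ge_1_nat[OF in_prime_factors_imp_prime[OF that]] .
    then have "prime_factors L \<subseteq> {1..2 ^ j}" using pf by auto
    then show "card (prime_factors L) \<le> 2 ^ j" using card_mono[of "{1..2 ^ j}" "prime_factors L"] by simp
  qed
  also have "\<dots> = 2 ^ (2 * j * 2 ^ j)"
    using N2 by (simp only: power_mult)
  finally have up: "L \<le> 2 ^ (2 * j * 2 ^ j)" .
  have "2 ^ (N - 1) \<le> L" unfolding L_def using Lcm_lower_bound[of "N - 1"] N1 by simp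
  with up have "(2::nat) ^ (N - 1) \<le> 2 ^ (2 * j * 2 ^ j)" by linarith
  then have "N - 1 \<le> 2 * j * 2 ^ j" by simp
  \<comment> \<open>Multiplied by 2^j this gives 2j * 2^j + 2^j <= N, while N <= 2j * 2^j + 1 was
    just derived; this is impossible because 2^j >= 2.\<close>
  moreover have "2 * j + 1 \<le> (2::nat) ^ j" using assms
  proof (induction j rule: dec_induct)
    case (step n)
    then show ?case by simp
  qed simp
  then have "(2 * j + 1) * 2 ^ j \<le> (2::nat) ^ j * 2 ^ j" by (rule mult_le_mono1)
  moreover have "(2::nat) ^ j * 2 ^ j = N" unfolding N_def by (simp add: power_mult_distrib[symmetric])
  moreover have "(2::nat) ^ 1 \<le> 2 ^ j" using assms by (intro power_increasing) auto
  ultimately show False by (simp add: algebra_simps)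
qed

section \<open>Counting and aggregation\<close>

text \<open>Lagrange's bound, with integer polynomials in place of a field with \<open>q\<close>
  elements: synthetic division at a root modulo \<open>q\<close> leaves a quotient that is again
  nonzero modulo \<open>q\<close> and has smaller degree.\<close>

lemma card_roots_mod_prime:
  fixes F :: "int poly" and q :: nat
  assumes "prime q" "\<not> (\<forall>i. int q dvd coeff F i)"
  shows "card {x\<in>{..<q}. int q dvd poly F (int x)} \<le> degree F"
  using assms(2)
proof (induction "degree F" arbitrary: F rule: less_induct)
  case less
  have pq: "prime (int q)" using assms(1) by simp
  show ?case
  proof (cases "\<exists>a<q. int q dvd poly F (int a)")
    case False
    then have "{x\<in>{..<q}. int q dvd poly F (int x)} = {}" by auto
    then show ?thesis by (metis card.empty le0)
  next
    case True
    then obtain a where a: "a < q" "int q dvd poly F (int a)" by blast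
    define G where "G = synthetic_div F (int a)"
    have F: "F = [:- int a, 1:] * G + [:poly F (int a):]"
      unfolding G_def by (rule synthetic_div_correct'[symmetric])
    have ev: "poly F x = (x - int a) * poly G x + poly F (int a)" for x
      by (subst F) (simp add: algebra_simps)
    have G: "\<not> (\<forall>i. int q dvd coeff G i)"
    proof
      assume G: "\<forall>i. int q dvd coeff G i"
      have "int q dvd coeff F i" for i
        by (subst F) (use G a(2) in \<open>auto simp: coeff_pCons split: nat.splits\<close>)
      with less.prems show False by blast
    qed
    have "degree F \<noteq> 0"
    proof
      assume "degree F = 0"
      then obtain c where c: "F = [:c:]" by (meson degree_eq_zeroE)
      with a(2) have "int q dvd c" by simp
      with c have "\<forall>i. int q dvd coeff F i" by (auto simp: coeff_pCons split: nat.splits)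
      with less.prems show False by blast
    qed
    then have dG: "degree F = Suc (degree G)" unfolding G_def by (simp add: degree_synthetic_div)
    have "{x\<in>{..<q}. int q dvd poly F (int x)} \<subseteq> insert a {x\<in>{..<q}. int q dvd poly G (int x)}"
    proof
      fix x assume x: "x \<in> {x\<in>{..<q}. int q dvd poly F (int x)}"
      then have "int q dvd (int x - int a) * poly G (int x) + poly F (int a)"
        unfolding ev[symmetric] by simp
      then have "int q dvd (int x - int a) * poly G (int x)" using a(2) dvd_add_left_iff by blast
      then consider "int q dvd int x - int a" | "int q dvd poly G (int x)"
        using pq prime_dvd_multD by blast
      then show "x \<in> insert a {x\<in>{..<q}. int q dvd poly G (int x)}"
      proof cases
        case 1
        then have "int x mod int q = int a mod int q" by (simp add: mod_eq_dvd_iff)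
        with x a have "x = a" by simp
        then show ?thesis by simp
      qed (use x in auto)
    qed
    then have "card {x\<in>{..<q}. int q dvd poly F (int x)}
        \<le> card (insert a {x\<in>{..<q}. int q dvd poly G (int x)})"
      by (intro card_mono) auto
    also have "\<dots> \<le> Suc (card {x\<in>{..<q}. int q dvd poly G (int x)})" by (rule card_insert_le_m1) auto
    also have "\<dots> \<le> Suc (degree G)" using less.hyps[of G] G dG by simp
    finally show ?thesis using dG by simp
  qed
qed

text \<open>A residue class has at most \<open>Q div q + 1\<close> members below \<open>Q\<close>.
  Coins are uniform below a power of two, hence not exactly uniform modulo \<open>q\<close>; this
  factor accounts for the difference in all later counts.\<close>

lemma card_residues_le:
  fixes q Q :: nat
  assumes "finite R"
  shows "card {c\<in>{..<Q}. c mod q \<in> R} \<le> card R * (Q div q + 1)"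
proof -
  have "card {c\<in>{..<Q}. c mod q \<in> R} \<le> card (R \<times> {..Q div q})"
  proof (rule card_inj_on_le)
    show "inj_on (\<lambda>c. (c mod q, c div q)) {c\<in>{..<Q}. c mod q \<in> R}"
      by (rule inj_onI) (metis Pair_inject mult_div_mod_eq)
    show "(\<lambda>c. (c mod q, c div q)) ` {c\<in>{..<Q}. c mod q \<in> R} \<subseteq> R \<times> {..Q div q}"
      by (auto simp: div_le_mono)
  qed (use assms in auto)
  then show ?thesis using assms by (simp add: card_cartesian_product)
qed

text \<open>The shift \<open>s\<close> stands for what the other coins contribute to a sum. The
  admissible residues of \<open>c\<close> are the roots of \<open>F\<close> translated by
  -s.\<close>

lemma card_coin_roots:
  fixes F :: "int poly"
  assumes "prime q" "\<not> (\<forall>i. int q dvd coeff F i)"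
  shows "card {c\<in>{..<Q}. int q dvd poly F (int c + s)} \<le> degree F * (Q div q + 1)"
proof -
  let ?s = "nat (s mod int q)"
  define R where "R = (\<lambda>x. (x + (q - ?s)) mod q) ` {x\<in>{..<q}. int q dvd poly F (int x)}"
  have q0: "q > 0" using assms(1) prime_gt_0_nat by blast
  have sq: "?s < q" using q0 by (simp add: nat_less_iff)
  have "{c\<in>{..<Q}. int q dvd poly F (int c + s)} \<subseteq> {c\<in>{..<Q}. c mod q \<in> R}"
  proof (intro subsetI CollectI conjI)
    fix c assume c: "c \<in> {c\<in>{..<Q}. int q dvd poly F (int c + s)}"
    then show "c \<in> {..<Q}" by simp
    define x where "x = (c + ?s) mod q"
    have "int x = (int c + s) mod int q"
      unfolding x_def using q0 by (simp add: zmod_int mod_simps)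
    then have "[int x = int c + s] (mod int q)" by (simp add: cong_def)
    then have "[poly F (int x) = poly F (int c + s)] (mod int q)"
      unfolding poly_altdef by (intro cong_sum cong_mult cong_pow cong_refl)
    then have "int q dvd poly F (int x)" using c by (simp add: cong_dvd_iff)
    moreover have "(x + (q - ?s)) mod q = c mod q"
    proof -
      have "(x + (q - ?s)) mod q = (c + ?s + (q - ?s)) mod q"
        unfolding x_def by (simp add: mod_simps)
      also have "c + ?s + (q - ?s) = c + q" using sq by simp
      finally show ?thesis by simp
    qed
    ultimately show "c mod q \<in> R" unfolding R_def using q0
      by (intro image_eqI[of _ _ x]) (auto simp: x_def)
  qed
  then have "card {c\<in>{..<Q}. int q dvd poly F (int c + s)} \<le> card {c\<in>{..<Q}. c mod q \<in> R}"
    by (intro card_mono) auto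
  also have "\<dots> \<le> card R * (Q div q + 1)" by (rule card_residues_le) (simp add: R_def)
  also have "\<dots> \<le> degree F * (Q div q + 1)"
  proof (rule mult_le_mono1)
    show "card R \<le> degree F"
    unfolding R_def by (rule le_trans[OF card_image_le card_roots_mod_prime[OF assms]]) simp
  qed
  finally show ?thesis .
qed

text \<open>Fubini for counting: the coordinates in \<open>A\<close> are fixed, the others are
  counted. All conditioning on a part of the coins goes through this equation.\<close>

lemma card_PiE_split:
  assumes "finite A" "finite B" "A \<inter> B = {}" "\<And>i. i \<in> A \<union> B \<Longrightarrow> finite (S i)"
  shows "card {f \<in> PiE (A \<union> B) S. P f}
       = (\<Sum>\<alpha>\<in>PiE A S. card {\<beta> \<in> PiE B S. P (\<lambda>i. if i \<in> A then \<alpha> i else \<beta> i)})"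
proof -
  have fB: "finite (PiE B S)" using assms by (intro finite_PiE) auto
  have fA: "finite (PiE A S)" using assms by (intro finite_PiE) auto
  let ?Y = "SIGMA \<alpha>:PiE A S. {\<beta> \<in> PiE B S. P (\<lambda>i. if i \<in> A then \<alpha> i else \<beta> i)}"
  let ?g = "\<lambda>(\<alpha>, \<beta>) i. if i \<in> A then \<alpha> i else \<beta> i"
  have "bij_betw ?g ?Y {f \<in> PiE (A \<union> B) S. P f}"
  proof (rule bij_betw_byWitness[where f' = "\<lambda>f. (restrict f A, restrict f B)"], goal_cases)
    case 1
    then show ?case using assms(3) by (fastforce simp: fun_eq_iff PiE_def extensional_def)
  next
    case 2
    then show ?case using assms(3) by (fastforce simp: fun_eq_iff PiE_def extensional_def)
  next
    case 3
    then show ?case using assms(3) by (auto simp: PiE_def extensional_def Pi_def)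
  next
    case 4
    have "(\<lambda>i. if i \<in> A then restrict f A i else restrict f B i) = f" if "f \<in> PiE (A \<union> B) S" for f
      using that by (auto simp: fun_eq_iff PiE_def extensional_def)
    then show ?case by (auto simp: PiE_def)
  qed
  then have "card {f \<in> PiE (A \<union> B) S. P f} = card ?Y" by (rule bij_betw_same_card[symmetric])
  also have "\<dots> = (\<Sum>\<alpha>\<in>PiE A S. card {\<beta> \<in> PiE B S. P (\<lambda>i. if i \<in> A then \<alpha> i else \<beta> i)})"
    using fA fB by (simp add: card_SigmaI)
  finally show ?thesis .
qed

lemma card_PiE_box:
  "finite I \<Longrightarrow> card {f \<in> PiE I S. \<forall>i\<in>I. P i (f i)} = (\<Prod>i\<in>I. card {c \<in> S i. P i c})"
proof -
  assume "finite I"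
  moreover have "{f \<in> PiE I S. \<forall>i\<in>I. P i (f i)} = PiE I (\<lambda>i. {c \<in> S i. P i c})"
    by (auto simp: PiE_def Pi_def)
  ultimately show ?thesis by (simp add: card_PiE)
qed

text \<open>Chebyshev's inequality for the number of events A z that occur.\<close>

lemma card_avoiding_le:
  fixes A :: "'z \<Rightarrow> 'w set" and \<delta> :: real
  assumes fin: "finite \<Omega>" "finite Z" and "Z \<noteq> {}" "\<delta> > 0"
    and sub: "\<And>z. z \<in> Z \<Longrightarrow> A z \<subseteq> \<Omega>"
    and single: "\<And>z. z \<in> Z \<Longrightarrow> real (card (A z)) = \<delta> * card \<Omega>"
    and pair: "\<And>z z'. z \<in> Z \<Longrightarrow> z' \<in> Z \<Longrightarrow> z \<noteq> z' \<Longrightarrow> real (card (A z \<inter> A z')) \<le> \<delta>\<^sup>2 * card \<Omega>"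
  shows "real (card (\<Omega> - (\<Union>z\<in>Z. A z))) * (\<delta> * card Z) \<le> card \<Omega>"
proof -
  define \<mu> where "\<mu> = \<delta> * card Z"
  define M where "M = real (card \<Omega>)"
  define X where "X w = (\<Sum>z\<in>Z. if w \<in> A z then 1 else 0 :: real)" for w
  have cZ: "card Z > 0" using assms by (simp add: card_gt_0_iff)
  have mu: "\<mu> > 0" unfolding \<mu>_def using cZ assms by simp
  have ind: "(\<Sum>w\<in>\<Omega>. if w \<in> B then 1 else 0 :: real) = card B" if "B \<subseteq> \<Omega>" for B
    using that fin by (simp add: sum.If_cases Int_absorb1)
  have S1: "(\<Sum>w\<in>\<Omega>. X w) = \<mu> * M"
  proof -
    have "(\<Sum>w\<in>\<Omega>. X w) = (\<Sum>z\<in>Z. \<Sum>w\<in>\<Omega>. if w \<in> A z then 1 else 0)"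
      unfolding X_def by (rule sum.swap)
    also have "\<dots> = (\<Sum>z\<in>Z. \<delta> * M)"
      by (intro sum.cong refl) (simp add: ind[OF sub] single M_def)
    finally show ?thesis by (simp add: \<mu>_def mult_ac)
  qed
  have S2: "(\<Sum>w\<in>\<Omega>. (X w)\<^sup>2) \<le> \<mu> * M + \<mu>\<^sup>2 * M"
  proof -
    have "(X w)\<^sup>2 = (\<Sum>z\<in>Z. \<Sum>z'\<in>Z. if w \<in> A z \<inter> A z' then 1 else 0)" for w
      unfolding X_def power2_eq_square sum_product by (intro sum.cong refl) auto
    then have "(\<Sum>w\<in>\<Omega>. (X w)\<^sup>2) = (\<Sum>w\<in>\<Omega>. \<Sum>z\<in>Z. \<Sum>z'\<in>Z. if w \<in> A z \<inter> A z' then 1 else 0)"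
      by simp
    also have "\<dots> = (\<Sum>z\<in>Z. \<Sum>w\<in>\<Omega>. \<Sum>z'\<in>Z. if w \<in> A z \<inter> A z' then 1 else 0)"
      by (rule sum.swap)
    also have "\<dots> = (\<Sum>z\<in>Z. \<Sum>z'\<in>Z. \<Sum>w\<in>\<Omega>. if w \<in> A z \<inter> A z' then 1 else 0)"
      by (intro sum.cong refl sum.swap)
    also have "\<dots> = (\<Sum>z\<in>Z. \<Sum>z'\<in>Z. real (card (A z \<inter> A z')))"
      by (intro sum.cong refl ind) (use sub in blast)
    also have "\<dots> \<le> (\<Sum>z\<in>Z. \<Sum>z'\<in>Z. (if z = z' then \<delta> * M else 0) + \<delta>\<^sup>2 * M)"
      unfolding M_def by (intro sum_mono) (auto simp: single dest: pair)
    also have "\<dots> = \<mu> * M + \<mu>\<^sup>2 * M"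
      using fin by (simp add: sum.distrib \<mu>_def power2_eq_square algebra_simps)
    finally show ?thesis .
  qed
  \<comment> \<open>Where no event occurs, \<open>X\<close> is 0 and deviates from the mean by all
    of \<open>\<mu>\<close>.\<close>
  have "real (card (\<Omega> - (\<Union>z\<in>Z. A z))) * \<mu>\<^sup>2 = (\<Sum>w\<in>\<Omega> - (\<Union>z\<in>Z. A z). (X w - \<mu>)\<^sup>2)"
    by (simp add: X_def)
  also have "\<dots> \<le> (\<Sum>w\<in>\<Omega>. (X w - \<mu>)\<^sup>2)" by (rule sum_mono2) (use fin in auto)
  also have "\<dots> = (\<Sum>w\<in>\<Omega>. (X w)\<^sup>2) - 2 * \<mu> * (\<Sum>w\<in>\<Omega>. X w) + \<mu>\<^sup>2 * M"
    by (simp add: power2_diff sum.distrib sum_subtractf sum_distrib_left sum_distrib_right M_def algebra_simps)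
  also have "\<dots> \<le> \<mu> * M" using S1 S2 by (simp add: algebra_simps power2_eq_square)
  finally have "(real (card (\<Omega> - (\<Union>z\<in>Z. A z))) * \<mu>) * \<mu> \<le> M * \<mu>"
    by (simp add: power2_eq_square algebra_simps)
  then have "real (card (\<Omega> - (\<Union>z\<in>Z. A z))) * \<mu> \<le> M" using mu by simp
  then show ?thesis unfolding \<mu>_def M_def .
qed

text \<open>Factors \<open>q\<close> are split off until at most \<open>q\<close> remains. Only this
  remainder is rounded to an integer, and rounding up a real number that is at least 1 costs at most
  a factor 2. A box is needed because the volume wanted is in general no power of
  \<open>q\<close>.\<close>

lemma exists_box_of_volume:
  fixes A :: real and q :: nat
  assumes "1 \<le> A" "A \<le> real q ^ N" "q \<ge> 1"
  shows "\<exists>W :: nat \<Rightarrow> nat. (\<forall>m. 1 \<le> W m \<and> W m \<le> q) \<and> A \<le> (\<Prod>m<N. W m) \<and> (\<Prod>m<N. W m) \<le> 2 * A"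
  using assms(1,2)
proof (induction N arbitrary: A)
  case 0
  then show ?case by (intro exI[of _ "\<lambda>_. 1"]) (use assms in auto)
next
  case (Suc N)
  show ?case
  proof (cases "A \<le> q")
    case True
    define W where "W m = (if m = N then nat \<lceil>A\<rceil> else 1)" for m
    have c: "A \<le> real (nat \<lceil>A\<rceil>)" "real (nat \<lceil>A\<rceil>) \<le> 2 * A" using Suc.prems by linarith+
    have c2: "nat \<lceil>A\<rceil> \<le> q" "1 \<le> nat \<lceil>A\<rceil>" using True Suc.prems by linarith+
    have p: "(\<Prod>m<Suc N. W m) = nat \<lceil>A\<rceil>" unfolding W_def by simp
    show ?thesis
    proof (intro exI[of _ W] conjI allI)
      show "1 \<le> W m" "W m \<le> q" for m using c2 assms(3) by (simp_all add: W_def)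
    qed (simp_all only: p c)
  next
    case False
    have q0: "real q > 0" using assms(3) by simp
    have "A / q \<ge> 1" using False q0 by simp
    moreover have "A / q \<le> real q ^ N" using Suc.prems(2) q0 by (simp add: field_simps)
    ultimately obtain W where W: "\<forall>m. 1 \<le> W m \<and> W m \<le> q" "A / q \<le> real (\<Prod>m<N. W m)"
      "real (\<Prod>m<N. W m) \<le> 2 * (A / q)" using Suc.IH[of "A / q"] by blast
    let ?W = "W(N := q)"
    have "(\<Prod>m<Suc N. ?W m) = (\<Prod>m<N. W m) * q" by (simp cong: prod.cong_simp)
    moreover have "A \<le> real (\<Prod>m<N. W m) * q" "real (\<Prod>m<N. W m) * q \<le> 2 * A"
      using W(2,3) q0 by (simp_all add: field_simps)
    ultimately show ?thesis using W(1) assms(3) by (intro exI[of _ ?W]) simp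
  qed
qed

section \<open>Aggregation along a spanning tree\<close>

lemma rtrancl_leaves:
  assumes "(a, b) \<in> E\<^sup>*" "a \<in> W" "b \<notin> W"
  shows "\<exists>x y. x \<in> W \<and> y \<notin> W \<and> (x, y) \<in> E"
  using assms by (induction rule: rtrancl_induct) blast+

text \<open>Adding a leaf x below y: the demand of x is moved to y and shipped along the new edge.\<close>

lemma partial_tree_flow:
  fixes V :: "nat set" and E :: "(nat \<times> nat) set"
  assumes fin: "finite V" and rt: "rt \<in> V" and sub: "E \<subseteq> V \<times> V" and sy: "sym E"
    and conn: "\<forall>v\<in>V. (rt, v) \<in> E\<^sup>*"
  shows "k < card V \<Longrightarrow> \<exists>W p. W \<subseteq> V \<and> card W = Suc k \<and> rt \<in> W \<and>
     (\<forall>v\<in>W - {rt}. p v \<in> W \<and> (v, p v) \<in> E) \<and>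
     (\<forall>val :: nat \<Rightarrow> int. \<exists>S. \<forall>v\<in>W. val v + (\<Sum>u\<in>{u\<in>W - {rt}. p u = v}. S u)
         = (if v = rt then sum val W else S v))"
proof (induction k)
  case 0
  show ?case by (rule exI[of _ "{rt}"], rule exI[of _ id]) (use rt in auto)
next
  case (Suc k)
  have "k < card V" using Suc.prems by simp
  from Suc.IH[OF this] obtain W p where W: "W \<subseteq> V" "card W = Suc k" "rt \<in> W"
    and p: "\<And>v. v\<in>W - {rt} \<Longrightarrow> p v \<in> W \<and> (v, p v) \<in> E"
    and S: "\<And>val :: nat \<Rightarrow> int. \<exists>S. \<forall>v\<in>W. val v + (\<Sum>u\<in>{u\<in>W - {rt}. p u = v}. S u)
         = (if v = rt then sum val W else S v)" by blast
  have fW: "finite W" using W(1) fin finite_subset by blast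
  have "W \<noteq> V" using W(2) Suc.prems by auto
  then obtain b where "b \<in> V" "b \<notin> W" using W(1) by blast
  then obtain y x where yx: "y \<in> W" "x \<notin> W" "(y, x) \<in> E" using rtrancl_leaves conn W(3) by metis
  have xV: "x \<in> V" and xy: "(x, y) \<in> E" using yx sub sy by (auto dest: symD)
  let ?W = "insert x W" and ?p = "p(x := y)"
  have xr: "x \<noteq> rt" "x \<noteq> y" using yx W(3) by auto
  show ?case
  proof (intro exI[of _ ?W] exI[of _ ?p] conjI allI)
    show "?W \<subseteq> V" "card ?W = Suc (Suc k)" "rt \<in> ?W" using W xV yx fW by auto
    show "\<forall>v\<in>?W - {rt}. ?p v \<in> ?W \<and> (v, ?p v) \<in> E" using p yx xy by auto
  next
    fix val :: "nat \<Rightarrow> int"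
    let ?val = "val(y := val y + val x)"
    obtain S where S: "\<And>v. v \<in> W \<Longrightarrow> ?val v + (\<Sum>u\<in>{u\<in>W - {rt}. p u = v}. S u)
         = (if v = rt then sum ?val W else S v)" using S[of ?val] by blast
    have sv: "sum ?val W = sum val ?W"
      using fW yx by (simp add: sum.remove[of W y] fun_upd_def cong: sum.cong_simp)
    show "\<exists>S. \<forall>v\<in>?W. val v + (\<Sum>u\<in>{u\<in>?W - {rt}. ?p u = v}. S u)
         = (if v = rt then sum val ?W else S v)"
    proof (intro exI[of _ "S(x := val x)"] ballI)
      fix v assume v: "v \<in> ?W"
      show "val v + (\<Sum>u\<in>{u\<in>?W - {rt}. ?p u = v}. (S(x := val x)) u)
         = (if v = rt then sum val ?W else (S(x := val x)) v)"
      proof (cases "v = x")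
        case True
        then have e: "{u\<in>?W - {rt}. ?p u = v} = {}" using p yx xr by auto
        show ?thesis unfolding e using True xr by simp
      next
        case False
        then have vW: "v \<in> W" using v by simp
        have e: "{u\<in>?W - {rt}. ?p u = v} = (if v = y then {x} else {}) \<union> {u\<in>W - {rt}. p u = v}"
          using yx xr by auto
        have d: "(\<Sum>u\<in>{u\<in>W - {rt}. p u = v}. (S(x := val x)) u) = (\<Sum>u\<in>{u\<in>W - {rt}. p u = v}. S u)"
          using yx by (intro sum.cong) auto
        have "(\<Sum>u\<in>{u\<in>?W - {rt}. ?p u = v}. (S(x := val x)) u)
          = (if v = y then val x else 0) + (\<Sum>u\<in>{u\<in>W - {rt}. p u = v}. S u)"
          unfolding e using fW yx d by (subst sum.union_disjoint) auto
        then show ?thesis using S[OF vW] sv False by (auto split: if_splits)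
      qed
    qed
  qed
qed

text \<open>The tree \<open>p\<close> is chosen before \<open>val\<close>, so one parent pointer per
  node serves all sums. The choice \<open>p rt = rt\<close> makes the root recognisable locally:
  there are no loops, hence its pointer is not a neighbour.\<close>

lemma tree_flow:
  assumes "is_instance c V E"
  obtains rt p where "rt \<in> V" "p rt = rt"
    "\<And>v. v \<in> V \<Longrightarrow> v \<noteq> rt \<Longrightarrow> p v \<in> nbrs V E v"
    "\<And>val :: nat \<Rightarrow> int. \<exists>S. \<forall>v\<in>V. val v + (\<Sum>u | u \<in> nbrs V E v \<and> p u = v. S u)
         = (if v = rt then sum val V else S v)"
proof -
  have inst: "finite V" "V \<noteq> {}" "E \<subseteq> V \<times> V" "sym E" "\<And>v. (v, v) \<notin> E"
    "\<And>u v. u \<in> V \<Longrightarrow> v \<in> V \<Longrightarrow> (u, v) \<in> E\<^sup>*" using assms unfolding is_instance_def by auto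
  then obtain rt where r: "rt \<in> V" by blast
  have cV: "card V - 1 < card V" "Suc (card V - 1) = card V" using inst by (simp_all add: card_gt_0_iff)
  have conn: "\<forall>v\<in>V. (rt, v) \<in> E\<^sup>*" using inst(6) r by blast
  from partial_tree_flow[OF inst(1) r inst(3,4) conn cV(1), unfolded cV(2)]
  obtain W p where W: "W \<subseteq> V" "card W = card V" and p: "\<forall>v\<in>W - {rt}. p v \<in> W \<and> (v, p v) \<in> E"
    and S: "\<And>val :: nat \<Rightarrow> int. \<exists>S. \<forall>v\<in>W. val v + (\<Sum>u\<in>{u\<in>W - {rt}. p u = v}. S u)
         = (if v = rt then sum val W else S v)" by blast
  have WV: "W = V" using W inst(1) by (simp add: card_subset_eq)
  let ?p = "p(rt := rt)"
  have eq: "{u. u \<in> nbrs V E v \<and> ?p u = v} = {u\<in>V - {rt}. p u = v}" if "v \<in> V" for v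
    using p inst(4,5) WV by (auto simp: nbrs_def dest: symD split: if_splits)
  show ?thesis
  proof (rule that[OF r, of ?p])
    show "\<And>v. v \<in> V \<Longrightarrow> v \<noteq> rt \<Longrightarrow> ?p v \<in> nbrs V E v" using p WV by (auto simp: nbrs_def)
    fix val :: "nat \<Rightarrow> int"
    show "\<exists>S. \<forall>v\<in>V. val v + (\<Sum>u | u \<in> nbrs V E v \<and> ?p u = v. S u)
         = (if v = rt then sum val V else S v)"
      using S[of val] unfolding WV by (simp only: eq cong: ball_cong)
  qed simp
qed

lemma power_one_plus_le:
  fixes r :: real
  assumes "0 \<le> r" "2 * real k * r \<le> 1"
  shows "(1 + r) ^ k \<le> 1 + 2 * real k * r"
  using assms(2)
proof (induction k)
  case (Suc k)
  have le: "2 * real k * r \<le> 1" using Suc.prems assms(1) by (simp add: algebra_simps)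
  have "(1 + r) ^ Suc k \<le> (1 + r) * (1 + 2 * real k * r)" using Suc.IH[OF le] assms(1) by simp
  also have "\<dots> = 1 + 2 * real k * r + r + (2 * real k * r) * r" by (simp add: algebra_simps)
  also have "\<dots> \<le> 1 + 2 * real k * r + r + 1 * r" using le assms(1) by (intro add_mono mult_right_mono) auto
  finally show ?case by (simp add: algebra_simps)
qed simp

section \<open>The hash family\<close>

text \<open>Coefficient N + m of the product of two polynomials, one with the coefficients
  \<open>z\<close> below N and one with the coefficients \<open>T\<close>. The shift by N keeps all
  indices \<open>N + m - i\<close> between 0 and 2N - 1 for m < N, so no term of a row is cut off.
  This reading makes the matrix product testable at one point.\<close>

definition toeplitz :: "nat \<Rightarrow> (nat \<Rightarrow> int) \<Rightarrow> (nat \<Rightarrow> int) \<Rightarrow> nat \<Rightarrow> int" where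
  "toeplitz N z T m = (\<Sum>i<N. z i * T (N + m - i))"

definition row_hash :: "(nat \<times> nat) set \<Rightarrow> (nat \<Rightarrow> nat) \<Rightarrow> nat \<Rightarrow> int" where
  "row_hash x a i = (\<Sum>j\<in>x `` {i}. int (a i) ^ j)"

text \<open>The eight hashes are concatenated: entry m belongs to copy \<open>m div n\<close> and
  label \<open>m mod n\<close>. Evaluation points belong to labels and are shared by all eight
  copies, so one condition on the points rules out collisions in every component.\<close>

definition tuple_hash :: "nat \<Rightarrow> (nat \<Rightarrow> (nat \<times> nat) set) \<Rightarrow> (nat \<Rightarrow> nat) \<Rightarrow> nat \<Rightarrow> int" where
  "tuple_hash n X a m = row_hash (X (m div n)) a (m mod n)"

text \<open>The coins are laid out as n evaluation points, 16 n Toeplitz entries and 8 n offsets.\<close>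

definition hits :: "nat \<Rightarrow> nat \<Rightarrow> (nat \<Rightarrow> nat) \<Rightarrow> (nat \<Rightarrow> int) \<Rightarrow> (nat \<Rightarrow> nat) \<Rightarrow> bool" where
  "hits n q W z \<omega> \<longleftrightarrow> (\<forall>m<8 * n.
     (toeplitz (8 * n) z (\<lambda>i. int (\<omega> (n + i))) m - int (\<omega> (17 * n + m))) mod int q < int (W m))"

definition graph_of :: "nat \<Rightarrow> (nat \<times> nat) set \<Rightarrow> (nat \<Rightarrow> nat) \<Rightarrow> (nat \<times> nat) set" where
  "graph_of n E \<rho> = {(i, j). i < n \<and> j < n \<and> (\<rho> i, \<rho> j) \<in> E}"

text \<open>These maps lead from labels to nodes; the prover announces their inverses. They are
  extensional, so that there are exactly n! of them.\<close>

definition labellings :: "nat \<Rightarrow> nat set \<Rightarrow> (nat \<Rightarrow> nat) set" where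
  "labellings n V = {\<rho> \<in> {..<n} \<rightarrow>\<^sub>E V. inj_on \<rho> {..<n}}"

definition copies :: "nat \<Rightarrow> nat set \<Rightarrow> (nat \<times> nat) set \<Rightarrow> (nat \<times> nat) set set" where
  "copies n V E = graph_of n E ` labellings n V"

definition lucky :: "nat \<Rightarrow> nat \<Rightarrow> (nat \<Rightarrow> nat) \<Rightarrow> nat set \<Rightarrow> (nat \<times> nat) set \<Rightarrow> (nat \<Rightarrow> nat) \<Rightarrow> bool" where
  "lucky n q W V E \<omega> \<longleftrightarrow>
     (\<exists>X\<in>{..<8} \<rightarrow>\<^sub>E copies n V E. hits n q W (tuple_hash n X \<omega>) \<omega>)"

text \<open>If i0 is the first nonzero entry of the difference, row m of the system determines the Toeplitz
  entry with index N + m - i0 from entries with smaller indices.\<close>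

lemma toeplitz_unique:
  fixes \<Delta> d :: "nat \<Rightarrow> int"
  assumes q: "prime q" and i0: "i0 < N" "\<not> q dvd \<Delta> i0" "\<And>k. k < i0 \<Longrightarrow> q dvd \<Delta> k"
    and lin: "\<And>m. m < N \<Longrightarrow> q dvd toeplitz N \<Delta> d m"
    and out: "\<And>i. i < 2 * N \<Longrightarrow> i \<notin> {N - i0..<2 * N - i0} \<Longrightarrow> q dvd d i"
  shows "i < 2 * N \<Longrightarrow> q dvd d i"
proof (induction i rule: less_induct)
  case (less i)
  show ?case
  proof (cases "i \<in> {N - i0..<2 * N - i0}")
    case False
    then show ?thesis using out less.prems by blast
  next
    case True
    define m where "m = i - (N - i0)"
    have m: "m < N" "N + m - i0 = i" unfolding m_def using True i0(1) by auto
    have rest: "q dvd (\<Sum>k\<in>{..<N} - {i0}. \<Delta> k * d (N + m - k))"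
    proof (rule dvd_sum)
      fix k assume k: "k \<in> {..<N} - {i0}"
      show "q dvd \<Delta> k * d (N + m - k)"
      proof (cases "k < i0")
        case True
        then show ?thesis using i0(3) by simp
      next
        case False
        then have "N + m - k < i" using k m by auto
        then show ?thesis using less by simp
      qed
    qed
    have "toeplitz N \<Delta> d m = \<Delta> i0 * d i + (\<Sum>k\<in>{..<N} - {i0}. \<Delta> k * d (N + m - k))"
      unfolding toeplitz_def using i0(1) m by (subst sum.remove[of _ i0]) auto
    with lin[OF m(1)] rest have "q dvd \<Delta> i0 * d i" using dvd_add_left_iff by metis
    then show ?thesis using q i0(2) prime_dvd_multD by blast
  qed
qed

text \<open>The map from c to (y - c) mod q permutes the residues. A uniform offset therefore meets
  a window with its exact frequency, whatever the rest of the hash is.\<close>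

lemma card_window:
  fixes y :: int
  assumes "w \<le> q" "q > 0"
  shows "card {c\<in>{..<q}. (y - int c) mod int q < int w} = w"
proof -
  let ?f = "\<lambda>c. nat ((y - int c) mod int q)"
  have inj: "inj_on ?f {..<q}"
  proof (rule inj_onI)
    fix c c' assume c: "c \<in> {..<q}" "c' \<in> {..<q}" and "?f c = ?f c'"
    then have "(y - int c) mod int q = (y - int c') mod int q" using assms(2)
      by (metis Euclidean_Rings.pos_mod_sign eq_nat_nat_iff of_nat_0_less_iff)
    then have "[y - int c = y - int c'] (mod int q)" by (simp add: cong_def)
    then have "[int c = int c'] (mod int q)" by (simp add: cong_iff_dvd_diff dvd_diff_commute)
    then show "c = c'" using c by (simp add: cong_def)
  qed
  have "?f ` {..<q} \<subseteq> {..<q}" using assms(2) by (auto simp: nat_less_iff)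
  then have surj: "?f ` {..<q} = {..<q}" using inj by (simp add: endo_inj_surj)
  have "bij_betw ?f {c\<in>{..<q}. (y - int c) mod int q < int w} {..<w}"
    unfolding bij_betw_def
  proof
    show "inj_on ?f {c\<in>{..<q}. (y - int c) mod int q < int w}" using inj by (rule inj_on_subset) auto
    show "?f ` {c\<in>{..<q}. (y - int c) mod int q < int w} = {..<w}"
    proof
      show "?f ` {c\<in>{..<q}. (y - int c) mod int q < int w} \<subseteq> {..<w}"
        using assms(2) by (auto simp: nat_less_iff)
      show "{..<w} \<subseteq> ?f ` {c\<in>{..<q}. (y - int c) mod int q < int w}"
      proof
        fix e assume e: "e \<in> {..<w}"
        then have "e \<in> ?f ` {..<q}" using surj assms(1) by auto
        then obtain c where c: "c < q" "e = ?f c" by auto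
        then have "(y - int c) mod int q < int w" using e assms(2) by (auto simp: nat_less_iff)
        with c show "e \<in> ?f ` {c\<in>{..<q}. (y - int c) mod int q < int w}" by auto
      qed
    qed
  qed
  then show ?thesis using bij_betw_same_card by fastforce
qed

lemma card_window_le:
  fixes y :: int
  assumes "w \<le> q" "q > 0"
  shows "card {c\<in>{..<Q}. (y - int c) mod int q < int w} \<le> w * (Q div q + 1)"
proof -
  have "{c\<in>{..<Q}. (y - int c) mod int q < int w}
      = {c\<in>{..<Q}. c mod q \<in> {c\<in>{..<q}. (y - int c) mod int q < int w}}"
    using assms(2) by (auto simp: zmod_int mod_simps)
  then show ?thesis using card_residues_le[of "{c\<in>{..<q}. (y - int c) mod int q < int w}" Q q]
    unfolding card_window[OF assms] by simp
qed

lemma hits_cong: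
  assumes "\<And>m. m < 8 * n \<Longrightarrow> [z m = z' m] (mod int q)"
    and "\<And>i. i \<in> {n..<25 * n} \<Longrightarrow> [int (\<omega> i) = int (\<omega>' i)] (mod int q)"
  shows "hits n q W z \<omega> \<longleftrightarrow> hits n q W z' \<omega>'"
proof -
  have "(toeplitz (8 * n) z (\<lambda>i. int (\<omega> (n + i))) m - int (\<omega> (17 * n + m))) mod int q
      = (toeplitz (8 * n) z' (\<lambda>i. int (\<omega>' (n + i))) m - int (\<omega>' (17 * n + m))) mod int q"
    if "m < 8 * n" for m
    unfolding toeplitz_def cong_def[symmetric]
    using that by (intro cong_diff cong_sum cong_mult assms) auto
  then show ?thesis unfolding hits_def by auto
qed

lemma prod_shift_to_0: "(\<Prod>i\<in>{k..<k + N}. f (i - k)) = (\<Prod>m<N. f m)" for f :: "nat \<Rightarrow> 'a::comm_monoid_mult"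
  by (rule prod.reindex_bij_witness[of _ "\<lambda>m. m + k" "\<lambda>i. i - k"]) auto

text \<open>Once the points and the Toeplitz entries are fixed, every row constrains an offset of
  its own, so counting the offsets becomes a product over the rows.\<close>

lemma hits_merge:
  fixes \<alpha> \<beta> :: "nat \<Rightarrow> nat"
  assumes A: "{n..<17 * n} \<subseteq> A" "A \<inter> {17 * n..<25 * n} = {}"
  shows "hits n q W z (\<lambda>i. if i \<in> A then \<alpha> i else \<beta> i) \<longleftrightarrow>
   (\<forall>i\<in>{17 * n..<17 * n + 8 * n}.
     (toeplitz (8 * n) z (\<lambda>i. int (\<alpha> (n + i))) (i - 17 * n) - int (\<beta> i)) mod int q < int (W (i - 17 * n)))"
proof -
  have t: "toeplitz (8 * n) z (\<lambda>i. int (if n + i \<in> A then \<alpha> (n + i) else \<beta> (n + i))) m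
      = toeplitz (8 * n) z (\<lambda>i. int (\<alpha> (n + i))) m" if "m < 8 * n" for m
    unfolding toeplitz_def
  proof (intro sum.cong refl)
    fix k assume "k \<in> {..<8 * n}"
    then have "n + (8 * n + m - k) \<in> A" using that by (intro subsetD[OF A(1)]) auto
    then show "z k * int (if n + (8 * n + m - k) \<in> A then \<alpha> (n + (8 * n + m - k)) else \<beta> (n + (8 * n + m - k)))
      = z k * int (\<alpha> (n + (8 * n + m - k)))" by (simp only: if_True)
  qed
  have b: "17 * n + m \<notin> A" if "m < 8 * n" for m using that A by auto
  show ?thesis unfolding hits_def
  proof safe
    fix i assume *: "\<forall>m<8 * n. (toeplitz (8 * n) z (\<lambda>i. int (if n + i \<in> A then \<alpha> (n + i) else \<beta> (n + i))) m
      - int (if 17 * n + m \<in> A then \<alpha> (17 * n + m) else \<beta> (17 * n + m))) mod int q < int (W m)"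
      and i: "i \<in> {17 * n..<17 * n + 8 * n}"
    then have "i - 17 * n < 8 * n" "17 * n + (i - 17 * n) = i" by auto
    then show "(toeplitz (8 * n) z (\<lambda>i. int (\<alpha> (n + i))) (i - 17 * n) - int (\<beta> i)) mod int q < int (W (i - 17 * n))"
      using *[rule_format, of "i - 17 * n"] t b by force
  next
    fix m assume *: "\<forall>i\<in>{17 * n..<17 * n + 8 * n}.
     (toeplitz (8 * n) z (\<lambda>i. int (\<alpha> (n + i))) (i - 17 * n) - int (\<beta> i)) mod int q < int (W (i - 17 * n))"
      and m: "m < 8 * n"
    show "(toeplitz (8 * n) z (\<lambda>i. int (if n + i \<in> A then \<alpha> (n + i) else \<beta> (n + i))) m
      - int (if 17 * n + m \<in> A then \<alpha> (17 * n + m) else \<beta> (17 * n + m))) mod int q < int (W m)"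
      using *[rule_format, of "17 * n + m"] t[OF m] b[OF m] m by simp
  qed
qed

lemma row_hash_cong: "a i = a' i \<Longrightarrow> row_hash x a i = row_hash x a' i"
  by (simp add: row_hash_def)

section \<open>Parameters, and how often one copy or two copies hit the box\<close>

text \<open>The lower bound on \<open>q\<close> keeps colliding copies rare.
  \<open>48 * n * q \<le> Q\<close> limits the bias of up to 24 n coins modulo \<open>q\<close> to a
  factor 2. The last two bounds concern n!^8 times the density of the box, which is the expected
  number of hits if all n! copies differ.\<close>

locale hash_parameters =
  fixes n q Q :: nat and W :: "nat \<Rightarrow> nat"
  assumes n2: "2 \<le> n" and pq: "prime q" and q_large: "10000 * n ^ 3 \<le> q"
    and Q_large: "48 * n * q \<le> Q"
    and W_range: "\<And>m. 1 \<le> W m" "\<And>m. W m \<le> q"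
    and W_lower: "16 * real q ^ (8 * n) \<le> real (\<Prod>m<8 * n. W m) * fact n ^ 8"
    and W_upper: "real (\<Prod>m<8 * n. W m) * fact n ^ 8 \<le> 32 * real q ^ (8 * n)"
begin

lemma q0: "q > 0" using pq prime_gt_0_nat by blast

lemma q_le_Q: "q \<le> Q"
  using Q_large n2 by (metis le_trans mult_le_mono1 mult_1 one_le_mult_iff numeral_le_iff one_le_numeral
      le_numeral_extra(4) nat_1_add_1 le_add2 semiring_norm(68))

text \<open>The left side is at most Q^k (1 + r)^k with r = 1 / (48 n). The limit 24 n is the number
  of Toeplitz entries and offsets together, the largest set of coins that is compared with uniform
  residues.\<close>

lemma fibre_power: "k \<le> 24 * n \<Longrightarrow> real ((Q div q + 1) * q) ^ k \<le> 2 * real Q ^ k"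
proof -
  assume k: "k \<le> 24 * n"
  define r where "r = 1 / (48 * real n)"
  have r: "r > 0" using n2 by (simp add: r_def)
  have "2 * real k * r \<le> 1" using k n2 by (simp add: r_def field_simps)
  then have b: "(1 + r) ^ k \<le> 1 + 2 * real k * r" using r by (intro power_one_plus_le) auto
  have "(Q div q + 1) * q \<le> Q + q" by (simp add: algebra_simps)
  then have "real ((Q div q + 1) * q) \<le> real Q + real q" by (metis of_nat_add of_nat_mono)
  also have "real q \<le> real Q * r"
  proof -
    have "real (48 * n * q) \<le> real Q" using Q_large of_nat_mono by blast
    then show ?thesis using n2 by (simp add: r_def field_simps)
  qed
  finally have "real ((Q div q + 1) * q) \<le> real Q * (1 + r)" by (simp add: algebra_simps)
  then have "real ((Q div q + 1) * q) ^ k \<le> (real Q * (1 + r)) ^ k" by (intro power_mono) auto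
  also have "\<dots> = real Q ^ k * (1 + r) ^ k" by (simp add: power_mult_distrib)
  also have "\<dots> \<le> real Q ^ k * 2" using b \<open>2 * real k * r \<le> 1\<close> by (intro mult_left_mono) auto
  finally show ?thesis by simp
qed

text \<open>The offsets alone give this bound: it holds for any values of the points and of the
  Toeplitz entries. The tuple \<open>X\<close> is fixed, so the bound can be summed over all
  tuples.\<close>

lemma card_hits_copy:
  "card {\<omega> \<in> {..<25 * n} \<rightarrow>\<^sub>E {..<Q}. hits n q W (tuple_hash n X \<omega>) \<omega>}
     \<le> Q ^ (17 * n) * ((\<Prod>m<8 * n. W m) * (Q div q + 1) ^ (8 * n))"
proof -
  let ?A = "{..<17 * n}" and ?B = "{17 * n..<17 * n + 8 * n}"
  let ?m = "\<lambda>\<alpha> \<beta> i. if i \<in> ?A then \<alpha> i else \<beta> i"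
  have u: "{..<25 * n} = ?A \<union> ?B" by auto
  have "card {\<omega> \<in> {..<25 * n} \<rightarrow>\<^sub>E {..<Q}. hits n q W (tuple_hash n X \<omega>) \<omega>}
    = (\<Sum>\<alpha>\<in>?A \<rightarrow>\<^sub>E {..<Q}. card {\<beta> \<in> ?B \<rightarrow>\<^sub>E {..<Q}.
        hits n q W (tuple_hash n X (?m \<alpha> \<beta>)) (?m \<alpha> \<beta>)})"
    unfolding u by (rule card_PiE_split) auto
  also have "\<dots> \<le> (\<Sum>\<alpha>\<in>?A \<rightarrow>\<^sub>E {..<Q}. (\<Prod>m<8 * n. W m) * (Q div q + 1) ^ (8 * n))"
  proof (rule sum_mono)
    fix \<alpha> assume "\<alpha> \<in> ?A \<rightarrow>\<^sub>E {..<Q}"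
    have th: "tuple_hash n X (?m \<alpha> \<beta>) = tuple_hash n X \<alpha>" for \<beta>
    proof
      fix m
      have "m mod n < 17 * n" using n2 mod_less_divisor[of n m] by linarith
      then show "tuple_hash n X (?m \<alpha> \<beta>) m = tuple_hash n X \<alpha> m"
        unfolding tuple_hash_def by (intro row_hash_cong) simp
    qed
    have "card {\<beta> \<in> ?B \<rightarrow>\<^sub>E {..<Q}.
        hits n q W (tuple_hash n X (?m \<alpha> \<beta>)) (?m \<alpha> \<beta>)}
      = card {\<beta> \<in> ?B \<rightarrow>\<^sub>E {..<Q}. \<forall>i\<in>?B. (toeplitz (8 * n) (tuple_hash n X \<alpha>) (\<lambda>i. int (\<alpha> (n + i))) (i - 17 * n)
            - int (\<beta> i)) mod int q < int (W (i - 17 * n))}"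
      unfolding th by (subst hits_merge) auto
    also have "\<dots> = (\<Prod>i\<in>?B. card {c\<in>{..<Q}. (toeplitz (8 * n) (tuple_hash n X \<alpha>) (\<lambda>i. int (\<alpha> (n + i))) (i - 17 * n)
            - int c) mod int q < int (W (i - 17 * n))})"
      by (rule card_PiE_box) simp
    also have "\<dots> \<le> (\<Prod>i\<in>?B. W (i - 17 * n) * (Q div q + 1))"
      by (intro prod_mono conjI card_window_le W_range q0) auto
    also have "\<dots> = (\<Prod>m<8 * n. W m * (Q div q + 1))"
      by (rule prod_shift_to_0[of "\<lambda>m. W m * (Q div q + 1)"])
    finally show "card {\<beta> \<in> ?B \<rightarrow>\<^sub>E {..<Q}.
        hits n q W (tuple_hash n X (?m \<alpha> \<beta>)) (?m \<alpha> \<beta>)}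
      \<le> (\<Prod>m<8 * n. W m) * (Q div q + 1) ^ (8 * n)"
      by (simp only: prod.distrib prod_constant card_lessThan)
  qed
  also have "\<dots> = Q ^ (17 * n) * ((\<Prod>m<8 * n. W m) * (Q div q + 1) ^ (8 * n))"
    by (simp add: card_PiE)
  finally show ?thesis .
qed

lemma card_hits_uniform:
  "card {u \<in> {n..<25 * n} \<rightarrow>\<^sub>E {..<q}. hits n q W z u} = q ^ (16 * n) * (\<Prod>m<8 * n. W m)"
proof -
  let ?A = "{n..<17 * n}" and ?B = "{17 * n..<17 * n + 8 * n}"
  let ?m = "\<lambda>\<alpha> \<beta> i. if i \<in> ?A then \<alpha> i else \<beta> i"
  have u: "{n..<25 * n} = ?A \<union> ?B" by auto
  have "card {u \<in> {n..<25 * n} \<rightarrow>\<^sub>E {..<q}. hits n q W z u}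
    = (\<Sum>\<alpha>\<in>?A \<rightarrow>\<^sub>E {..<q}. card {\<beta> \<in> ?B \<rightarrow>\<^sub>E {..<q}. hits n q W z (?m \<alpha> \<beta>)})"
    unfolding u by (rule card_PiE_split) auto
  also have "\<dots> = (\<Sum>\<alpha>\<in>?A \<rightarrow>\<^sub>E {..<q}. (\<Prod>m<8 * n. W m))"
  proof (rule sum.cong[OF refl])
    fix \<alpha> assume "\<alpha> \<in> ?A \<rightarrow>\<^sub>E {..<q}"
    have "card {\<beta> \<in> ?B \<rightarrow>\<^sub>E {..<q}. hits n q W z (?m \<alpha> \<beta>)}
      = card {\<beta> \<in> ?B \<rightarrow>\<^sub>E {..<q}. \<forall>i\<in>?B. (toeplitz (8 * n) z (\<lambda>i. int (\<alpha> (n + i))) (i - 17 * n)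
            - int (\<beta> i)) mod int q < int (W (i - 17 * n))}"
      by (subst hits_merge) auto
    also have "\<dots> = (\<Prod>i\<in>?B. card {c\<in>{..<q}. (toeplitz (8 * n) z (\<lambda>i. int (\<alpha> (n + i))) (i - 17 * n)
            - int c) mod int q < int (W (i - 17 * n))})"
      by (rule card_PiE_box) simp
    also have "\<dots> = (\<Prod>i\<in>?B. W (i - 17 * n))"
      by (intro prod.cong refl card_window W_range q0)
    also have "\<dots> = (\<Prod>m<8 * n. W m)" by (rule prod_shift_to_0)
    finally show "card {\<beta> \<in> ?B \<rightarrow>\<^sub>E {..<q}. hits n q W z (?m \<alpha> \<beta>)} = (\<Prod>m<8 * n. W m)" .
  qed
  also have "\<dots> = q ^ (16 * n) * (\<Prod>m<8 * n. W m)"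
    by (simp add: card_PiE)
  finally show ?thesis .
qed

text \<open>Pairwise independence as an upper bound. Let \<open>i0\<close> be the first position
  where the hashes differ. Given the 8 n Toeplitz entries in \<open>D\<close>, the two places inside
  the box determine everything else: their difference fixes the remaining 8 n Toeplitz entries by
  \<open>toeplitz_unique\<close>, and then one place fixes the offsets.\<close>

lemma card_hits_pair:
  assumes "m0 < 8 * n" "\<not> [z m0 = z' m0] (mod int q)"
  shows "card {u \<in> {n..<25 * n} \<rightarrow>\<^sub>E {..<q}. hits n q W z u \<and> hits n q W z' u}
    \<le> (\<Prod>m<8 * n. W m)\<^sup>2 * q ^ (8 * n)"
proof -
  let ?N = "8 * n"
  let ?H = "{u \<in> {n..<25 * n} \<rightarrow>\<^sub>E {..<q}. hits n q W z u \<and> hits n q W z' u}"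
  define \<Delta> where "\<Delta> i = z i - z' i" for i
  define i0 where "i0 = (LEAST i. \<not> int q dvd \<Delta> i)"
  have m0: "\<not> int q dvd \<Delta> m0" using assms(2) by (simp add: \<Delta>_def cong_iff_dvd_diff)
  have i0: "\<not> int q dvd \<Delta> i0" unfolding i0_def using m0 by (rule LeastI)
  have i0': "int q dvd \<Delta> k" if "k < i0" for k using not_less_Least that unfolding i0_def by blast
  have "i0 \<le> m0" unfolding i0_def using m0 by (rule Least_le)
  then have i0N: "i0 < ?N" using assms(1) by simp
  define D where "D = {n..<17 * n} - {n + (?N - i0)..<n + (2 * ?N - i0)}"
  have cD: "card D = 8 * n" unfolding D_def using i0N by (subst card_Diff_subset) auto
  define e where "e z u m = nat ((toeplitz ?N z (\<lambda>i. int (u (n + i))) m - int (u (17 * n + m))) mod int q)"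
    for z :: "nat \<Rightarrow> int" and u :: "nat \<Rightarrow> nat" and m
  define \<Phi> where "\<Phi> u = (restrict (e z u) {..<?N}, restrict (e z' u) {..<?N}, restrict u D)" for u
  have "card ?H \<le> card (PiE {..<?N} (\<lambda>m. {..<W m}) \<times> PiE {..<?N} (\<lambda>m. {..<W m}) \<times> (D \<rightarrow>\<^sub>E {..<q}))"
  proof (rule card_inj_on_le)
    show "\<Phi> ` ?H \<subseteq> PiE {..<?N} (\<lambda>m. {..<W m}) \<times> PiE {..<?N} (\<lambda>m. {..<W m}) \<times> (D \<rightarrow>\<^sub>E {..<q})"
    proof
      fix y assume "y \<in> \<Phi> ` ?H"
      then obtain u where u: "u \<in> {n..<25 * n} \<rightarrow>\<^sub>E {..<q}" "hits n q W z u" "hits n q W z' u" "y = \<Phi> u" by blast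
      have "restrict u D \<in> D \<rightarrow>\<^sub>E {..<q}" using u(1) by (auto simp: D_def PiE_def)
      then show "y \<in> PiE {..<?N} (\<lambda>m. {..<W m}) \<times> PiE {..<?N} (\<lambda>m. {..<W m}) \<times> (D \<rightarrow>\<^sub>E {..<q})"
        using u(2,3) q0 unfolding u(4) \<Phi>_def e_def hits_def by (auto simp: nat_less_iff)
    qed
    show "inj_on \<Phi> ?H"
    proof (rule inj_onI)
      fix u u' assume u: "u \<in> ?H" and u': "u' \<in> ?H" and eq: "\<Phi> u = \<Phi> u'"
      have ez: "e z u m = e z u' m" "e z' u m = e z' u' m" if "m < ?N" for m
        using eq that unfolding \<Phi>_def by (metis Pair_inject lessThan_iff restrict_apply')+
      have eD: "u i = u' i" if "i \<in> D" for i
        using eq that unfolding \<Phi>_def by (metis Pair_inject restrict_apply')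
      define d where "d i = int (u (n + i)) - int (u' (n + i))" for i
      have ee: "[toeplitz ?N y (\<lambda>i. int (u (n + i))) m - int (u (17 * n + m))
           = toeplitz ?N y (\<lambda>i. int (u' (n + i))) m - int (u' (17 * n + m))] (mod int q)"
        if "e y u m = e y u' m" for y m
        using that q0 unfolding e_def cong_def
        by (metis Euclidean_Rings.pos_mod_sign eq_nat_nat_iff of_nat_0_less_iff)
      have lin: "toeplitz ?N z (\<lambda>i. int (u (n + i))) m - toeplitz ?N z' (\<lambda>i. int (u (n + i))) m
         - (toeplitz ?N z (\<lambda>i. int (u' (n + i))) m - toeplitz ?N z' (\<lambda>i. int (u' (n + i))) m)
         = toeplitz ?N \<Delta> d m" for m
        unfolding toeplitz_def sum_subtractf[symmetric] \<Delta>_def d_def by (simp add: algebra_simps)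
      \<comment> \<open>Subtracting the rows of \<open>z\<close> and \<open>z'\<close> cancels the
        offset, which is common to both.\<close>
      have "int q dvd toeplitz ?N \<Delta> d m" if "m < ?N" for m
      proof -
        have "[(toeplitz ?N z (\<lambda>i. int (u (n + i))) m - int (u (17 * n + m)))
             - (toeplitz ?N z' (\<lambda>i. int (u (n + i))) m - int (u (17 * n + m)))
           = (toeplitz ?N z (\<lambda>i. int (u' (n + i))) m - int (u' (17 * n + m)))
             - (toeplitz ?N z' (\<lambda>i. int (u' (n + i))) m - int (u' (17 * n + m)))] (mod int q)"
          using ez[OF that] by (intro cong_diff ee)
        then show ?thesis unfolding lin[symmetric] cong_iff_dvd_diff by simp
      qed
      moreover have "int q dvd d i" if "i < 2 * ?N" "i \<notin> {?N - i0..<2 * ?N - i0}" for i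
        using eD[of "n + i"] that by (auto simp: D_def d_def)
      ultimately have dz: "int q dvd d i" if "i < 2 * ?N" for i
        using toeplitz_unique[of "int q" i0 ?N \<Delta> d i] pq i0 i0' i0N that by auto
      have T: "u (n + i) = u' (n + i)" if "i < 2 * ?N" for i
      proof -
        have "u (n + i) < q" "u' (n + i) < q" using u u' that by (auto simp: PiE_def Pi_def)
        moreover have "[int (u (n + i)) = int (u' (n + i))] (mod int q)"
          using dz[OF that] by (simp add: d_def cong_iff_dvd_diff)
        ultimately show ?thesis by (simp add: cong_def)
      qed
      have B: "u (17 * n + m) = u' (17 * n + m)" if "m < ?N" for m
      proof -
        have "toeplitz ?N z (\<lambda>i. int (u (n + i))) m = toeplitz ?N z (\<lambda>i. int (u' (n + i))) m"
          unfolding toeplitz_def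
        proof (intro sum.cong refl)
          fix k assume "k \<in> {..<?N}"
          then show "z k * int (u (n + (?N + m - k))) = z k * int (u' (n + (?N + m - k)))"
            using T[of "?N + m - k"] that by simp
        qed
        with ee[OF ez(1)[OF that]] have "[int (u (17 * n + m)) = int (u' (17 * n + m))] (mod int q)"
          by (simp add: cong_iff_dvd_diff dvd_diff_commute)
        moreover have "u (17 * n + m) < q" "u' (17 * n + m) < q" using u u' that by (auto simp: PiE_def Pi_def)
        ultimately show ?thesis by (simp add: cong_def)
      qed
      show "u = u'"
      proof (rule PiE_ext)
        show "u \<in> {n..<25 * n} \<rightarrow>\<^sub>E {..<q}" "u' \<in> {n..<25 * n} \<rightarrow>\<^sub>E {..<q}" using u u' by auto
        fix i assume i: "i \<in> {n..<25 * n}"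
        show "u i = u' i"
        proof (cases "i < 17 * n")
          case True
          then show ?thesis using T[of "i - n"] i by simp
        next
          case False
          then show ?thesis using B[of "i - 17 * n"] i by simp
        qed
      qed
    qed
    show "finite (PiE {..<?N} (\<lambda>m. {..<W m}) \<times> PiE {..<?N} (\<lambda>m. {..<W m}) \<times> (D \<rightarrow>\<^sub>E {..<q}))"
      by (intro finite_cartesian_product finite_PiE) (auto simp: D_def)
  qed
  also have "\<dots> = (\<Prod>m<?N. W m)\<^sup>2 * q ^ (8 * n)"
  proof -
    have "finite D" by (simp add: D_def)
    then show ?thesis by (simp add: card_cartesian_product card_PiE cD power2_eq_square)
  qed
  finally show ?thesis .
qed

end

section \<open>Labelled copies and automorphisms\<close>

lemma finite_labellings: "finite V \<Longrightarrow> finite (labellings n V)"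
  unfolding labellings_def by (rule finite_subset[of _ "{..<n} \<rightarrow>\<^sub>E V"]) (auto intro!: finite_PiE)

lemma card_labellings: "finite V \<Longrightarrow> card V = n \<Longrightarrow> card (labellings n V) = fact n"
  unfolding labellings_def by (subst card_inj_on_subset_funcset) (auto simp: fact_prod_rev)

lemma labelling_bij:
  assumes "finite V" "card V = n" "\<rho> \<in> labellings n V"
  shows "bij_betw \<rho> {..<n} V"
proof -
  have inj: "inj_on \<rho> {..<n}" and sub: "\<rho> ` {..<n} \<subseteq> V" using assms(3) by (auto simp: labellings_def)
  have "card (\<rho> ` {..<n}) = card V" using inj assms(2) by (simp add: card_image)
  then have "\<rho> ` {..<n} = V" using sub assms(1) card_subset_eq by blast
  with inj show ?thesis by (simp add: bij_betw_def)
qed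

text \<open>Following a labelling by a non-trivial automorphism gives a different labelling with the
  same copy, so every fibre of \<open>graph_of\<close> has at least two elements.\<close>

lemma card_copies_symmetric:
  assumes inst: "is_instance c V E" and n: "card V = n" and sym: "\<not> Asym V E"
  shows "2 * card (copies n V E) \<le> fact n"
proof -
  have fin: "finite V" using inst by (simp add: is_instance_def)
  let ?L = "labellings n V"
  obtain \<phi> v0 where \<phi>: "bij_betw \<phi> V V" "\<And>u v. u \<in> V \<Longrightarrow> v \<in> V \<Longrightarrow> (u, v) \<in> E \<longleftrightarrow> (\<phi> u, \<phi> v) \<in> E"
    and v0: "v0 \<in> V" "\<phi> v0 \<noteq> v0"
    using sym unfolding Asym_def is_automorphism_def by blast
  have two: "2 \<le> card {\<rho>\<in>?L. graph_of n E \<rho> = y}" if y: "y \<in> copies n V E" for y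
  proof -
    obtain \<rho> where \<rho>: "\<rho> \<in> ?L" "y = graph_of n E \<rho>" using y unfolding copies_def by blast
    have b: "bij_betw \<rho> {..<n} V" using labelling_bij[OF fin n \<rho>(1)] .
    define \<rho>' where "\<rho>' = restrict (\<phi> \<circ> \<rho>) {..<n}"
    have "\<rho>' \<in> ?L"
      using bij_betw_trans[OF b \<phi>(1)] unfolding labellings_def \<rho>'_def bij_betw_def by auto
    moreover have "graph_of n E \<rho>' = y"
      unfolding \<rho>(2) graph_of_def \<rho>'_def using \<phi>(2) bij_betwE[OF b] by auto
    moreover have "\<rho>' \<noteq> \<rho>"
    proof
      assume eq: "\<rho>' = \<rho>"
      obtain i where i: "i < n" "\<rho> i = v0" using v0(1) b unfolding bij_betw_def by auto
      then have "\<rho>' i = \<phi> v0" by (simp add: \<rho>'_def)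
      with eq i v0 show False by simp
    qed
    ultimately have "{\<rho>, \<rho>'} \<subseteq> {\<rho>\<in>?L. graph_of n E \<rho> = y}" "card {\<rho>, \<rho>'} = 2" using \<rho> by auto
    moreover have "finite {\<rho>\<in>?L. graph_of n E \<rho> = y}" using finite_labellings[OF fin] by simp
    ultimately show ?thesis using card_mono by metis
  qed
  have "2 * card (copies n V E) = (\<Sum>y\<in>copies n V E. 2)" by simp
  also have "\<dots> \<le> (\<Sum>y\<in>copies n V E. card {\<rho>\<in>?L. graph_of n E \<rho> = y})" by (rule sum_mono) (rule two)
  also have "\<dots> = card ?L"
    unfolding copies_def card_eq_sum using finite_labellings[OF fin] by (rule sum.image_gen[symmetric])
  finally show ?thesis using card_labellings[OF fin n] by simp
qed

text \<open>If two labellings give the same copy, the second after the inverse of the first is an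
  automorphism, hence the identity.\<close>

lemma card_copies_asymmetric:
  assumes inst: "is_instance c V E" and n: "card V = n" and asym: "Asym V E"
  shows "card (copies n V E) = fact n"
proof -
  have fin: "finite V" using inst by (simp add: is_instance_def)
  let ?L = "labellings n V"
  have "inj_on (graph_of n E) ?L"
  proof (rule inj_onI)
    fix \<rho> \<rho>' assume \<rho>: "\<rho> \<in> ?L" and \<rho>': "\<rho>' \<in> ?L" and eq: "graph_of n E \<rho> = graph_of n E \<rho>'"
    note b = labelling_bij[OF fin n \<rho>] and b' = labelling_bij[OF fin n \<rho>']
    define \<phi> where "\<phi> = \<rho>' \<circ> inv_into {..<n} \<rho>"
    have \<phi>: "\<phi> (\<rho> i) = \<rho>' i" if "i < n" for i
      using that b unfolding \<phi>_def bij_betw_def by simp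
    have "bij_betw \<phi> V V" unfolding \<phi>_def using bij_betw_trans[OF bij_betw_inv_into[OF b] b'] .
    moreover have "(u, v) \<in> E \<longleftrightarrow> (\<phi> u, \<phi> v) \<in> E" if uv: "u \<in> V" "v \<in> V" for u v
    proof -
      obtain i j where ij: "i < n" "j < n" "u = \<rho> i" "v = \<rho> j"
        using uv b unfolding bij_betw_def by auto
      have "(i, j) \<in> graph_of n E \<rho> \<longleftrightarrow> (i, j) \<in> graph_of n E \<rho>'" using eq by simp
      then show ?thesis using ij \<phi> by (simp add: graph_of_def)
    qed
    ultimately have "is_automorphism V E \<phi>" unfolding is_automorphism_def by blast
    then have id: "\<phi> v = v" if "v \<in> V" for v using asym that unfolding Asym_def by blast
    show "\<rho> = \<rho>'"
    proof (rule PiE_ext)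
      show "\<rho> \<in> {..<n} \<rightarrow>\<^sub>E V" "\<rho>' \<in> {..<n} \<rightarrow>\<^sub>E V" using \<rho> \<rho>' by (auto simp: labellings_def)
      fix i assume i: "i \<in> {..<n}"
      then have "\<rho> i \<in> V" using bij_betwE[OF b] by blast
      then show "\<rho> i = \<rho>' i" using id \<phi> i by fastforce
    qed
  qed
  then show ?thesis unfolding copies_def using card_labellings[OF fin n] by (simp add: card_image)
qed

section \<open>Collisions of row hashes\<close>

definition differing_rows :: "nat \<Rightarrow> (nat \<times> nat) set \<Rightarrow> (nat \<times> nat) set \<Rightarrow> nat set" where
  "differing_rows n x y = {i. i < n \<and> x `` {i} \<noteq> y `` {i}}"

definition collide :: "nat \<Rightarrow> nat \<Rightarrow> (nat \<Rightarrow> nat) \<Rightarrow> (nat \<times> nat) set \<Rightarrow> (nat \<times> nat) set \<Rightarrow> bool" where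
  "collide n q a x y \<longleftrightarrow> (\<forall>i<n. [row_hash x a i = row_hash y a i] (mod int q))"

text \<open>A copy that agrees with x outside the rows D (hence, by symmetry, outside the columns D) is
  determined by the vertices that carry the labels in D.\<close>

lemma card_copies_differing_at:
  assumes inst: "is_instance c V E" and n: "card V = n"
  shows "card {y\<in>copies n V E. differing_rows n x y = D} \<le> n ^ card D"
proof (cases "D \<subseteq> {..<n}")
  case False
  then have "{y\<in>copies n V E. differing_rows n x y = D} = {}" unfolding differing_rows_def by auto
  then show ?thesis by (metis card.empty zero_le)
next
  case True
  have fin: "finite V" and sym: "sym E" using inst by (auto simp: is_instance_def)
  have finD: "finite D" using True finite_subset by blast
  define \<rho> where "\<rho> y = (SOME r. r \<in> labellings n V \<and> graph_of n E r = y)" for y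
  have \<rho>: "\<rho> y \<in> labellings n V \<and> graph_of n E (\<rho> y) = y" if "y \<in> copies n V E" for y
  proof -
    have "\<exists>r. r \<in> labellings n V \<and> graph_of n E r = y" using that by (auto simp: copies_def)
    then show ?thesis unfolding \<rho>_def by (rule someI_ex)
  qed
  have "card {y\<in>copies n V E. differing_rows n x y = D} \<le> card (D \<rightarrow>\<^sub>E V)"
  proof (rule card_inj_on_le)
    show "(\<lambda>y. restrict (\<rho> y) D) ` {y\<in>copies n V E. differing_rows n x y = D} \<subseteq> D \<rightarrow>\<^sub>E V"
      using \<rho> True by (fastforce simp: labellings_def)
    show "finite (D \<rightarrow>\<^sub>E V)" using fin finD by (intro finite_PiE) auto
    show "inj_on (\<lambda>y. restrict (\<rho> y) D) {y\<in>copies n V E. differing_rows n x y = D}"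
    proof (rule inj_onI)
      fix y y' assume y: "y \<in> {y\<in>copies n V E. differing_rows n x y = D}"
        and y': "y' \<in> {y\<in>copies n V E. differing_rows n x y = D}"
        and eq: "restrict (\<rho> y) D = restrict (\<rho> y') D"
      have eqD: "\<rho> y i = \<rho> y' i" if "i \<in> D" for i using eq that by (metis restrict_apply')
      have outD: "(i, j) \<in> y \<longleftrightarrow> (i, j) \<in> y'" if "i < n" "i \<notin> D" for i j
      proof -
        have "x `` {i} = y `` {i}" "x `` {i} = y' `` {i}"
          using that y y' by (auto simp: differing_rows_def)
        then show ?thesis by blast
      qed
      have mem: "(i, j) \<in> z \<longleftrightarrow> i < n \<and> j < n \<and> (\<rho> z i, \<rho> z j) \<in> E" if "z \<in> copies n V E" for z i j
      proof -
        have "(i, j) \<in> graph_of n E (\<rho> z) \<longleftrightarrow> i < n \<and> j < n \<and> (\<rho> z i, \<rho> z j) \<in> E"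
          by (simp add: graph_of_def)
        then show ?thesis using \<rho>[OF that] by simp
      qed
      have symz: "(i, j) \<in> z \<longleftrightarrow> (j, i) \<in> z" if "z \<in> copies n V E" for z i j
        unfolding mem[OF that] using sym by (auto dest: symD)
      have "(i, j) \<in> y \<longleftrightarrow> (i, j) \<in> y'" if ij: "i < n" "j < n" for i j
      proof (cases "i \<in> D \<and> j \<in> D")
        case True
        then show ?thesis using mem[of y] mem[of y'] y y' eqD by simp
      next
        case False
        then show ?thesis using outD[of i j] outD[of j i] symz[of y] symz[of y'] y y' ij by blast
      qed
      then show "y = y'" using mem[of y] mem[of y'] y y' by auto
    qed
  qed
  also have "\<dots> = n ^ card D" using finD n by (simp add: card_PiE)
  finally show ?thesis .
qed

lemma sum_Pow_power:
  fixes r :: real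
  assumes "finite A"
  shows "(\<Sum>D\<in>Pow A. r ^ card D) = (1 + r) ^ card A"
  using prod_add[OF assms, of "\<lambda>_. r" "\<lambda>_. 1"] by (simp add: add.commute)

lemma card_mod_preimage_le:
  fixes q Q :: nat
  assumes "finite B" "finite Y"
  shows "card {\<beta> \<in> B \<rightarrow>\<^sub>E {..<Q}. restrict (\<lambda>i. \<beta> i mod q) B \<in> Y} \<le> card Y * (Q div q + 1) ^ card B"
proof -
  have "{\<beta> \<in> B \<rightarrow>\<^sub>E {..<Q}. restrict (\<lambda>i. \<beta> i mod q) B \<in> Y}
     \<subseteq> (\<Union>u\<in>Y. {\<beta> \<in> B \<rightarrow>\<^sub>E {..<Q}. \<forall>i\<in>B. \<beta> i mod q \<in> {u i}})" by auto
  then have "card {\<beta> \<in> B \<rightarrow>\<^sub>E {..<Q}. restrict (\<lambda>i. \<beta> i mod q) B \<in> Y}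
     \<le> card (\<Union>u\<in>Y. {\<beta> \<in> B \<rightarrow>\<^sub>E {..<Q}. \<forall>i\<in>B. \<beta> i mod q \<in> {u i}})"
    using assms by (intro card_mono finite_UN_I finite_subset[OF _ finite_PiE[of B "\<lambda>_. {..<Q}"]]) auto
  also have "\<dots> \<le> (\<Sum>u\<in>Y. card {\<beta> \<in> B \<rightarrow>\<^sub>E {..<Q}. \<forall>i\<in>B. \<beta> i mod q \<in> {u i}})"
    by (rule card_UN_le[OF assms(2)])
  also have "\<dots> \<le> (\<Sum>u\<in>Y. (Q div q + 1) ^ card B)"
  proof (rule sum_mono)
    fix u
    have "card {\<beta> \<in> B \<rightarrow>\<^sub>E {..<Q}. \<forall>i\<in>B. \<beta> i mod q \<in> {u i}} = (\<Prod>i\<in>B. card {c \<in> {..<Q}. c mod q \<in> {u i}})"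
      by (rule card_PiE_box[OF assms(1)])
    also have "\<dots> \<le> (\<Prod>i\<in>B. Q div q + 1)"
      using card_residues_le[of "{u _}" Q q] by (intro prod_mono) auto
    finally show "card {\<beta> \<in> B \<rightarrow>\<^sub>E {..<Q}. \<forall>i\<in>B. \<beta> i mod q \<in> {u i}} \<le> (Q div q + 1) ^ card B" by simp
  qed
  finally show ?thesis by simp
qed

section \<open>The probability of lucky coins\<close>

context hash_parameters
begin

lemma card_lucky_le:
  assumes inst: "is_instance c V E" and n: "card V = n" and sym: "\<not> Asym V E"
  shows "real (card {\<omega> \<in> {..<25 * n} \<rightarrow>\<^sub>E {..<Q}. lucky n q W V E \<omega>}) \<le> real Q ^ (25 * n) / 4"
proof -
  let ?\<Omega> = "{..<25 * n} \<rightarrow>\<^sub>E {..<Q}" and ?XS = "{..<8::nat} \<rightarrow>\<^sub>E copies n V E"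
  have fin: "finite V" using inst by (simp add: is_instance_def)
  have finC: "finite (copies n V E)" unfolding copies_def using finite_labellings[OF fin] by simp
  have finX: "finite ?XS" using finC by (intro finite_PiE) auto
  let ?K = "Q ^ (17 * n) * ((\<Prod>m<8 * n. W m) * (Q div q + 1) ^ (8 * n))"
  have un: "{\<omega> \<in> ?\<Omega>. lucky n q W V E \<omega>} = (\<Union>X\<in>?XS. {\<omega> \<in> ?\<Omega>. hits n q W (tuple_hash n X \<omega>) \<omega>})"
    unfolding lucky_def by auto
  have "card {\<omega> \<in> ?\<Omega>. lucky n q W V E \<omega>} \<le> (\<Sum>X\<in>?XS. card {\<omega> \<in> ?\<Omega>. hits n q W (tuple_hash n X \<omega>) \<omega>})"
    unfolding un by (rule card_UN_le[OF finX])
  also have "\<dots> \<le> (\<Sum>X\<in>?XS. ?K)" by (rule sum_mono) (rule card_hits_copy)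
  also have "\<dots> = card (copies n V E) ^ 8 * ?K" by (simp add: card_PiE)
  finally have "real (card {\<omega> \<in> ?\<Omega>. lucky n q W V E \<omega>}) \<le> real (card (copies n V E) ^ 8 * ?K)"
    by (rule of_nat_mono)
  also have "\<dots> = real (card (copies n V E)) ^ 8 * real ?K" by simp
  also have "\<dots> \<le> (fact n / 2) ^ 8 * real ?K"
  proof (intro mult_right_mono power_mono of_nat_0_le_iff)
    have "real (2 * card (copies n V E)) \<le> real (fact n)"
      using card_copies_symmetric[OF inst n sym] of_nat_mono by blast
    then show "real (card (copies n V E)) \<le> fact n / 2" by simp
  qed
  \<comment> \<open>Here 256 is 2^8. With at most 32 for the remaining product this leaves 1/8, and
    the bias of the 8 n offsets raises it to 1/4.\<close>
  also have "\<dots> = (real (\<Prod>m<8 * n. W m) * fact n ^ 8) * (real Q ^ (17 * n) * real (Q div q + 1) ^ (8 * n)) / 256"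
    by (simp add: power_divide)
  also have "\<dots> \<le> (32 * real q ^ (8 * n)) * (real Q ^ (17 * n) * real (Q div q + 1) ^ (8 * n)) / 256"
    by (intro divide_right_mono mult_right_mono W_upper) auto
  also have "\<dots> = real Q ^ (17 * n) * real ((Q div q + 1) * q) ^ (8 * n) / 8"
    by (simp only: of_nat_mult power_mult_distrib) simp
  also have "\<dots> \<le> real Q ^ (17 * n) * (2 * real Q ^ (8 * n)) / 8"
    by (intro divide_right_mono mult_left_mono fibre_power) auto
  also have "\<dots> = real Q ^ (25 * n) / 4"
  proof -
    have "real Q ^ (8 * n) * real Q ^ (17 * n) = real Q ^ (25 * n)" by (simp add: power_add[symmetric])
    then show ?thesis by simp
  qed
  finally show ?thesis .
qed

text \<open>A differing row yields a difference polynomial with coefficients -1, 0 and 1, not all 0,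
  and of degree at most n. The points of different rows are independent, and the factor 2 pays for
  the bias of each coin.\<close>

lemma card_collide_le:
  assumes "x \<subseteq> {..<n} \<times> {..<n}" "y \<subseteq> {..<n} \<times> {..<n}"
  shows "real (card {a \<in> {..<n} \<rightarrow>\<^sub>E {..<Q}. collide n q a x y})
     \<le> real Q ^ n * (2 * real n / real q) ^ card (differing_rows n x y)"
proof -
  let ?D = "differing_rows n x y"
  let ?P = "\<lambda>i c. [(\<Sum>j\<in>x `` {i}. int c ^ j) = (\<Sum>j\<in>y `` {i}. int c ^ j)] (mod int q)"
  have eq: "{a \<in> {..<n} \<rightarrow>\<^sub>E {..<Q}. collide n q a x y} = {a \<in> {..<n} \<rightarrow>\<^sub>E {..<Q}. \<forall>i\<in>{..<n}. ?P i (a i)}"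
    by (rule Collect_cong) (auto simp: collide_def row_hash_def)
  have "real (card {a \<in> {..<n} \<rightarrow>\<^sub>E {..<Q}. collide n q a x y}) = (\<Prod>i<n. real (card {c\<in>{..<Q}. ?P i c}))"
    unfolding eq card_PiE_box[OF finite_lessThan, where P = ?P] by (rule of_nat_prod)
  also have "\<dots> \<le> (\<Prod>i<n. real Q * (if i \<in> ?D then 2 * real n / real q else 1))"
  proof (intro prod_mono conjI)
    fix i assume i: "i \<in> {..<n}"
    show "real (card {c\<in>{..<Q}. ?P i c})
       \<le> real Q * (if i \<in> ?D then 2 * real n / real q else 1)"
    proof (cases "i \<in> ?D")
      case False
      have "card {c\<in>{..<Q}. ?P i c}
        \<le> card {..<Q}" by (intro card_mono) auto
      then show ?thesis using False by simp
    next
      case True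
      define F :: "int poly" where "F = (\<Sum>j\<in>x `` {i}. monom 1 j) - (\<Sum>j\<in>y `` {i}. monom 1 j)"
      have sub: "x `` {i} \<subseteq> {..<n}" "y `` {i} \<subseteq> {..<n}" using assms by auto
      then have f: "finite (x `` {i})" "finite (y `` {i})" using finite_subset by blast+
      have cF: "coeff F j = (if j \<in> x `` {i} then 1 else 0) - (if j \<in> y `` {i} then 1 else 0)" for j
        unfolding F_def using f by (simp add: coeff_sum sum.delta')
      have dF: "degree F \<le> n"
      proof (rule degree_le, intro allI impI)
        fix j assume "n < j"
        then show "coeff F j = 0" unfolding cF using sub by auto
      qed
      obtain j where j: "(j \<in> x `` {i}) \<noteq> (j \<in> y `` {i})" using True unfolding differing_rows_def by blast
      then have "coeff F j = 1 \<or> coeff F j = -1" unfolding cF by auto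
      then have nz: "\<not> (\<forall>j. int q dvd coeff F j)"
        using pq prime_gt_1_nat[of q] by (metis abs_1 abs_minus_cancel int_dvd_int_iff nat_dvd_1_iff_1
            dvd_minus_iff of_nat_1 less_irrefl)
      have "{c\<in>{..<Q}. ?P i c}
         = {c\<in>{..<Q}. int q dvd poly F (int c + 0)}"
        unfolding F_def by (simp add: poly_sum poly_monom cong_iff_dvd_diff)
      then have "card {c\<in>{..<Q}. ?P i c}
         \<le> degree F * (Q div q + 1)" using card_coin_roots[OF pq nz, of Q 0] by simp
      also have "\<dots> \<le> n * (Q div q + 1)" using dF by (rule mult_le_mono1)
      finally have "real (card {c\<in>{..<Q}. ?P i c})
        \<le> real (n * (Q div q + 1))" by (rule of_nat_mono)
      also have "\<dots> = real n * real ((Q div q + 1) * q) / real q" using q0 by (simp add: field_simps)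
      also have "\<dots> \<le> real n * (2 * real Q) / real q"
        using fibre_power[of 1] n2 by (intro divide_right_mono mult_left_mono) auto
      finally show ?thesis using True by (simp add: mult_ac)
    qed
  qed auto
  also have "\<dots> = real Q ^ n * (\<Prod>i<n. if i \<in> ?D then 2 * real n / real q else 1)"
    by (simp add: prod.distrib)
  also have "(\<Prod>i<n. if i \<in> ?D then 2 * real n / real q else 1) = (2 * real n / real q) ^ card ?D"
  proof -
    have "{..<n} \<inter> {i. i \<in> ?D} = ?D" by (auto simp: differing_rows_def)
    then show ?thesis by (simp add: prod.If_cases)
  qed
  finally show ?thesis .
qed

lemma sum_collide_le:
  assumes inst: "is_instance c V E" and n: "card V = n" and x: "x \<in> copies n V E"
  shows "(\<Sum>y\<in>copies n V E - {x}. real (card {a \<in> {..<n} \<rightarrow>\<^sub>E {..<Q}. collide n q a x y})) \<le> real Q ^ n / 2500"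
proof -
  let ?S = "copies n V E" and ?t = "\<lambda>y. (2 * real n / real q) ^ card (differing_rows n x y)"
  have fin: "finite V" using inst by (simp add: is_instance_def)
  have finS: "finite ?S" unfolding copies_def using finite_labellings[OF fin] by simp
  have sq: "y \<subseteq> {..<n} \<times> {..<n}" if "y \<in> ?S" for y using that by (auto simp: copies_def graph_of_def)
  \<comment> \<open>The price of one differing label: a factor n for the vertex that carries it and
    a factor 2n/q for the collision of its row.\<close>
  define r where "r = 2 * real n ^ 2 / real q"
  have r0: "r \<ge> 0" by (simp add: r_def)
  have nr: "real n * r \<le> 1 / 5000"
  proof -
    have "real (10000 * n ^ 3) \<le> real q" using q_large of_nat_mono by blast
    then show ?thesis using q0 by (simp add: r_def field_simps power2_eq_square power3_eq_cube)
  qed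
  have img: "differing_rows n x ` (?S - {x}) \<subseteq> Pow {..<n} - {{}}"
  proof
    fix D assume "D \<in> differing_rows n x ` (?S - {x})"
    then obtain y where y: "y \<in> ?S" "y \<noteq> x" "D = differing_rows n x y" by blast
    have "D \<noteq> {}"
    proof
      assume "D = {}"
      then have "x `` {i} = y `` {i}" if "i < n" for i using that y(3) by (auto simp: differing_rows_def)
      then have "x = y" using sq[OF x] sq[OF y(1)] by blast
      with y show False by simp
    qed
    with y(3) show "D \<in> Pow {..<n} - {{}}" by (auto simp: differing_rows_def)
  qed
  have "(\<Sum>y\<in>?S - {x}. real (card {a \<in> {..<n} \<rightarrow>\<^sub>E {..<Q}. collide n q a x y}))
      \<le> (\<Sum>y\<in>?S - {x}. real Q ^ n * ?t y)"
    by (intro sum_mono card_collide_le sq) (use x in auto)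
  also have "\<dots> = (\<Sum>D\<in>Pow {..<n} - {{}}. \<Sum>y\<in>{y\<in>?S - {x}. differing_rows n x y = D}.
       real Q ^ n * ?t y)"
    by (rule sum.group[symmetric]) (use finS img in auto)
  also have "\<dots> \<le> (\<Sum>D\<in>Pow {..<n} - {{}}. real Q ^ n * r ^ card D)"
  proof (rule sum_mono)
    fix D :: "nat set" assume "D \<in> Pow {..<n} - {{}}"
    have "card {y\<in>?S - {x}. differing_rows n x y = D} \<le> card {y\<in>?S. differing_rows n x y = D}"
      using finS by (intro card_mono) auto
    also have "\<dots> \<le> n ^ card D" by (rule card_copies_differing_at[OF inst n])
    finally have le: "real (card {y\<in>?S - {x}. differing_rows n x y = D}) \<le> real n ^ card D"
      using of_nat_mono by fastforce
    have "(\<Sum>y\<in>{y\<in>?S - {x}. differing_rows n x y = D}. real Q ^ n * ?t y)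
      = real (card {y\<in>?S - {x}. differing_rows n x y = D}) * (real Q ^ n * (2 * real n / real q) ^ card D)"
      by simp
    also have "\<dots> \<le> real n ^ card D * (real Q ^ n * (2 * real n / real q) ^ card D)"
      using le by (intro mult_right_mono) auto
    also have "\<dots> = real Q ^ n * r ^ card D"
      unfolding r_def by (simp add: power_mult_distrib[symmetric] power2_eq_square mult_ac)
    finally show "(\<Sum>y\<in>{y\<in>?S - {x}. differing_rows n x y = D}. real Q ^ n * ?t y)
      \<le> real Q ^ n * r ^ card D" .
  qed
  also have "\<dots> = real Q ^ n * ((1 + r) ^ n - 1)"
  proof -
    have "(\<Sum>D\<in>Pow {..<n}. r ^ card D) = (1 + r) ^ n" using sum_Pow_power[of "{..<n}" r] by simp
    then have "(\<Sum>D\<in>Pow {..<n} - {{}}. r ^ card D) = (1 + r) ^ n - 1"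
      by (subst sum_diff1) auto
    then show ?thesis by (simp add: sum_distrib_left[symmetric])
  qed
  also have "\<dots> \<le> real Q ^ n * (1 / 2500)"
  proof (intro mult_left_mono)
    have "(1 + r) ^ n \<le> 1 + 2 * real n * r" using r0 nr by (intro power_one_plus_le) auto
    then show "(1 + r) ^ n - 1 \<le> 1 / 2500" using nr by simp
  qed auto
  finally show ?thesis by simp
qed

text \<open>The points are fixed here; only Toeplitz entries and offsets are random. After the
  colliding copies have been dropped, different 8-tuples have different hashes, so their hits are
  pairwise independent in the sense needed for the second moment bound.\<close>

lemma card_unlucky_given_rows:
  assumes inst: "is_instance c V E" and n: "card V = n" and asym: "Asym V E"
    and good: "16 * card {x\<in>copies n V E. \<exists>y\<in>copies n V E. y \<noteq> x \<and> collide n q \<alpha> x y} \<le> card (copies n V E)"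
  shows "real (card {\<beta> \<in> {n..<25 * n} \<rightarrow>\<^sub>E {..<Q}. \<not> lucky n q W V E (\<lambda>i. if i \<in> {..<n} then \<alpha> i else \<beta> i)})
     \<le> real Q ^ (24 * n) / 4"
proof -
  let ?S = "copies n V E" and ?B = "{n..<25 * n}" and ?m = "\<lambda>\<beta> i. if i \<in> {..<n} then \<alpha> i else \<beta> i"
  have fin: "finite V" using inst by (simp add: is_instance_def)
  have finS: "finite ?S" unfolding copies_def using finite_labellings[OF fin] by simp
  define S' where "S' = ?S - {x\<in>?S. \<exists>y\<in>?S. y \<noteq> x \<and> collide n q \<alpha> x y}"
  have fS': "finite S'" "S' \<subseteq> ?S" unfolding S'_def using finS by auto
  have cS: "card ?S = fact n" by (rule card_copies_asymmetric[OF inst n asym])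
  have cS': "real (card S') \<ge> 15 / 16 * fact n"
  proof -
    have "card S' = card ?S - card {x\<in>?S. \<exists>y\<in>?S. y \<noteq> x \<and> collide n q \<alpha> x y}"
      unfolding S'_def using finS by (intro card_Diff_subset) auto
    then have "15 * card ?S \<le> 16 * card S'" using good by simp
    then have "real (15 * card ?S) \<le> real (16 * card S')" using of_nat_mono by blast
    then show ?thesis by (simp add: cS)
  qed
  define Z where "Z = {..<8::nat} \<rightarrow>\<^sub>E S'"
  define U where "U = ?B \<rightarrow>\<^sub>E {..<q}"
  define A where "A X = {u \<in> U. hits n q W (tuple_hash n X \<alpha>) u}" for X
  define P where "P = real (\<Prod>m<8 * n. W m)"
  define \<delta> where "\<delta> = P / real q ^ (8 * n)"
  have fU: "finite U" unfolding U_def by (intro finite_PiE) auto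
  have cU: "card U = q ^ (24 * n)" unfolding U_def by (simp add: card_PiE)
  have fZ: "finite Z" unfolding Z_def using fS' by (intro finite_PiE) auto
  have S'0: "S' \<noteq> {}"
  proof
    assume "S' = {}"
    then have "15 / 16 * fact n \<le> (0 :: real)" using cS' by simp
    then show False using fact_gt_zero[of n, where ?'a = real] by linarith
  qed
  \<comment> \<open>Since (15/16)^8 > 1/2, at least n!^8 / 2 tuples survive and the mean stays at
    least 8. A miss then has probability at most 1/8 for uniform residues, and at most 1/4 for
    coins.\<close>
  have cZ: "real (card Z) \<ge> fact n ^ 8 / 2"
  proof -
    have "fact n ^ 8 / 2 \<le> (15 / 16 :: real) ^ 8 * fact n ^ 8" by (simp add: power_divide)
    also have "\<dots> = (15 / 16 * fact n) ^ 8" by (simp only: power_mult_distrib)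
    also have "\<dots> \<le> real (card S') ^ 8" using cS' by (intro power_mono) auto
    finally show ?thesis by (simp add: Z_def card_PiE)
  qed
  have P0: "P > 0" unfolding P_def using W_range(1) by (auto intro!: prod_pos simp: less_eq_Suc_le)
  have qp: "real q ^ k > 0" for k using q0 by simp
  have mu: "\<delta> * card Z \<ge> 8"
  proof -
    have "8 \<le> P * fact n ^ 8 / real q ^ (8 * n) / 2" using W_lower qp[of "8 * n"] by (simp add: P_def field_simps)
    also have "\<dots> = \<delta> * (fact n ^ 8 / 2)" by (simp add: \<delta>_def)
    also have "\<dots> \<le> \<delta> * card Z" using cZ P0 qp by (intro mult_left_mono) (auto simp: \<delta>_def)
    finally show ?thesis .
  qed
  let ?UA = "\<Union>X\<in>Z. A X"
  have "real (card (U - ?UA)) * (\<delta> * card Z) \<le> card U"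
  proof (rule card_avoiding_le[OF fU fZ])
    show "Z \<noteq> {}" unfolding Z_def using S'0 by (simp add: PiE_eq_empty_iff)
    show "\<delta> > 0" unfolding \<delta>_def using P0 qp by simp
    show "A X \<subseteq> U" for X unfolding A_def by auto
    have "card (A X) = q ^ (16 * n) * (\<Prod>m<8 * n. W m)" for X
      unfolding A_def U_def by (rule card_hits_uniform)
    then have "real (card (A X)) = real q ^ (16 * n) * P" for X by (simp add: P_def)
    also have "real q ^ (16 * n) * P = P / real q ^ (8 * n) * real q ^ (24 * n)"
      using qp[of "8 * n"] power_add[of "real q" "16 * n" "8 * n"] by (simp add: field_simps)
    finally show "real (card (A X)) = \<delta> * card U" for X by (simp add: \<delta>_def cU)
  next
    fix X X' assume X: "X \<in> Z" "X' \<in> Z" "X \<noteq> X'"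
    then obtain s where s: "s < 8" "X s \<noteq> X' s" unfolding Z_def by (metis PiE_ext lessThan_iff)
    have Xs: "X s \<in> S'" "X' s \<in> S'" using X s unfolding Z_def by auto
    then have "\<not> collide n q \<alpha> (X s) (X' s)" using s(2) by (auto simp: S'_def)
    then obtain i where i: "i < n" "\<not> [row_hash (X s) \<alpha> i = row_hash (X' s) \<alpha> i] (mod int q)"
      unfolding collide_def by blast
    define m0 where "m0 = s * n + i"
    have dm: "m0 div n = s" "m0 mod n = i" using i(1) unfolding m0_def by simp_all
    have m8: "m0 < 8 * n"
    proof -
      have "m0 < Suc s * n" using i(1) by (simp add: m0_def)
      also have "\<dots> \<le> 8 * n" using s(1) by (intro mult_le_mono1) simp
      finally show ?thesis .
    qed
    have "\<not> [tuple_hash n X \<alpha> m0 = tuple_hash n X' \<alpha> m0] (mod int q)"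
      unfolding tuple_hash_def dm using i(2) .
    from card_hits_pair[where z = "tuple_hash n X \<alpha>" and z' = "tuple_hash n X' \<alpha>", OF m8 this]
    have "card (A X \<inter> A X') \<le> (\<Prod>m<8 * n. W m)\<^sup>2 * q ^ (8 * n)"
      unfolding A_def U_def by (simp add: Collect_conj_eq[symmetric] Int_def conj_ac)
    then have "real (card (A X \<inter> A X')) \<le> real ((\<Prod>m<8 * n. W m)\<^sup>2 * q ^ (8 * n))" by (rule of_nat_mono)
    also have "\<dots> = P\<^sup>2 * real q ^ (8 * n)" by (simp add: P_def)
    also have "\<dots> = \<delta>\<^sup>2 * card U"
    proof -
      have "real q ^ (24 * n) = real q ^ (8 * n) * (real q ^ (8 * n))\<^sup>2"
        by (simp add: power_add[symmetric] power_mult[symmetric])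
      then show ?thesis using qp[of "8 * n"] by (simp add: \<delta>_def cU power_divide)
    qed
    finally show "real (card (A X \<inter> A X')) \<le> \<delta>\<^sup>2 * card U" .
  qed
  moreover have "real (card (U - ?UA)) * 8 \<le> real (card (U - ?UA)) * (\<delta> * card Z)"
    using mu by (intro mult_left_mono) auto
  ultimately have miss: "real (card (U - ?UA)) \<le> real q ^ (24 * n) / 8" by (simp add: cU)
  have th: "tuple_hash n X (?m \<beta>) = tuple_hash n X \<alpha>" for X \<beta>
  proof
    fix m
    have "m mod n < n" using n2 by simp
    then show "tuple_hash n X (?m \<beta>) m = tuple_hash n X \<alpha> m"
      unfolding tuple_hash_def by (intro row_hash_cong) simp
  qed
  have "{\<beta> \<in> ?B \<rightarrow>\<^sub>E {..<Q}. \<not> lucky n q W V E (?m \<beta>)}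
     \<subseteq> {\<beta> \<in> ?B \<rightarrow>\<^sub>E {..<Q}. restrict (\<lambda>i. \<beta> i mod q) ?B \<in> U - ?UA}"
  proof safe
    fix \<beta> assume \<beta>: "\<beta> \<in> ?B \<rightarrow>\<^sub>E {..<Q}" "\<not> lucky n q W V E (?m \<beta>)"
    show "restrict (\<lambda>i. \<beta> i mod q) ?B \<in> U" unfolding U_def using q0 by auto
    fix X assume X: "X \<in> Z" "restrict (\<lambda>i. \<beta> i mod q) ?B \<in> A X"
    then have "hits n q W (tuple_hash n X \<alpha>) (restrict (\<lambda>i. \<beta> i mod q) ?B)" by (simp add: A_def)
    also have "hits n q W (tuple_hash n X \<alpha>) (restrict (\<lambda>i. \<beta> i mod q) ?B)
       \<longleftrightarrow> hits n q W (tuple_hash n X (?m \<beta>)) (?m \<beta>)"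
      unfolding th by (intro hits_cong) (auto simp: cong_def zmod_int)
    finally have "lucky n q W V E (?m \<beta>)"
      using X(1) fS'(2) unfolding lucky_def Z_def by blast
    with \<beta> show False by blast
  qed
  then have "card {\<beta> \<in> ?B \<rightarrow>\<^sub>E {..<Q}. \<not> lucky n q W V E (?m \<beta>)}
     \<le> card {\<beta> \<in> ?B \<rightarrow>\<^sub>E {..<Q}. restrict (\<lambda>i. \<beta> i mod q) ?B \<in> U - ?UA}"
    by (intro card_mono finite_subset[OF _ finite_PiE[of ?B "\<lambda>_. {..<Q}"]]) auto
  also have "\<dots> \<le> card (U - ?UA) * (Q div q + 1) ^ card ?B"
    by (rule card_mod_preimage_le) (use fU in auto)
  finally have "real (card {\<beta> \<in> ?B \<rightarrow>\<^sub>E {..<Q}. \<not> lucky n q W V E (?m \<beta>)})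
     \<le> real (card (U - ?UA) * (Q div q + 1) ^ card ?B)" by (rule of_nat_mono)
  also have "\<dots> = real (card (U - ?UA)) * real (Q div q + 1) ^ (24 * n)" by simp
  also have "\<dots> \<le> real q ^ (24 * n) / 8 * real (Q div q + 1) ^ (24 * n)"
    using miss by (intro mult_right_mono) auto
  also have "\<dots> = real ((Q div q + 1) * q) ^ (24 * n) / 8"
    by (simp only: of_nat_mult power_mult_distrib) simp
  also have "\<dots> \<le> (2 * real Q ^ (24 * n)) / 8" by (intro divide_right_mono fibre_power) auto
  finally show ?thesis by simp
qed

text \<open>Markov's inequality for the number of colliding copies: its mean is at most 1/2500 of
  all copies, so it exceeds 1/16 of them with probability at most 16/2500 <= 1/50. Together with the
  1/4 for good points this is 27/100.\<close>

lemma card_unlucky_le: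
  assumes inst: "is_instance c V E" and n: "card V = n" and asym: "Asym V E"
  shows "real (card {\<omega> \<in> {..<25 * n} \<rightarrow>\<^sub>E {..<Q}. \<not> lucky n q W V E \<omega>}) \<le> 3 / 10 * real Q ^ (25 * n)"
proof -
  let ?S = "copies n V E" and ?A = "{..<n} \<rightarrow>\<^sub>E {..<Q}" and ?B = "{n..<25 * n}"
  have fin: "finite V" using inst by (simp add: is_instance_def)
  have finS: "finite ?S" unfolding copies_def using finite_labellings[OF fin] by simp
  have fA: "finite ?A" by (intro finite_PiE) auto
  have cA: "card ?A = Q ^ n" by (simp add: card_PiE)
  define bad where "bad a = {x\<in>?S. \<exists>y\<in>?S. y \<noteq> x \<and> collide n q a x y}" for a
  define M where "M = {a\<in>?A. \<not> 16 * card (bad a) \<le> card ?S}"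
  have S0: "card ?S > 0" using card_copies_asymmetric[OF inst n asym] by simp
  have "real (card M) * (card ?S / 16) = (\<Sum>a\<in>M. card ?S / 16)" by simp
  also have "\<dots> \<le> (\<Sum>a\<in>M. real (card (bad a)))"
    by (intro sum_mono) (auto simp: M_def)
  also have "\<dots> \<le> (\<Sum>a\<in>?A. real (card (bad a)))"
    by (rule sum_mono2) (use fA in \<open>auto simp: M_def\<close>)
  also have "\<dots> \<le> (\<Sum>a\<in>?A. \<Sum>x\<in>?S. \<Sum>y\<in>?S - {x}. if collide n q a x y then 1 else 0)"
  proof (rule sum_mono)
    fix a
    have "real (card (bad a)) = (\<Sum>x\<in>?S. if x \<in> bad a then 1 else 0)"
      using finS by (simp add: sum.If_cases bad_def Int_def)
    also have "\<dots> \<le> (\<Sum>x\<in>?S. \<Sum>y\<in>?S - {x}. if collide n q a x y then 1 else 0)"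
    proof (rule sum_mono)
      fix x
      show "(if x \<in> bad a then 1 else 0 :: real) \<le> (\<Sum>y\<in>?S - {x}. if collide n q a x y then 1 else 0)"
      proof (cases "x \<in> bad a")
        case True
        then obtain y where y: "y \<in> ?S - {x}" "collide n q a x y" unfolding bad_def by blast
        have "(if collide n q a x y then 1 else 0 :: real) \<le> (\<Sum>y\<in>?S - {x}. if collide n q a x y then 1 else 0)"
          by (rule member_le_sum[OF y(1)]) (use finS in auto)
        then show ?thesis using True y by simp
      next
        case False
        then show ?thesis by (simp add: sum_nonneg)
      qed
    qed
    finally show "real (card (bad a)) \<le> (\<Sum>x\<in>?S. \<Sum>y\<in>?S - {x}. if collide n q a x y then 1 else 0)" .
  qed
  also have "\<dots> = (\<Sum>x\<in>?S. \<Sum>a\<in>?A. \<Sum>y\<in>?S - {x}. if collide n q a x y then 1 else 0)" by (rule sum.swap)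
  also have "\<dots> = (\<Sum>x\<in>?S. \<Sum>y\<in>?S - {x}. \<Sum>a\<in>?A. if collide n q a x y then 1 else 0)"
    by (intro sum.cong refl sum.swap)
  also have "\<dots> = (\<Sum>x\<in>?S. \<Sum>y\<in>?S - {x}. real (card {a\<in>?A. collide n q a x y}))"
    using fA by (simp add: sum.If_cases Int_def)
  also have "\<dots> \<le> (\<Sum>x\<in>?S. real Q ^ n / 2500)"
    by (rule sum_mono) (rule sum_collide_le[OF inst n])
  also have "\<dots> = real Q ^ n / 2500 * card ?S" by simp
  finally have "real (card M) / 16 * card ?S \<le> real Q ^ n / 2500 * card ?S" by simp
  then have cM: "real (card M) \<le> real Q ^ n / 50" using S0 by (simp add: mult_le_cancel_right)
  have fB: "finite (?B \<rightarrow>\<^sub>E {..<Q})" by (intro finite_PiE) auto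
  have u: "{..<25 * n} = {..<n} \<union> ?B" by auto
  have "real (card {\<omega> \<in> {..<25 * n} \<rightarrow>\<^sub>E {..<Q}. \<not> lucky n q W V E \<omega>})
    = (\<Sum>\<alpha>\<in>?A. real (card {\<beta> \<in> ?B \<rightarrow>\<^sub>E {..<Q}. \<not> lucky n q W V E (\<lambda>i. if i \<in> {..<n} then \<alpha> i else \<beta> i)}))"
    unfolding u by (subst card_PiE_split) auto
  also have "\<dots> \<le> (\<Sum>\<alpha>\<in>?A. (if \<alpha> \<in> M then real Q ^ (24 * n) else 0) + real Q ^ (24 * n) / 4)"
  proof (rule sum_mono)
    fix \<alpha> assume \<alpha>: "\<alpha> \<in> ?A"
    show "real (card {\<beta> \<in> ?B \<rightarrow>\<^sub>E {..<Q}. \<not> lucky n q W V E (\<lambda>i. if i \<in> {..<n} then \<alpha> i else \<beta> i)})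
      \<le> (if \<alpha> \<in> M then real Q ^ (24 * n) else 0) + real Q ^ (24 * n) / 4"
    proof (cases "\<alpha> \<in> M")
      case False
      then show ?thesis
        using card_unlucky_given_rows[OF inst n asym, of \<alpha>] \<alpha> by (simp add: M_def bad_def)
    next
      case True
      have "card {\<beta> \<in> ?B \<rightarrow>\<^sub>E {..<Q}. \<not> lucky n q W V E (\<lambda>i. if i \<in> {..<n} then \<alpha> i else \<beta> i)}
         \<le> card (?B \<rightarrow>\<^sub>E {..<Q})" by (intro card_mono fB) auto
      also have "\<dots> = Q ^ (24 * n)" by (simp add: card_PiE)
      finally have "real (card {\<beta> \<in> ?B \<rightarrow>\<^sub>E {..<Q}. \<not> lucky n q W V E (\<lambda>i. if i \<in> {..<n} then \<alpha> i else \<beta> i)})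
         \<le> real Q ^ (24 * n)" using of_nat_mono by fastforce
      then show ?thesis using True by (smt (verit) divide_nonneg_nonneg of_nat_0_le_iff zero_le_power)
    qed
  qed
  also have "\<dots> = real (card M) * real Q ^ (24 * n) + real Q ^ n * (real Q ^ (24 * n) / 4)"
  proof -
    have "?A \<inter> {\<alpha>. \<alpha> \<in> M} = M" by (auto simp: M_def)
    then show ?thesis using fA by (simp add: sum.distrib sum.If_cases cA)
  qed
  also have "\<dots> \<le> real Q ^ n / 50 * real Q ^ (24 * n) + real Q ^ n * (real Q ^ (24 * n) / 4)"
    using cM by (intro add_right_mono mult_right_mono) auto
  also have "\<dots> = 27 / 100 * (real Q ^ n * real Q ^ (24 * n))" by simp
  also have "real Q ^ n * real Q ^ (24 * n) = real Q ^ (25 * n)" by (simp add: power_add[symmetric])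
  also have "27 / 100 * real Q ^ (25 * n) \<le> 3 / 10 * real Q ^ (25 * n)" by (intro mult_right_mono) auto
  finally show ?thesis .
qed

end

section \<open>The protocol\<close>

definition rank :: "nat set \<Rightarrow> nat \<Rightarrow> nat" where
  "rank V v = card {u \<in> V. u < v}"

lemma rank_strict_mono:
  assumes "finite V" "u \<in> V" "u < v"
  shows "rank V u < rank V v"
  unfolding rank_def by (rule psubset_card_mono) (use assms in auto)

lemma rank_bij:
  assumes "finite V"
  shows "bij_betw (rank V) V {..<card V}"
proof -
  have inj: "inj_on (rank V) V"
    by (rule inj_onI) (metis assms rank_strict_mono less_irrefl linorder_neqE_nat)
  have "rank V v < card V" if "v \<in> V" for v
    unfolding rank_def by (rule psubset_card_mono) (use assms that in auto)
  then have "rank V ` V \<subseteq> {..<card V}" by auto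
  moreover have "card (rank V ` V) = card {..<card V}" using inj by (simp add: card_image)
  ultimately have "rank V ` V = {..<card V}" by (intro card_subset_eq) auto
  with inj show ?thesis by (simp add: bij_betw_def)
qed

text \<open>If identifiers increase along consecutive indices, they increase along all of them, so
  the nodes with a smaller identifier are exactly those with a smaller index. Only consecutive pairs
  need a certificate, and a single node can hold that.\<close>

lemma successive_imp_rank:
  assumes fin: "finite V" and b: "bij_betw \<iota> V {..<card V}"
    and succ: "\<And>v w. v \<in> V \<Longrightarrow> w \<in> V \<Longrightarrow> \<iota> w = Suc (\<iota> v) \<Longrightarrow> v < w"
    and v: "v \<in> V"
  shows "\<iota> v = rank V v"
proof -
  define g where "g = inv_into V \<iota>"
  have g: "g i \<in> V" "\<iota> (g i) = i" if "i < card V" for i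
    using that b unfolding g_def bij_betw_def by (auto simp: inv_into_into f_inv_into_f)
  have g\<iota>: "g (\<iota> u) = u" if "u \<in> V" for u using that b unfolding g_def bij_betw_def by simp
  have mono: "g i < g j" if "i < j" "j < card V" for i j
    using that
  proof (induction j)
    case (Suc j)
    have "g j < g (Suc j)" using succ[of "g j" "g (Suc j)"] g Suc.prems by simp
    then show ?case using Suc by (cases "i = j") auto
  qed simp
  have lt: "\<iota> u < card V" if "u \<in> V" for u using that bij_betwE[OF b] by auto
  have "{u \<in> V. u < v} = g ` {..<\<iota> v}"
  proof
    show "{u \<in> V. u < v} \<subseteq> g ` {..<\<iota> v}"
    proof
      fix u assume u: "u \<in> {u \<in> V. u < v}"
      then have "\<iota> u < \<iota> v" using mono[of "\<iota> v" "\<iota> u"] g\<iota> v lt[of u]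
        by (metis (no_types, lifting) linorder_neqE_nat mem_Collect_eq order_less_asym less_irrefl)
      then show "u \<in> g ` {..<\<iota> v}" using g\<iota> u by (metis (no_types, lifting) image_eqI lessThan_iff mem_Collect_eq)
    qed
    show "g ` {..<\<iota> v} \<subseteq> {u \<in> V. u < v}"
    proof
      fix u assume "u \<in> g ` {..<\<iota> v}"
      then obtain i where i: "i < \<iota> v" "u = g i" by auto
      then show "u \<in> {u \<in> V. u < v}" using mono[of i "\<iota> v"] g(1)[of i] g\<iota>[OF v] lt[OF v] by simp
    qed
  qed
  moreover have "inj_on g {..<\<iota> v}"
    by (rule inj_onI) (metis g(2) lessThan_iff lt[OF v] less_trans)
  ultimately show ?thesis by (simp add: rank_def card_image)
qed

section \<open>Polynomials whose coefficients are spread over the nodes\<close>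

text \<open>Positions are cut into \<open>K\<close> blocks of length \<open>n\<close>, and node
  \<open>v\<close> holds the coefficient at place \<open>f e v\<close> of block \<open>e\<close>. If
  every \<open>f e\<close> is a bijection onto {..<n}, each coefficient has exactly one owner; in
  any case a value of the polynomial is a sum over the nodes.\<close>

definition block_poly :: "nat \<Rightarrow> nat \<Rightarrow> nat set \<Rightarrow> (nat \<Rightarrow> nat \<Rightarrow> int) \<Rightarrow> (nat \<Rightarrow> nat \<Rightarrow> nat) \<Rightarrow> int poly" where
  "block_poly n K V h f = (\<Sum>v\<in>V. \<Sum>e<K. monom (h e v) (e * n + f e v))"

lemma poly_block_poly: "poly (block_poly n K V h f) x = (\<Sum>v\<in>V. \<Sum>e<K. h e v * x ^ (e * n + f e v))"
  by (simp add: block_poly_def poly_sum poly_monom)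

lemma block_index_less:
  fixes n :: nat
  assumes "e < K" "i < n" shows "e * n + i < K * n"
proof -
  have "e * n + i < Suc e * n" using assms by simp
  also have "\<dots> \<le> K * n" using assms by (intro mult_le_mono1) simp
  finally show ?thesis .
qed

lemma coeff_block_poly_outside:
  assumes "\<And>e v. e < K \<Longrightarrow> v \<in> V \<Longrightarrow> f e v < n" "K * n \<le> m"
  shows "coeff (block_poly n K V h f) m = 0"
proof -
  have "e * n + f e v \<noteq> m" if "e < K" "v \<in> V" for e v
    using block_index_less[OF that(1) assms(1)[OF that]] assms(2) by simp
  then show ?thesis by (simp add: block_poly_def coeff_sum)
qed

lemma coeff_block_poly:
  assumes "finite V" "\<And>e. e < K \<Longrightarrow> inj_on (f e) V" "\<And>e v. e < K \<Longrightarrow> v \<in> V \<Longrightarrow> f e v < n"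
    and "e < K" "v \<in> V"
  shows "coeff (block_poly n K V h f) (e * n + f e v) = h e v"
proof -
  have iff: "e' * n + f e' v' = e * n + f e v \<longleftrightarrow> e' = e \<and> v' = v" if "e' < K" "v' \<in> V" for e' v'
  proof
    assume eq: "e' * n + f e' v' = e * n + f e v"
    have lt: "f e' v' < n" "f e v < n" using assms that by auto
    have "(e' * n + f e' v') div n = e'" "(e * n + f e v) div n = e" using lt by auto
    with eq have "e' = e" by simp
    moreover from this eq have "f e v' = f e v" by simp
    ultimately show "e' = e \<and> v' = v" using assms(2)[OF assms(4)] that assms(5) by (auto dest: inj_onD)
  qed auto
  have "coeff (block_poly n K V h f) (e * n + f e v)
     = (\<Sum>v'\<in>V. \<Sum>e'<K. if e' = e \<and> v' = v then h e v else 0)"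
    unfolding block_poly_def coeff_sum coeff_monom
    by (intro sum.cong refl) (auto simp: iff)
  also have "\<dots> = (\<Sum>v'\<in>V. if v' = v then h e v else 0)"
    using assms(4) by (intro sum.cong refl) auto
  also have "\<dots> = h e v" using assms by simp
  finally show ?thesis .
qed

lemma degree_block_poly:
  assumes "\<And>e v. e < K \<Longrightarrow> v \<in> V \<Longrightarrow> f e v < n"
  shows "degree (block_poly n K V h f) \<le> K * n"
proof (rule degree_le, intro allI impI)
  fix m assume "K * n < m"
  then show "coeff (block_poly n K V h f) m = 0" using assms by (intro coeff_block_poly_outside) auto
qed

text \<open>It turns bijectivity into a polynomial identity: a label that nobody carries has
  coefficient -1, which is nonzero modulo \<open>q\<close>.\<close>

definition labels_poly :: "nat \<Rightarrow> nat set \<Rightarrow> (nat \<Rightarrow> nat) \<Rightarrow> int poly" where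
  "labels_poly n V f = (\<Sum>v\<in>V. monom 1 (f v)) - (\<Sum>i<n. monom 1 i)"

lemma labels_poly_zero_imp_bij:
  assumes fin: "finite V" and n: "card V = n" and nq: "n < q" and q2: "2 \<le> q" and f: "\<And>v. v \<in> V \<Longrightarrow> f v < n"
    and z: "\<forall>i. int q dvd coeff (labels_poly n V f) i"
  shows "bij_betw f V {..<n}"
proof -
  have "\<exists>v\<in>V. f v = i" if i: "i < n" for i
  proof (rule ccontr)
    assume "\<not> ?thesis"
    then have "(\<Sum>v\<in>V. if f v = i then 1 else 0 :: int) = 0" by (intro sum.neutral) auto
    then have "coeff (labels_poly n V f) i = -1"
      using i by (simp add: labels_poly_def coeff_sum)
    then have "int q dvd 1" using z by (metis dvd_minus_iff)
    then show False using q2 by (simp add: zdvd1_eq)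
  qed
  then have img: "f ` V = {..<n}" using f by auto
  then have "inj_on f V" using fin n by (intro eq_card_imp_inj_on) auto
  with img show ?thesis by (simp add: bij_betw_def)
qed

lemma degree_labels_poly:
  assumes "\<And>v. v \<in> V \<Longrightarrow> f v < n"
  shows "degree (labels_poly n V f) \<le> n"
proof (rule degree_le, intro allI impI)
  fix m assume m: "n < m"
  have "(\<Sum>v\<in>V. if f v = m then 1 else 0 :: int) = 0" using assms m by (intro sum.neutral) fastforce
  then show "coeff (labels_poly n V f) m = 0" using m by (simp add: labels_poly_def coeff_sum)
qed

text \<open>Position i collects the identifier of the node with index i and, negatively, the one
  announced by the node with index i - 1. The two conditions drop the first node, which has no
  predecessor, and the last one, which has no successor.\<close>

definition chain_poly :: "nat \<Rightarrow> nat set \<Rightarrow> (nat \<Rightarrow> nat) \<Rightarrow> (nat \<Rightarrow> nat) \<Rightarrow> int poly" where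
  "chain_poly n V \<iota> nx = (\<Sum>v\<in>V. (if \<iota> v \<noteq> 0 then monom (int v) (\<iota> v) else 0)
      - (if Suc (\<iota> v) \<noteq> n then monom (int (nx v)) (Suc (\<iota> v)) else 0))"

lemma degree_chain_poly:
  assumes "\<And>v. v \<in> V \<Longrightarrow> \<iota> v < n"
  shows "degree (chain_poly n V \<iota> nx) \<le> n"
proof (rule degree_le, intro allI impI)
  fix m assume m: "n < m"
  have "coeff ((if \<iota> v \<noteq> 0 then monom (int v) (\<iota> v) else 0)
      - (if Suc (\<iota> v) \<noteq> n then monom (int (nx v)) (Suc (\<iota> v)) else 0)) m = 0" if "v \<in> V" for v
    using assms[OF that] m by auto
  then show "coeff (chain_poly n V \<iota> nx) m = 0" by (simp only: chain_poly_def coeff_sum sum.neutral_const cong: sum.cong)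
qed

lemma chain_poly_zero_imp_next:
  assumes fin: "finite V" and b: "bij_betw \<iota> V {..<n}" and vw: "v \<in> V" "w \<in> V" "\<iota> w = Suc (\<iota> v)"
    and nq: "\<And>v. v \<in> V \<Longrightarrow> v < q" "\<And>v. v \<in> V \<Longrightarrow> nx v < q"
    and z: "\<forall>i. int q dvd coeff (chain_poly n V \<iota> nx) i"
  shows "nx v = w"
proof -
  have inj: "\<iota> u = \<iota> u' \<longleftrightarrow> u = u'" if "u \<in> V" "u' \<in> V" for u u'
    using b that unfolding bij_betw_def by (auto dest: inj_onD)
  have wn: "\<iota> w < n" using bij_betwE[OF b] vw by auto
  have w0: "\<iota> w \<noteq> 0" using vw by simp
  have 1: "(\<Sum>u\<in>V. if \<iota> u \<noteq> 0 \<and> \<iota> u = \<iota> w then int u else 0) = int w"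
  proof -
    have "(\<Sum>u\<in>V. if \<iota> u \<noteq> 0 \<and> \<iota> u = \<iota> w then int u else 0) = (\<Sum>u\<in>V. if u = w then int u else 0)"
      by (intro sum.cong refl) (use inj[OF _ vw(2)] w0 in auto)
    then show ?thesis using fin vw by simp
  qed
  have 2: "(\<Sum>u\<in>V. if Suc (\<iota> u) \<noteq> n \<and> Suc (\<iota> u) = \<iota> w then int (nx u) else 0) = int (nx v)"
  proof -
    have "(\<Sum>u\<in>V. if Suc (\<iota> u) \<noteq> n \<and> Suc (\<iota> u) = \<iota> w then int (nx u) else 0) = (\<Sum>u\<in>V. if u = v then int (nx u) else 0)"
      by (intro sum.cong refl) (use inj vw wn in auto)
    then show ?thesis using fin vw by simp
  qed
  have "coeff (chain_poly n V \<iota> nx) (\<iota> w)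
     = (\<Sum>u\<in>V. (if \<iota> u \<noteq> 0 \<and> \<iota> u = \<iota> w then int u else 0)
          - (if Suc (\<iota> u) \<noteq> n \<and> Suc (\<iota> u) = \<iota> w then int (nx u) else 0))"
    unfolding chain_poly_def coeff_sum by (intro sum.cong refl) auto
  also have "\<dots> = int w - int (nx v)" by (simp only: sum_subtractf 1 2)
  finally have "int q dvd int w - int (nx v)" using z by metis
  then have "int w mod int q = int (nx v) mod int q" by (simp add: mod_eq_dvd_iff)
  then show ?thesis using nq vw by simp
qed

lemma bij_betw_label_exists:
  "bij_betw f V {..<n} \<Longrightarrow> i < n \<Longrightarrow> \<exists>v\<in>V. f v = i"
  unfolding bij_betw_def by (metis imageE lessThan_iff)

text \<open>Slots of the decoded strings. Round 1 coins: 0 is the evaluation point of the row hash,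
  1--16 are Toeplitz entries, 17--24 are offsets. Round 2: 0 is the rank, 1 the next identifier,
  2--9 the eight labels, 10--17 the claimed evaluation points of these labels, 18--41 the
  coefficients of the product polynomial. Round 4: 0 is the common evaluation point, 1 the value
  of the hash polynomial there, 2 the parent, 3--23 the partial sums.

  The 21 sums over all nodes that must vanish modulo q test: 0 the evaluation point is the sum of the
  coins, 1 the ranks form a bijection, 2 consecutive ranks belong to consecutive identifiers, 3--10
  the labels form bijections, 11--18 the evaluation points belong to the labels, 19 the value of the
  hash polynomial, 20 the product. Multiplying by n instead of subtracting a constant at one
  distinguished node avoids the need for a root.\<close>

definition local_hash :: "nat set \<Rightarrow> (nat \<Rightarrow> nat) \<Rightarrow> (nat \<Rightarrow> nat \<Rightarrow> nat) \<Rightarrow> nat \<Rightarrow> int" where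
  "local_hash N m1 M1 s = (\<Sum>u\<in>N. int (m1 (10 + s)) ^ M1 u (2 + s))"

definition summand :: "nat \<Rightarrow> nat \<Rightarrow> nat set \<Rightarrow> (nat \<Rightarrow> nat) \<Rightarrow> nat \<Rightarrow> (nat \<Rightarrow> nat) \<Rightarrow> (nat \<Rightarrow> nat \<Rightarrow> nat)
    \<Rightarrow> int \<Rightarrow> int \<Rightarrow> nat \<Rightarrow> int" where
  "summand n v N c1 c m1 M1 r \<zeta> f =
     (if f = 0 then int n * int c - r
      else if f = 1 then int n * r ^ m1 0 - (\<Sum>i<n. r ^ i)
      else if f = 2 then (if m1 0 \<noteq> 0 then int v * r ^ m1 0 else 0)
          - (if Suc (m1 0) \<noteq> n then int (m1 1) * r ^ Suc (m1 0) else 0)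
      else if f < 11 then int n * r ^ m1 (f - 1) - (\<Sum>i<n. r ^ i)
      else if f < 19 then int (m1 (f - 1)) * r ^ m1 (f - 9) - int (c1 0) * r ^ m1 0
      else if f = 19 then int n * (\<Sum>s<8. local_hash N m1 M1 s * r ^ (s * n + m1 (2 + s))) - \<zeta>
      else \<zeta> * (\<Sum>e<16. int (c1 (1 + e)) * r ^ (e * n + m1 0))
          - (\<Sum>e<24. int (m1 (18 + e)) * r ^ (e * n + m1 0)))"

text \<open>Slots 26 to 33 are blocks 8 to 15 of the product polynomial, that is, coefficients 8n to
  16n - 1: the rows of the Toeplitz product. The other blocks are committed to so that the product
  identity can be tested.\<close>

definition first_check :: "nat \<Rightarrow> nat \<Rightarrow> (nat \<Rightarrow> nat) \<Rightarrow> nat \<Rightarrow> (nat \<Rightarrow> nat) \<Rightarrow> (nat \<Rightarrow> nat) \<Rightarrow> bool" where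
  "first_check n q W v c1 m1 \<longleftrightarrow>
     m1 0 < n \<and> m1 1 < q \<and> (Suc (m1 0) < n \<longrightarrow> v < m1 1) \<and> (\<forall>s<8. m1 (2 + s) < n) \<and>
     (\<forall>e<8. (int (m1 (26 + e)) - int (c1 (17 + e))) mod int q < int (W (e * n + m1 0)))"

text \<open>A pointer outside the neighbourhood marks a root. It has nobody to pass its sum to, so
  this sum must vanish. Comparing the two broadcast values with the neighbours makes them global
  because the graph is connected.\<close>

definition second_check :: "nat \<Rightarrow> nat \<Rightarrow> nat \<Rightarrow> nat set \<Rightarrow> (nat \<Rightarrow> nat) \<Rightarrow> nat \<Rightarrow> (nat \<Rightarrow> nat) \<Rightarrow> (nat \<Rightarrow> nat)
    \<Rightarrow> (nat \<Rightarrow> nat \<Rightarrow> nat) \<Rightarrow> (nat \<Rightarrow> nat \<Rightarrow> nat) \<Rightarrow> bool" where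
  "second_check n q v N c1 c m1 m2 M1 M2 \<longleftrightarrow>
     (\<forall>u\<in>N. M2 u 0 = m2 0 \<and> M2 u 1 = m2 1) \<and>
     (\<forall>f<21. [summand n v N c1 c m1 M1 (int (m2 0)) (int (m2 1)) f + (\<Sum>u | u \<in> N \<and> M2 u 2 = v. int (M2 u (3 + f)))
         = (if m2 2 \<in> N then int (m2 (3 + f)) else 0)] (mod int q))"

section \<open>Soundness of the tests for fixed coins of round 1\<close>

locale protocol_instance = hash_parameters +
  fixes c :: nat and V :: "nat set" and E :: "(nat \<times> nat) set"
    and \<omega> :: "nat \<Rightarrow> nat" and c1 :: "nat \<Rightarrow> nat \<Rightarrow> nat"
  assumes inst: "is_instance c V E" and cV: "card V = n" and ids: "n ^ c \<le> q"
    and c1: "\<And>v i. v \<in> V \<Longrightarrow> i < 25 \<Longrightarrow> c1 v i = \<omega> (i * n + rank V v)"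
begin

lemma fV: "finite V" and V0: "V \<noteq> {}" and Esym: "sym E" and EV: "E \<subseteq> V \<times> V"
  using inst by (auto simp: is_instance_def)

lemma id_less: "v \<in> V \<Longrightarrow> v < q" using inst ids cV by (auto simp: is_instance_def)

lemma n_less_q: "n < q"
proof -
  have "n < 10000 * n ^ 1" using n2 by simp
  also have "\<dots> \<le> 10000 * n ^ 3" using n2 by (intro mult_le_mono2 power_increasing) auto
  finally show ?thesis using q_large by simp
qed

lemma rk: "bij_betw (rank V) V {..<n}" using rank_bij[OF fV] cV by simp

lemma rk_less: "v \<in> V \<Longrightarrow> rank V v < n" using bij_betwE[OF rk] by auto

lemma nb: "u \<in> nbrs V E v \<longleftrightarrow> u \<in> V \<and> (v, u) \<in> E" by (simp add: nbrs_def)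

abbreviation hash_poly :: "(nat \<Rightarrow> nat \<Rightarrow> nat) \<Rightarrow> int poly" where
  "hash_poly M1 \<equiv> block_poly n 8 V (\<lambda>s v. local_hash (nbrs V E v) (M1 v) M1 s) (\<lambda>s v. M1 v (2 + s))"

abbreviation coin_poly :: "(nat \<Rightarrow> nat \<Rightarrow> nat) \<Rightarrow> int poly" where
  "coin_poly M1 \<equiv> block_poly n 16 V (\<lambda>e v. int (c1 v (1 + e))) (\<lambda>e v. M1 v 0)"

abbreviation prod_poly :: "(nat \<Rightarrow> nat \<Rightarrow> nat) \<Rightarrow> int poly" where
  "prod_poly M1 \<equiv> block_poly n 24 V (\<lambda>e v. int (M1 v (18 + e))) (\<lambda>e v. M1 v 0)"

abbreviation claims_poly :: "(nat \<Rightarrow> nat \<Rightarrow> nat) \<Rightarrow> nat \<Rightarrow> int poly" where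
  "claims_poly M1 s \<equiv> block_poly n 1 V (\<lambda>e v. int (M1 v (10 + s))) (\<lambda>e v. M1 v (2 + s))
      - block_poly n 1 V (\<lambda>e v. int (c1 v 0)) (\<lambda>e v. M1 v 0)"

text \<open>These polynomials involve the coins of round 1 and the strings of round 2 only, so they
  are fixed before the coins of round 3 are drawn.\<close>

definition identities :: "(nat \<Rightarrow> nat \<Rightarrow> nat) \<Rightarrow> int poly set" where
  "identities M1 = {labels_poly n V (\<lambda>v. M1 v 0), chain_poly n V (\<lambda>v. M1 v 0) (\<lambda>v. M1 v 1),
      hash_poly M1 * coin_poly M1 - prod_poly M1}
     \<union> (\<lambda>s. labels_poly n V (\<lambda>v. M1 v (2 + s))) ` {..<8} \<union> claims_poly M1 ` {..<8}"

lemma degree_identities: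
  assumes chk: "\<And>v. v \<in> V \<Longrightarrow> first_check n q W v (c1 v) (M1 v)" and F: "F \<in> identities M1"
  shows "degree F \<le> 24 * n"
proof -
  have l: "\<And>v. v \<in> V \<Longrightarrow> M1 v 0 < n" "\<And>v s. v \<in> V \<Longrightarrow> s < 8 \<Longrightarrow> M1 v (2 + s) < n"
    using chk by (auto simp: first_check_def)
  have 1: "degree (labels_poly n V (\<lambda>v. M1 v 0)) \<le> n" by (intro degree_labels_poly l)
  have 2: "degree (chain_poly n V (\<lambda>v. M1 v 0) (\<lambda>v. M1 v 1)) \<le> n" by (intro degree_chain_poly l)
  have 3: "degree (hash_poly M1 * coin_poly M1 - prod_poly M1) \<le> 24 * n"
  proof (rule degree_diff_le)
    have "degree (hash_poly M1 * coin_poly M1) \<le> degree (hash_poly M1) + degree (coin_poly M1)"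
      by (rule degree_mult_le)
    also have "\<dots> \<le> 8 * n + 16 * n" by (intro add_mono degree_block_poly l)
    finally show "degree (hash_poly M1 * coin_poly M1) \<le> 24 * n" by simp
    show "degree (prod_poly M1) \<le> 24 * n" by (intro degree_block_poly l)
  qed
  have 4: "degree (labels_poly n V (\<lambda>v. M1 v (2 + s))) \<le> n" if "s < 8" for s
    by (intro degree_labels_poly l that)
  have 5: "degree (claims_poly M1 s) \<le> 1 * n" if "s < 8" for s
    by (intro degree_diff_le degree_block_poly l that)
  show ?thesis using F 1 2 3 4 5 unfolding identities_def by fastforce
qed

text \<open>Node \<open>v\<close> owns the place of its label in each copy, and the labels of its
  neighbours form the corresponding row of \<open>X s\<close>; so the first factor carries the tuple
  hash. The second factor carries the Toeplitz entries, ordered by rank. Equality is modulo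
  \<open>q\<close> because the claimed points are only known modulo \<open>q\<close>. Both soundness
  and the honest prover rest on this.\<close>

lemma coeff_product:
  assumes \<iota>: "\<And>v. v \<in> V \<Longrightarrow> M1 v 0 = rank V v"
    and \<sigma>: "\<And>s. s < 8 \<Longrightarrow> bij_betw (\<lambda>v. M1 v (2 + s)) V {..<n}"
    and \<rho>: "\<And>s v. s < 8 \<Longrightarrow> v \<in> V \<Longrightarrow> \<rho> s (M1 v (2 + s)) = v"
    and X: "\<And>s. s < 8 \<Longrightarrow> X s = graph_of n E (\<rho> s)"
    and \<alpha>: "\<And>s v. s < 8 \<Longrightarrow> v \<in> V \<Longrightarrow> [int (M1 v (10 + s)) = int (\<omega> (M1 v (2 + s)))] (mod int q)"
    and m: "m < 8 * n"
  shows "[coeff (hash_poly M1 * coin_poly M1) (8 * n + m)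
      = toeplitz (8 * n) (tuple_hash n X \<omega>) (\<lambda>i. int (\<omega> (n + i))) m] (mod int q)"
proof -
  have \<sigma>n: "M1 v (2 + s) < n" if "v \<in> V" "s < 8" for v s using bij_betwE[OF \<sigma>] that by auto
  have Z: "[coeff (hash_poly M1) k = tuple_hash n X \<omega> k] (mod int q)" if k: "k < 8 * n" for k
  proof -
    define s where "s = k div n"
    have s: "s < 8" unfolding s_def using k by (simp add: less_mult_imp_div_less)
    have "k mod n < n" using n2 by simp
    then obtain v where v: "v \<in> V" "M1 v (2 + s) = k mod n" using bij_betw_label_exists[OF \<sigma>[OF s]] by blast
    have k': "k = s * n + M1 v (2 + s)" using v by (simp add: s_def)
    have "coeff (hash_poly M1) k = local_hash (nbrs V E v) (M1 v) M1 s"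
      unfolding k' by (rule coeff_block_poly[OF fV _ _ s v(1)]) (use \<sigma> \<sigma>n in \<open>auto simp: bij_betw_def\<close>)
    also have "[\<dots> = (\<Sum>u\<in>nbrs V E v. int (\<omega> (M1 v (2 + s))) ^ M1 u (2 + s))] (mod int q)"
      unfolding local_hash_def by (intro cong_sum cong_pow \<alpha> s v)
    also have "(\<Sum>u\<in>nbrs V E v. int (\<omega> (M1 v (2 + s))) ^ M1 u (2 + s)) = row_hash (X s) \<omega> (k mod n)"
    proof -
      have "X s `` {k mod n} = (\<lambda>u. M1 u (2 + s)) ` nbrs V E v"
      proof
        show "X s `` {k mod n} \<subseteq> (\<lambda>u. M1 u (2 + s)) ` nbrs V E v"
        proof
          fix j assume "j \<in> X s `` {k mod n}"
          then have j: "j < n" "(\<rho> s (k mod n), \<rho> s j) \<in> E" unfolding X[OF s] graph_of_def by auto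
          then obtain u where u: "u \<in> V" "M1 u (2 + s) = j" using bij_betw_label_exists[OF \<sigma>[OF s]] by blast
          have "(v, u) \<in> E" using j(2) \<rho>[OF s v(1)] \<rho>[OF s u(1)] u(2) v(2) by simp
          then show "j \<in> (\<lambda>u. M1 u (2 + s)) ` nbrs V E v" using u nb by blast
        qed
        show "(\<lambda>u. M1 u (2 + s)) ` nbrs V E v \<subseteq> X s `` {k mod n}"
        proof
          fix j assume "j \<in> (\<lambda>u. M1 u (2 + s)) ` nbrs V E v"
          then obtain u where u: "u \<in> V" "(v, u) \<in> E" "j = M1 u (2 + s)" using nb by blast
          have "(\<rho> s (k mod n), \<rho> s j) \<in> E" using u \<rho>[OF s v(1)] \<rho>[OF s u(1)] v(2) by simp
          moreover have "j < n" "k mod n < n" using \<sigma>n u s n2 by auto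
          ultimately show "j \<in> X s `` {k mod n}" unfolding X[OF s] graph_of_def by simp
        qed
      qed
      moreover have "inj_on (\<lambda>u. M1 u (2 + s)) (nbrs V E v)"
        by (rule inj_on_subset[OF bij_betw_imp_inj_on[OF \<sigma>[OF s]]]) (auto simp: nbrs_def)
      ultimately show ?thesis unfolding row_hash_def v(2) by (simp add: sum.reindex)
    qed
    finally show ?thesis unfolding tuple_hash_def s_def .
  qed
  have T: "coeff (coin_poly M1) k = int (\<omega> (n + k))" if k: "k < 16 * n" for k
  proof -
    define e where "e = k div n"
    have e: "e < 16" unfolding e_def using k by (simp add: less_mult_imp_div_less)
    have "k mod n < n" using n2 by simp
    then obtain v where v: "v \<in> V" "rank V v = k mod n" using bij_betw_label_exists[OF rk] by blast
    have k': "k = e * n + M1 v 0" using v \<iota> by (simp add: e_def)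
    have inj: "inj_on (\<lambda>v. M1 v 0) V"
      using bij_betw_imp_inj_on[OF rk] \<iota> by (simp cong: inj_on_cong)
    have "coeff (coin_poly M1) k = int (c1 v (1 + e))"
      unfolding k' by (rule coeff_block_poly[OF fV _ _ e v(1)]) (use inj \<iota> rk_less in auto)
    also have "\<dots> = int (\<omega> ((1 + e) * n + rank V v))" using c1[OF v(1), of "1 + e"] e by simp
    also have "(1 + e) * n + rank V v = n + k" using k' \<iota>[OF v(1)] by simp
    finally show ?thesis .
  qed
  have Z0: "coeff (hash_poly M1) k = 0" if "8 * n \<le> k" for k
    by (rule coeff_block_poly_outside[OF _ that]) (use \<sigma>n in auto)
  have "coeff (hash_poly M1 * coin_poly M1) (8 * n + m)
     = (\<Sum>k\<le>8 * n + m. coeff (hash_poly M1) k * coeff (coin_poly M1) (8 * n + m - k))" by (rule coeff_mult)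
  also have "\<dots> = (\<Sum>k<8 * n. coeff (hash_poly M1) k * coeff (coin_poly M1) (8 * n + m - k))"
    by (rule sum.mono_neutral_right) (use Z0 in auto)
  also have "\<dots> = (\<Sum>k<8 * n. coeff (hash_poly M1) k * int (\<omega> (n + (8 * n + m - k))))"
  proof (intro sum.cong refl)
    fix k assume "k \<in> {..<8 * n}"
    then have "8 * n + m - k < 16 * n" using m by auto
    then show "coeff (hash_poly M1) k * coeff (coin_poly M1) (8 * n + m - k)
      = coeff (hash_poly M1) k * int (\<omega> (n + (8 * n + m - k)))" by (simp only: T)
  qed
  finally have expand: "coeff (hash_poly M1 * coin_poly M1) (8 * n + m)
     = (\<Sum>k<8 * n. coeff (hash_poly M1) k * int (\<omega> (n + (8 * n + m - k))))" .
  show ?thesis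
    unfolding toeplitz_def expand by (intro cong_sum cong_mult cong_refl Z) auto
qed

text \<open>The ranks have to come before everything else, since they fix the index of every coin.
  The labellings follow, then the points that belong to the labels, and finally the product, whose
  middle blocks have passed the box test. The witness consists of the copies given by the inverse
  labellings.\<close>

lemma identities_imp_lucky:
  assumes chk: "\<And>v. v \<in> V \<Longrightarrow> first_check n q W v (c1 v) (M1 v)"
    and id: "\<And>F. F \<in> identities M1 \<Longrightarrow> \<forall>i. int q dvd coeff F i"
  shows "lucky n q W V E \<omega>"
proof -
  have l: "\<And>v. v \<in> V \<Longrightarrow> M1 v 0 < n" "\<And>v. v \<in> V \<Longrightarrow> M1 v 1 < q"
    "\<And>v. v \<in> V \<Longrightarrow> Suc (M1 v 0) < n \<Longrightarrow> v < M1 v 1" "\<And>v s. v \<in> V \<Longrightarrow> s < 8 \<Longrightarrow> M1 v (2 + s) < n"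
    and box: "\<And>v e. v \<in> V \<Longrightarrow> e < 8 \<Longrightarrow>
      (int (M1 v (26 + e)) - int (c1 v (17 + e))) mod int q < int (W (e * n + M1 v 0))"
    using chk by (auto simp: first_check_def)
  have q2: "2 \<le> q" using pq prime_ge_2_nat by blast
  have b\<iota>: "bij_betw (\<lambda>v. M1 v 0) V {..<n}"
    by (rule labels_poly_zero_imp_bij[OF fV cV n_less_q q2 l(1)]) (use id in \<open>auto simp: identities_def\<close>)
  have "v < w" if "v \<in> V" "w \<in> V" "M1 w 0 = Suc (M1 v 0)" for v w
  proof -
    have "M1 v 1 = w"
      using chain_poly_zero_imp_next[OF fV b\<iota> that, of q "\<lambda>v. M1 v 1"] id_less l(2) id
      by (simp add: identities_def)
    then show ?thesis using l(3)[of v] that l(1)[of w] by simp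
  qed
  then have \<iota>: "M1 v 0 = rank V v" if "v \<in> V" for v
    using successive_imp_rank[of V "\<lambda>v. M1 v 0" v] b\<iota> fV cV that by simp
  have \<sigma>: "bij_betw (\<lambda>v. M1 v (2 + s)) V {..<n}" if s: "s < 8" for s
    by (rule labels_poly_zero_imp_bij[OF fV cV n_less_q q2]) (use id s l(4) in \<open>auto simp: identities_def\<close>)
  have \<alpha>: "[int (M1 v (10 + s)) = int (\<omega> (M1 v (2 + s)))] (mod int q)" if s: "s < 8" and v: "v \<in> V" for s v
  proof -
    obtain w where w: "w \<in> V" "M1 w 0 = M1 v (2 + s)"
      using bij_betw_label_exists[OF b\<iota> l(4)[OF v s]] by blast
    have "coeff (block_poly n 1 V (\<lambda>e v. int (M1 v (10 + s))) (\<lambda>e v. M1 v (2 + s))) (0 * n + M1 v (2 + s))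
        = int (M1 v (10 + s))"
      by (rule coeff_block_poly[OF fV _ _ _ v]) (use \<sigma>[OF s] l(4) s in \<open>auto simp: bij_betw_def\<close>)
    moreover have "coeff (block_poly n 1 V (\<lambda>e v. int (c1 v 0)) (\<lambda>e v. M1 v 0)) (0 * n + M1 w 0) = int (c1 w 0)"
      by (rule coeff_block_poly[OF fV _ _ _ w(1)]) (use b\<iota> l(1) in \<open>auto simp: bij_betw_def\<close>)
    moreover have "c1 w 0 = \<omega> (M1 v (2 + s))" using c1[OF w(1), of 0] \<iota>[OF w(1)] w(2) by simp
    ultimately have "coeff (claims_poly M1 s) (M1 v (2 + s)) = int (M1 v (10 + s)) - int (\<omega> (M1 v (2 + s)))"
      using w(2) by simp
    moreover have "claims_poly M1 s \<in> identities M1" using s by (auto simp: identities_def)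
    ultimately show ?thesis using id unfolding cong_iff_dvd_diff by metis
  qed
  define \<rho> where "\<rho> s = restrict (inv_into V (\<lambda>v. M1 v (2 + s))) {..<n}" for s
  have \<rho>: "\<rho> s (M1 v (2 + s)) = v" if "s < 8" "v \<in> V" for s v
    unfolding \<rho>_def using inv_into_f_f[OF bij_betw_imp_inj_on[OF \<sigma>[OF that(1)]] that(2)] l(4)[OF that(2,1)]
    by simp
  define X where "X = restrict (\<lambda>s. graph_of n E (\<rho> s)) {..<8::nat}"
  have "\<rho> s \<in> labellings n V" if "s < 8" for s
    using bij_betw_inv_into[OF \<sigma>[OF that]] unfolding labellings_def \<rho>_def by (auto simp: bij_betw_def)
  then have X: "X \<in> {..<8} \<rightarrow>\<^sub>E copies n V E" unfolding X_def copies_def by auto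
  have "(toeplitz (8 * n) (tuple_hash n X \<omega>) (\<lambda>i. int (\<omega> (n + i))) m - int (\<omega> (17 * n + m))) mod int q < int (W m)"
    if m: "m < 8 * n" for m
  proof -
    define e where "e = m div n"
    have e: "e < 8" unfolding e_def using m by (simp add: less_mult_imp_div_less)
    have "m mod n < n" using n2 by simp
    then obtain v where v: "v \<in> V" "rank V v = m mod n" using bij_betw_label_exists[OF rk] by blast
    have m': "m = e * n + M1 v 0" using v \<iota> by (simp add: e_def)
    have "coeff (prod_poly M1) ((8 + e) * n + M1 v 0) = int (M1 v (18 + (8 + e)))"
      by (rule coeff_block_poly[OF fV _ _ _ v(1)]) (use b\<iota> l(1) e in \<open>auto simp: bij_betw_def\<close>)
    moreover have "(8 + e) * n + M1 v 0 = 8 * n + m" using m' by (simp add: algebra_simps)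
    ultimately have Y: "coeff (prod_poly M1) (8 * n + m) = int (M1 v (26 + e))" by simp
    have "hash_poly M1 * coin_poly M1 - prod_poly M1 \<in> identities M1" unfolding identities_def by blast
    from id[OF this] have "int q dvd coeff (hash_poly M1 * coin_poly M1 - prod_poly M1) (8 * n + m)" by blast
    then have "[int (M1 v (26 + e)) = coeff (hash_poly M1 * coin_poly M1) (8 * n + m)] (mod int q)"
      using Y by (simp add: cong_iff_dvd_diff dvd_diff_commute)
    also have "[coeff (hash_poly M1 * coin_poly M1) (8 * n + m)
       = toeplitz (8 * n) (tuple_hash n X \<omega>) (\<lambda>i. int (\<omega> (n + i))) m] (mod int q)"
      by (rule coeff_product[OF \<iota> \<sigma> \<rho> _ \<alpha> m]) (auto simp: X_def)
    finally have "[int (M1 v (26 + e)) - int (c1 v (17 + e))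
      = toeplitz (8 * n) (tuple_hash n X \<omega>) (\<lambda>i. int (\<omega> (n + i))) m - int (c1 v (17 + e))] (mod int q)"
      by (intro cong_diff cong_refl)
    moreover have "c1 v (17 + e) = \<omega> (17 * n + m)"
      using c1[OF v(1), of "17 + e"] e m' \<iota>[OF v(1)] by (simp add: algebra_simps)
    ultimately show ?thesis using box[OF v(1) e] m' by (simp add: cong_def)
  qed
  then have "hits n q W (tuple_hash n X \<omega>) \<omega>" unfolding hits_def by blast
  with X show ?thesis unfolding lucky_def by blast
qed

text \<open>Every partial sum is passed to exactly one neighbour, so the local equations telescope; it is
  irrelevant whether the parent pointers form a tree.\<close>

lemma sum_summand:
  assumes chk: "\<And>v. v \<in> V \<Longrightarrow> second_check n q v (nbrs V E v) (c1 v) (C v) (M1 v) (M2 v) M1 M2"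
    and v0: "v0 \<in> V" and f: "f < 21"
  shows "int q dvd (\<Sum>v\<in>V. summand n v (nbrs V E v) (c1 v) (C v) (M1 v) M1 (int (M2 v0 0)) (int (M2 v0 1)) f)"
proof -
  have const: "M2 v 0 = M2 v0 0 \<and> M2 v 1 = M2 v0 1" if "v \<in> V" for v
  proof -
    have "(v0, v) \<in> E\<^sup>*" using inst v0 that by (auto simp: is_instance_def)
    then show ?thesis
    proof (induction rule: rtrancl_induct)
      case (step y z)
      then have "y \<in> V" "z \<in> nbrs V E y" using EV by (auto simp: nb)
      then have "M2 z 0 = M2 y 0 \<and> M2 z 1 = M2 y 1" using chk[of y] unfolding second_check_def by blast
      with step.IH show ?case by simp
    qed simp
  qed
  let ?val = "\<lambda>v. summand n v (nbrs V E v) (c1 v) (C v) (M1 v) M1 (int (M2 v0 0)) (int (M2 v0 1)) f"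
  let ?S = "\<lambda>v. int (M2 v (3 + f))"
  have "[(\<Sum>v\<in>V. ?val v + (\<Sum>u | u \<in> nbrs V E v \<and> M2 u 2 = v. ?S u))
      = (\<Sum>v\<in>V. if M2 v 2 \<in> nbrs V E v then ?S v else 0)] (mod int q)"
  proof (rule cong_sum)
    fix v assume v: "v \<in> V"
    show "[?val v + (\<Sum>u | u \<in> nbrs V E v \<and> M2 u 2 = v. ?S u) = (if M2 v 2 \<in> nbrs V E v then ?S v else 0)] (mod int q)"
      using chk[OF v] f const[OF v] unfolding second_check_def by auto
  qed
  moreover have "(\<Sum>v\<in>V. \<Sum>u | u \<in> nbrs V E v \<and> M2 u 2 = v. ?S u) = (\<Sum>v\<in>V. if M2 v 2 \<in> nbrs V E v then ?S v else 0)"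
  proof -
    have "(\<Sum>v\<in>V. \<Sum>u | u \<in> nbrs V E v \<and> M2 u 2 = v. ?S u)
        = (\<Sum>v\<in>V. \<Sum>u\<in>V. if (u, v) \<in> E \<and> M2 u 2 = v then ?S u else 0)"
    proof (rule sum.cong[OF refl])
      fix v assume "v \<in> V"
      have "{u. u \<in> nbrs V E v \<and> M2 u 2 = v} = {u \<in> V. (u, v) \<in> E \<and> M2 u 2 = v}"
        using Esym by (auto simp: nb dest: symD)
      then show "(\<Sum>u | u \<in> nbrs V E v \<and> M2 u 2 = v. ?S u) = (\<Sum>u\<in>V. if (u, v) \<in> E \<and> M2 u 2 = v then ?S u else 0)"
        using sum.inter_filter[OF fV, of ?S "\<lambda>u. (u, v) \<in> E \<and> M2 u 2 = v"] by simp
    qed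
    also have "\<dots> = (\<Sum>u\<in>V. \<Sum>v\<in>V. if (u, v) \<in> E \<and> M2 u 2 = v then ?S u else 0)" by (rule sum.swap)
    also have "\<dots> = (\<Sum>u\<in>V. if M2 u 2 \<in> nbrs V E u then ?S u else 0)"
    proof (rule sum.cong[OF refl])
      fix u assume "u \<in> V"
      have "(\<Sum>v\<in>V. if (u, v) \<in> E \<and> M2 u 2 = v then ?S u else 0)
         = (\<Sum>v\<in>V. if M2 u 2 = v then (if (u, v) \<in> E then ?S u else 0) else 0)"
        by (intro sum.cong refl) auto
      also have "\<dots> = (if M2 u 2 \<in> V then (if (u, M2 u 2) \<in> E then ?S u else 0) else 0)"
        by (rule sum.delta'[OF fV])
      finally show "(\<Sum>v\<in>V. if (u, v) \<in> E \<and> M2 u 2 = v then ?S u else 0)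
         = (if M2 u 2 \<in> nbrs V E u then ?S u else 0)" by (simp add: nb)
    qed
    finally show ?thesis .
  qed
  ultimately show ?thesis by (simp add: sum.distrib cong_iff_dvd_diff)
qed

lemma dvd_cancel_n: "int q dvd int n * x \<Longrightarrow> int q dvd x"
proof -
  assume "int q dvd int n * x"
  moreover have "\<not> int q dvd int n" using n_less_q n2 by (auto dest: zdvd_imp_le)
  ultimately show ?thesis using pq prime_dvd_multD[of "int q" "int n" x] by simp
qed

lemma poly_labels_poly:
  "(\<Sum>v\<in>V. int n * x ^ f v - (\<Sum>i<n. x ^ i)) = int n * poly (labels_poly n V f) x"
  by (simp add: labels_poly_def poly_sum poly_monom sum_subtractf cV sum_distrib_left algebra_simps)

text \<open>Each vanishing sum is read as a value of \<open>F\<close> at the common point. A product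
  of two sums over the nodes is no sum over the nodes; therefore the value of the hash polynomial is
  broadcast as \<open>\<zeta>\<close> and tested by a sum of its own, after which the product
  identity is linear in the data of the nodes.\<close>

lemma checks_imp_root:
  assumes chk: "\<And>v. v \<in> V \<Longrightarrow> second_check n q v (nbrs V E v) (c1 v) (C v) (M1 v) (M2 v) M1 M2"
    and F: "F \<in> identities M1"
  shows "int q dvd poly F (\<Sum>v\<in>V. int (C v))"
proof -
  obtain v0 where v0: "v0 \<in> V" using V0 by blast
  define r where "r = int (M2 v0 0)"
  define \<zeta> where "\<zeta> = int (M2 v0 1)"
  note sums = sum_summand[OF chk v0, folded r_def \<zeta>_def]
  have r: "[r = (\<Sum>v\<in>V. int (C v))] (mod int q)"
  proof -
    have "int q dvd (\<Sum>v\<in>V. int n * int (C v) - r)" using sums[of 0] by (simp add: summand_def)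
    also have "(\<Sum>v\<in>V. int n * int (C v) - r) = int n * ((\<Sum>v\<in>V. int (C v)) - r)"
      by (simp add: sum_subtractf cV sum_distrib_left algebra_simps)
    finally have "int q dvd (\<Sum>v\<in>V. int (C v)) - r" by (rule dvd_cancel_n)
    then show ?thesis by (simp add: cong_iff_dvd_diff dvd_diff_commute)
  qed
  have "int q dvd poly F r"
  proof -
    consider "F = labels_poly n V (\<lambda>v. M1 v 0)" | "F = chain_poly n V (\<lambda>v. M1 v 0) (\<lambda>v. M1 v 1)"
      | "F = hash_poly M1 * coin_poly M1 - prod_poly M1"
      | s where "s < 8" "F = labels_poly n V (\<lambda>v. M1 v (2 + s))"
      | s where "s < 8" "F = claims_poly M1 s"
      using F unfolding identities_def by auto
    then show ?thesis
    proof cases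
      case 1
      have "int q dvd int n * poly F r"
        using sums[of 1] unfolding 1 by (simp add: summand_def poly_labels_poly)
      then show ?thesis by (rule dvd_cancel_n)
    next
      case 2
      have "poly F r = (\<Sum>v\<in>V. summand n v (nbrs V E v) (c1 v) (C v) (M1 v) M1 r \<zeta> 2)"
        unfolding 2 chain_poly_def poly_sum by (intro sum.cong refl) (simp add: summand_def poly_monom)
      then show ?thesis using sums[of 2] by simp
    next
      case 3
      have Z: "[\<zeta> = poly (hash_poly M1) r] (mod int q)"
      proof -
        have "int q dvd (\<Sum>v\<in>V. int n * (\<Sum>s<8. local_hash (nbrs V E v) (M1 v) M1 s * r ^ (s * n + M1 v (2 + s))) - \<zeta>)"
          using sums[of 19] by (simp add: summand_def)
        also have "\<dots> = int n * (poly (hash_poly M1) r - \<zeta>)"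
          unfolding poly_block_poly by (simp add: sum_subtractf cV sum_distrib_left algebra_simps)
        finally have "int q dvd poly (hash_poly M1) r - \<zeta>" by (rule dvd_cancel_n)
        then show ?thesis by (simp add: cong_iff_dvd_diff dvd_diff_commute)
      qed
      have "(\<Sum>v\<in>V. summand n v (nbrs V E v) (c1 v) (C v) (M1 v) M1 r \<zeta> 20)
         = \<zeta> * poly (coin_poly M1) r - poly (prod_poly M1) r"
        unfolding poly_block_poly by (simp add: summand_def sum_subtractf sum_distrib_left)
      then have "int q dvd \<zeta> * poly (coin_poly M1) r - poly (prod_poly M1) r" using sums[of 20] by simp
      moreover have "[\<zeta> * poly (coin_poly M1) r - poly (prod_poly M1) r
         = poly (hash_poly M1) r * poly (coin_poly M1) r - poly (prod_poly M1) r] (mod int q)"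
        by (intro cong_diff cong_mult cong_refl Z)
      ultimately show ?thesis unfolding 3 by (simp add: cong_dvd_iff)
    next
      case (4 s)
      have "int q dvd int n * poly F r"
        using sums[of "3 + s"] 4(1) unfolding 4(2) poly_labels_poly[symmetric] by (simp add: summand_def)
      then show ?thesis by (rule dvd_cancel_n)
    next
      case (5 s)
      have "poly F r = (\<Sum>v\<in>V. summand n v (nbrs V E v) (c1 v) (C v) (M1 v) M1 r \<zeta> (11 + s))"
        unfolding 5(2) poly_diff poly_block_poly using 5(1) by (simp add: summand_def sum_subtractf)
      then show ?thesis using sums[of "11 + s"] 5(1) by simp
    qed
  qed
  moreover have "[poly F r = poly F (\<Sum>v\<in>V. int (C v))] (mod int q)"
    unfolding poly_altdef by (intro cong_sum cong_mult cong_pow cong_refl r)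
  ultimately show ?thesis by (simp add: cong_dvd_iff)
qed

end

lemma second_check_cong:
  assumes "\<And>u. u \<in> N \<Longrightarrow> M1 u = M1' u" "\<And>u. u \<in> N \<Longrightarrow> M2 u = M2' u"
  shows "second_check n q v N c1 c m1 m2 M1 M2 = second_check n q v N c1 c m1 m2 M1' M2'"
proof -
  have h: "local_hash N m1 M1 = local_hash N m1 M1'"
    unfolding local_hash_def using assms by (intro ext sum.cong) auto
  have s: "summand n v N c1 c m1 M1 r \<zeta> f = summand n v N c1 c m1 M1' r \<zeta> f" for r \<zeta> f
    unfolding summand_def h by simp
  have "(\<Sum>u | u \<in> N \<and> M2 u 2 = v. int (M2 u (3 + f))) = (\<Sum>u | u \<in> N \<and> M2' u 2 = v. int (M2' u (3 + f)))" for f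
    using assms by (intro sum.cong) auto
  then show ?thesis unfolding second_check_def s using assms by simp
qed

section \<open>The honest prover\<close>

context protocol_instance
begin

lemma honest_sum:
  assumes M0: "\<And>v. v \<in> V \<Longrightarrow> M1 v 0 = rank V v"
    and nx: "\<And>v. v \<in> V \<Longrightarrow> Suc (rank V v) < n \<Longrightarrow> M1 v 1 = inv_into V (rank V) (Suc (rank V v))"
    and \<sigma>: "\<And>s. s < 8 \<Longrightarrow> bij_betw (\<lambda>v. M1 v (2 + s)) V {..<n}"
    and \<alpha>: "\<And>s v. s < 8 \<Longrightarrow> v \<in> V \<Longrightarrow> M1 v (10 + s) = \<omega> (M1 v (2 + s))"
    and Y: "\<And>e v. e < 24 \<Longrightarrow> v \<in> V \<Longrightarrow>
       [int (M1 v (18 + e)) = coeff (hash_poly M1 * coin_poly M1) (e * n + rank V v)] (mod int q)"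
    and r: "[r = (\<Sum>v\<in>V. int (C v))] (mod int q)"
    and \<zeta>: "[\<zeta> = poly (hash_poly M1) r] (mod int q)"
    and f: "f < 21"
  shows "int q dvd (\<Sum>v\<in>V. summand n v (nbrs V E v) (c1 v) (C v) (M1 v) M1 r \<zeta> f)"
proof -
  have lab: "(\<Sum>v\<in>V. int n * r ^ l v - (\<Sum>i<n. r ^ i)) = 0" if "bij_betw l V {..<n}" for l
  proof -
    have "(\<Sum>v\<in>V. r ^ l v) = (\<Sum>i<n. r ^ i)" by (rule sum.reindex_bij_betw[OF that])
    then show ?thesis by (simp add: sum_subtractf cV sum_distrib_left[symmetric])
  qed
  consider "f = 0" | "f = 1" | "f = 2" | s where "s < 8" "f = 3 + s" | s where "s < 8" "f = 11 + s"
    | "f = 19" | "f = 20"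
  proof -
    have "f = 0 \<or> f = 1 \<or> f = 2 \<or> (f - 3 < 8 \<and> f = 3 + (f - 3)) \<or> (f - 11 < 8 \<and> f = 11 + (f - 11)) \<or> f = 19 \<or> f = 20"
      using f by linarith
    then show ?thesis using that by blast
  qed
  then show ?thesis
  proof cases
    case 1
    have "(\<Sum>v\<in>V. int n * int (C v) - r) = int n * ((\<Sum>v\<in>V. int (C v)) - r)"
      by (simp add: sum_subtractf cV sum_distrib_left algebra_simps)
    moreover have "int q dvd (\<Sum>v\<in>V. int (C v)) - r"
      using r by (simp add: cong_iff_dvd_diff dvd_diff_commute)
    ultimately show ?thesis unfolding 1 summand_def by simp
  next
    case 2
    have "(\<Sum>v\<in>V. summand n v (nbrs V E v) (c1 v) (C v) (M1 v) M1 r \<zeta> f) = (\<Sum>v\<in>V. int n * r ^ rank V v - (\<Sum>i<n. r ^ i))"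
      unfolding 2 by (intro sum.cong refl) (simp add: summand_def M0)
    then show ?thesis using lab[OF rk] by simp
  next
    case 3
    let ?g = "inv_into V (rank V)"
    have g: "?g i \<in> V" "rank V (?g i) = i" if "i < n" for i
      using that rk unfolding bij_betw_def by (auto simp: inv_into_into f_inv_into_f)
    have inj: "inj_on (rank V) V" using rk by (simp add: bij_betw_def)
    have g': "?g (rank V v) = v" if "v \<in> V" for v using inv_into_f_f[OF inj that] .
    have "(\<Sum>v\<in>V. summand n v (nbrs V E v) (c1 v) (C v) (M1 v) M1 r \<zeta> f)
      = (\<Sum>v\<in>V. (if rank V v \<noteq> 0 then int v * r ^ rank V v else 0)
          - (if Suc (rank V v) \<noteq> n then int (?g (Suc (rank V v))) * r ^ Suc (rank V v) else 0))"
    proof (rule sum.cong[OF refl])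
      fix v assume v: "v \<in> V"
      have "M1 v 1 = ?g (Suc (rank V v))" if "Suc (rank V v) \<noteq> n"
        using nx[OF v] rk_less[OF v] that by simp
      then show "summand n v (nbrs V E v) (c1 v) (C v) (M1 v) M1 r \<zeta> f
        = (if rank V v \<noteq> 0 then int v * r ^ rank V v else 0)
          - (if Suc (rank V v) \<noteq> n then int (?g (Suc (rank V v))) * r ^ Suc (rank V v) else 0)"
        unfolding 3 summand_def M0[OF v] by simp
    qed
    also have "\<dots> = (\<Sum>v | v \<in> V \<and> rank V v \<noteq> 0. int v * r ^ rank V v)
          - (\<Sum>v | v \<in> V \<and> Suc (rank V v) \<noteq> n. int (?g (Suc (rank V v))) * r ^ Suc (rank V v))"
      by (simp only: sum_subtractf sum.inter_filter[OF fV])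
    \<comment> \<open>Passing to the next identifier is a bijection from all nodes but the last to
      all nodes but the first, and it matches announced with actual identifiers.\<close>
    also have "(\<Sum>v | v \<in> V \<and> Suc (rank V v) \<noteq> n. int (?g (Suc (rank V v))) * r ^ Suc (rank V v))
       = (\<Sum>v | v \<in> V \<and> rank V v \<noteq> 0. int v * r ^ rank V v)"
    proof (rule sum.reindex_bij_witness[where j = "\<lambda>v. ?g (Suc (rank V v))" and i = "\<lambda>v. ?g (rank V v - 1)"])
      fix v assume v: "v \<in> {v. v \<in> V \<and> Suc (rank V v) \<noteq> n}"
      then have lt: "Suc (rank V v) < n" using rk_less[of v] by auto
      show "?g (rank V (?g (Suc (rank V v))) - 1) = v" using g(2)[OF lt] g' v by simp
      show "?g (Suc (rank V v)) \<in> {v. v \<in> V \<and> rank V v \<noteq> 0}" using g[OF lt] by simp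
      show "int (?g (Suc (rank V v))) * r ^ rank V (?g (Suc (rank V v))) = int (?g (Suc (rank V v))) * r ^ Suc (rank V v)"
        using g(2)[OF lt] by simp
    next
      fix v assume v: "v \<in> {v. v \<in> V \<and> rank V v \<noteq> 0}"
      then have lt: "rank V v - 1 < n" "Suc (rank V v - 1) = rank V v" "rank V v < n" using rk_less[of v] by auto
      show "?g (Suc (rank V (?g (rank V v - 1)))) = v" using g(2)[OF lt(1)] g' v lt by simp
      show "?g (rank V v - 1) \<in> {v. v \<in> V \<and> Suc (rank V v) \<noteq> n}" using g[OF lt(1)] lt by simp
    qed
    finally show ?thesis by simp
  next
    case (4 s)
    have "(\<Sum>v\<in>V. summand n v (nbrs V E v) (c1 v) (C v) (M1 v) M1 r \<zeta> f) = (\<Sum>v\<in>V. int n * r ^ M1 v (2 + s) - (\<Sum>i<n. r ^ i))"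
      using 4 by (intro sum.cong refl) (simp add: summand_def)
    then show ?thesis using lab[OF \<sigma>[OF 4(1)]] by simp
  next
    case (5 s)
    have "(\<Sum>v\<in>V. summand n v (nbrs V E v) (c1 v) (C v) (M1 v) M1 r \<zeta> f)
      = (\<Sum>v\<in>V. int (M1 v (10 + s)) * r ^ M1 v (2 + s) - int (c1 v 0) * r ^ M1 v 0)"
      using 5 by (intro sum.cong refl) (simp add: summand_def)
    also have "\<dots> = (\<Sum>v\<in>V. int (\<omega> (M1 v (2 + s))) * r ^ M1 v (2 + s) - int (\<omega> (rank V v)) * r ^ rank V v)"
      by (intro sum.cong refl) (use \<alpha>[OF 5(1)] M0 c1[of _ 0] in simp)
    also have "\<dots> = (\<Sum>i<n. int (\<omega> i) * r ^ i) - (\<Sum>i<n. int (\<omega> i) * r ^ i)"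
      unfolding sum_subtractf sum.reindex_bij_betw[OF \<sigma>[OF 5(1)], where g = "\<lambda>i. int (\<omega> i) * r ^ i"]
        sum.reindex_bij_betw[OF rk, where g = "\<lambda>i. int (\<omega> i) * r ^ i"] ..
    finally show ?thesis by simp
  next
    case 6
    have "(\<Sum>v\<in>V. summand n v (nbrs V E v) (c1 v) (C v) (M1 v) M1 r \<zeta> f)
       = (\<Sum>v\<in>V. int n * (\<Sum>s<8. local_hash (nbrs V E v) (M1 v) M1 s * r ^ (s * n + M1 v (2 + s))) - \<zeta>)"
      unfolding 6 by (simp add: summand_def)
    also have "\<dots> = int n * (poly (hash_poly M1) r - \<zeta>)"
      unfolding poly_block_poly by (simp add: sum_subtractf cV sum_distrib_left algebra_simps)
    finally show ?thesis using \<zeta> by (simp add: cong_iff_dvd_diff dvd_diff_commute)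
  next
    case 7
    let ?P = "hash_poly M1 * coin_poly M1"
    have eq: "(\<Sum>v\<in>V. summand n v (nbrs V E v) (c1 v) (C v) (M1 v) M1 r \<zeta> f)
         = \<zeta> * poly (coin_poly M1) r - poly (prod_poly M1) r"
      unfolding 7 poly_block_poly by (simp add: summand_def sum_subtractf sum_distrib_left)
    have "[\<zeta> * poly (coin_poly M1) r - poly (prod_poly M1) r = poly (hash_poly M1) r * poly (coin_poly M1) r - poly ?P r] (mod int q)"
    proof (intro cong_diff cong_mult cong_refl \<zeta>)
      have l: "M1 v 0 < n" "s < 8 \<Longrightarrow> M1 v (2 + s) < n" if "v \<in> V" for v s
        using that M0 rk_less bij_betwE[OF \<sigma>] by auto
      have deg: "degree ?P \<le> 24 * n"
      proof -
        have "degree ?P \<le> degree (hash_poly M1) + degree (coin_poly M1)" by (rule degree_mult_le)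
        also have "\<dots> \<le> 8 * n + 16 * n" by (intro add_mono degree_block_poly l)
        finally show ?thesis by simp
      qed
      \<comment> \<open>The degree bound leaves position 24n open, but the 24 slots per node hold
        only positions below 24n. The factors vanish from 8n and from 16n on, so nothing is
        lost.\<close>
      have top: "coeff ?P (24 * n) = 0"
      proof -
        have "coeff (hash_poly M1) i * coeff (coin_poly M1) (24 * n - i) = 0" for i
        proof (cases "i < 8 * n")
          case True
          then have "coeff (coin_poly M1) (24 * n - i) = 0" by (intro coeff_block_poly_outside l) auto
          then show ?thesis by simp
        next
          case False
          then have "coeff (hash_poly M1) i = 0" by (intro coeff_block_poly_outside l) auto
          then show ?thesis by simp
        qed
        then show ?thesis unfolding coeff_mult by (intro sum.neutral) auto
      qed
      have "poly ?P r = (\<Sum>i\<le>24 * n. coeff ?P i * r ^ i)"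
        unfolding poly_altdef by (rule sum.mono_neutral_left) (use deg in \<open>auto simp: coeff_eq_0\<close>)
      also have "\<dots> = (\<Sum>i<24 * n. coeff ?P i * r ^ i)" using top by (simp add: lessThan_Suc_atMost[symmetric])
      also have "\<dots> = (\<Sum>(v, e)\<in>V \<times> {..<24}. coeff ?P (e * n + rank V v) * r ^ (e * n + rank V v))"
      proof (rule sum.reindex_bij_witness[symmetric, where j = "\<lambda>(v, e). e * n + rank V v"
            and i = "\<lambda>i. (inv_into V (rank V) (i mod n), i div n)"], goal_cases)
        case (1 a)
        then obtain v e where a: "a = (v, e)" "v \<in> V" by auto
        have "rank V v < n" using rk_less[OF a(2)] .
        then show ?case unfolding a(1) using inv_into_f_f[OF bij_betw_imp_inj_on[OF rk] a(2)] by simp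
      next
        case (2 a)
        then show ?case using block_index_less[OF _ rk_less] by auto
      next
        case (3 i)
        have "i mod n \<in> rank V ` V" using rk n2 unfolding bij_betw_def by simp
        then show ?case using f_inv_into_f[of "i mod n" "rank V" V] by simp
      next
        case (4 i)
        have "i mod n \<in> rank V ` V" using rk n2 unfolding bij_betw_def by simp
        then show ?case using inv_into_into[of "i mod n" "rank V" V] 4 by (simp add: less_mult_imp_div_less)
      next
        case (5 a)
        then show ?case by auto
      qed
      also have "\<dots> = (\<Sum>v\<in>V. \<Sum>e<24. coeff ?P (e * n + rank V v) * r ^ (e * n + rank V v))"
        by (rule sum.cartesian_product[symmetric])
      finally have "poly ?P r = (\<Sum>v\<in>V. \<Sum>e<24. coeff ?P (e * n + rank V v) * r ^ (e * n + rank V v))" .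
      moreover have "[(\<Sum>v\<in>V. \<Sum>e<24. int (M1 v (18 + e)) * r ^ (e * n + M1 v 0))
        = (\<Sum>v\<in>V. \<Sum>e<24. coeff ?P (e * n + rank V v) * r ^ (e * n + rank V v))] (mod int q)"
      proof (intro cong_sum cong_mult)
        fix v e assume "v \<in> V" "e \<in> {..<24::nat}"
        then show "[int (M1 v (18 + e)) = coeff ?P (e * n + rank V v)] (mod int q)"
          "[r ^ (e * n + M1 v 0) = r ^ (e * n + rank V v)] (mod int q)"
          using Y[of e v] M0 by auto
      qed
      ultimately show "[poly (prod_poly M1) r = poly ?P r] (mod int q)"
        unfolding poly_block_poly by simp
    qed
    then have "[\<zeta> * poly (coin_poly M1) r - poly (prod_poly M1) r = 0] (mod int q)"
      by (simp only: poly_mult diff_self)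
    then show ?thesis unfolding eq by (simp only: cong_0_iff)
  qed
qed

text \<open>One tree carries all 21 flows. The partial sums are integers of any size and sign;
  reduced modulo \<open>q\<close>, they fit into a slot.\<close>

lemma honest_second_message:
  assumes z: "\<And>f. f < 21 \<Longrightarrow> int q dvd (\<Sum>v\<in>V. summand n v (nbrs V E v) (c1 v) (C v) (M1 v) M1 (int r) (int \<zeta>) f)"
    and r: "r < q" and \<zeta>: "\<zeta> < q"
  shows "\<exists>M2. (\<forall>v\<in>V. \<forall>i. M2 v i < Q)
    \<and> (\<forall>v\<in>V. second_check n q v (nbrs V E v) (c1 v) (C v) (M1 v) (M2 v) M1 M2)"
proof -
  let ?val = "\<lambda>f v. summand n v (nbrs V E v) (c1 v) (C v) (M1 v) M1 (int r) (int \<zeta>) f"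
  obtain rt p where rt: "rt \<in> V" "p rt = rt" and p: "\<And>v. v \<in> V \<Longrightarrow> v \<noteq> rt \<Longrightarrow> p v \<in> nbrs V E v"
    and S: "\<And>val :: nat \<Rightarrow> int. \<exists>S. \<forall>v\<in>V. val v + (\<Sum>u | u \<in> nbrs V E v \<and> p u = v. S u)
         = (if v = rt then sum val V else S v)" by (rule tree_flow[OF inst]) (rule that, assumption+)
  have "\<forall>f. \<exists>S. \<forall>v\<in>V. ?val f v + (\<Sum>u | u \<in> nbrs V E v \<and> p u = v. S u)
         = (if v = rt then sum (?val f) V else S v)" by (intro allI S)
  then obtain S where S: "\<And>f v. v \<in> V \<Longrightarrow> ?val f v + (\<Sum>u | u \<in> nbrs V E v \<and> p u = v. S f u)
         = (if v = rt then sum (?val f) V else S f v)" using choice[of "\<lambda>f S. \<forall>v\<in>V. ?val f v + (\<Sum>u | u \<in> nbrs V E v \<and> p u = v. S u)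
         = (if v = rt then sum (?val f) V else S v)"] by blast
  define M2 where "M2 v i = (if i = 0 then r else if i = 1 then \<zeta> else if i = 2 then p v
      else nat (S (i - 3) v mod int q))" for v i
  have M2: "M2 v 0 = r" "M2 v 1 = \<zeta>" "M2 v 2 = p v" "M2 v (3 + f) = nat (S f v mod int q)" for v f
    by (simp_all add: M2_def)
  have pV: "p v \<in> V" if "v \<in> V" for v using p[OF that] rt by (cases "v = rt") (auto simp: nb)
  have "M2 v i < Q" if "v \<in> V" for v i
  proof -
    have "M2 v i < q" unfolding M2_def using r \<zeta> id_less[OF pV[OF that]] q0 by (auto simp: nat_less_iff)
    then show ?thesis using q_le_Q by simp
  qed
  moreover have "second_check n q v (nbrs V E v) (c1 v) (C v) (M1 v) (M2 v) M1 M2" if v: "v \<in> V" for v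
    unfolding second_check_def M2
  proof (intro conjI allI impI ballI refl)
    fix f :: nat assume f: "f < 21"
    have iff: "p v \<in> nbrs V E v \<longleftrightarrow> v \<noteq> rt"
      using p[OF v] rt inst by (auto simp: nb is_instance_def)
    have red: "[int (nat (S f u mod int q)) = S f u] (mod int q)" for u
      using q0 by (simp add: cong_def)
    have "[?val f v + (\<Sum>u | u \<in> nbrs V E v \<and> p u = v. int (nat (S f u mod int q)))
      = ?val f v + (\<Sum>u | u \<in> nbrs V E v \<and> p u = v. S f u)] (mod int q)"
      by (intro cong_add cong_sum cong_refl red)
    also have "?val f v + (\<Sum>u | u \<in> nbrs V E v \<and> p u = v. S f u) = (if v = rt then sum (?val f) V else S f v)"
      by (rule S[OF v])
    also have "[\<dots> = (if p v \<in> nbrs V E v then int (nat (S f v mod int q)) else 0)] (mod int q)"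
    proof (cases "v = rt")
      case True
      then show ?thesis using z[OF f] iff by (simp add: cong_0_iff)
    next
      case False
      then show ?thesis using iff cong_sym[OF red] by simp
    qed
    finally show "[?val f v + (\<Sum>u | u \<in> nbrs V E v \<and> p u = v. int (nat (S f u mod int q)))
      = (if p v \<in> nbrs V E v then int (nat (S f v mod int q)) else 0)] (mod int q)" .
  qed
  ultimately show ?thesis by blast
qed

text \<open>The first message must not depend on the coins \<open>C\<close> of round 3, which
  explains the order of the quantifiers.\<close>

lemma lucky_imp_messages:
  assumes lucky: "lucky n q W V E \<omega>" and \<omega>Q: "\<And>i. i < 25 * n \<Longrightarrow> \<omega> i < Q"
  shows "\<exists>M1. (\<forall>v\<in>V. \<forall>i. M1 v i < Q) \<and> (\<forall>v\<in>V. first_check n q W v (c1 v) (M1 v)) \<and>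
     (\<forall>C. \<exists>M2. (\<forall>v\<in>V. \<forall>i. M2 v i < Q)
       \<and> (\<forall>v\<in>V. second_check n q v (nbrs V E v) (c1 v) (C v) (M1 v) (M2 v) M1 M2))"
proof -
  obtain X where X: "X \<in> {..<8} \<rightarrow>\<^sub>E copies n V E" and hit: "hits n q W (tuple_hash n X \<omega>) \<omega>"
    using lucky unfolding lucky_def by blast
  have "\<forall>s\<in>{..<8::nat}. \<exists>\<rho>. \<rho> \<in> labellings n V \<and> X s = graph_of n E \<rho>"
    using X unfolding copies_def by (auto simp: PiE_def Pi_def)
  from bchoice[OF this] obtain \<rho> where \<rho>: "\<And>s. s < 8 \<Longrightarrow> \<rho> s \<in> labellings n V" "\<And>s. s < 8 \<Longrightarrow> X s = graph_of n E (\<rho> s)"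
    by blast
  define \<sigma> where "\<sigma> s = inv_into {..<n} (\<rho> s)" for s
  have b\<rho>: "bij_betw (\<rho> s) {..<n} V" if "s < 8" for s using labelling_bij[OF fV cV \<rho>(1)[OF that]] .
  have b\<sigma>: "bij_betw (\<sigma> s) V {..<n}" if "s < 8" for s
    unfolding \<sigma>_def using bij_betw_inv_into[OF b\<rho>[OF that]] .
  have \<rho>\<sigma>: "\<rho> s (\<sigma> s v) = v" if "s < 8" "v \<in> V" for s v
    unfolding \<sigma>_def by (rule f_inv_into_f) (use b\<rho>[OF that(1)] that(2) in \<open>simp add: bij_betw_def\<close>)
  have \<sigma>n: "\<sigma> s v < n" if "s < 8" "v \<in> V" for s v using bij_betwE[OF b\<sigma>[OF that(1)]] that(2) by auto
  let ?g = "inv_into V (rank V)"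
  have g: "?g i \<in> V" "rank V (?g i) = i" if "i < n" for i
    using that rk unfolding bij_betw_def by (auto simp: inv_into_into f_inv_into_f)
  \<comment> \<open>Two layers avoid a circular definition: both factors of the product read slots
    below 18 only, so filling in its coefficients from slot 18 on does not change them. The last
    node announces 0, a dummy that its check ignores.\<close>
  define M0 where "M0 v i = (if i = 0 then rank V v else if i = 1 then (if Suc (rank V v) < n then ?g (Suc (rank V v)) else 0)
     else if i < 10 then \<sigma> (i - 2) v else if i < 18 then \<omega> (\<sigma> (i - 10) v) else 0)" for v i
  define P where "P = hash_poly M0 * coin_poly M0"
  define M1 where "M1 v i = (if i < 18 then M0 v i else nat (coeff P ((i - 18) * n + rank V v) mod int q))" for v i
  have m0: "M1 v 0 = rank V v" "M1 v 1 = (if Suc (rank V v) < n then ?g (Suc (rank V v)) else 0)" for v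
    by (simp_all add: M1_def M0_def)
  have ms: "M1 v (2 + s) = \<sigma> s v" "M1 v (10 + s) = \<omega> (\<sigma> s v)" if "s < 8" for s v
    using that by (simp_all add: M1_def M0_def)
  have mY: "M1 v (18 + e) = nat (coeff P (e * n + rank V v) mod int q)" for v e
    by (simp add: M1_def)
  have "hash_poly M1 = hash_poly M0" "coin_poly M1 = coin_poly M0"
    unfolding block_poly_def local_hash_def by (auto simp: M1_def intro!: sum.cong)
  then have P: "P = hash_poly M1 * coin_poly M1" by (simp add: P_def)
  have Y: "[int (M1 v (18 + e)) = coeff (hash_poly M1 * coin_poly M1) (e * n + rank V v)] (mod int q)" for e v
    unfolding mY P[symmetric] using q0 by (simp add: cong_def)
  have bnd: "M1 v i < Q" if v: "v \<in> V" for v i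
  proof -
    have "\<omega> (\<sigma> s v) < Q" if "s < 8" for s using \<omega>Q \<sigma>n[OF that v] by simp
    moreover have "x < Q" if "x < q" for x using that q_le_Q by simp
    moreover have "\<sigma> s v < q" if "s < 8" for s using \<sigma>n[OF that v] n_less_q by simp
    moreover have "rank V v < q" using rk_less[OF v] n_less_q by simp
    moreover have "?g (Suc (rank V v)) < q" if "Suc (rank V v) < n" using id_less[OF g(1)[OF that]] .
    moreover have "nat (x mod int q) < q" for x using q0 by (simp add: nat_less_iff)
    ultimately show ?thesis using q0 unfolding M1_def M0_def by auto
  qed
  have b2: "bij_betw (\<lambda>v. M1 v (2 + s)) V {..<n}" if "s < 8" for s
    using b\<sigma>[OF that] ms(1)[OF that] by simp
  have fc: "first_check n q W v (c1 v) (M1 v)" if v: "v \<in> V" for v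
    unfolding first_check_def
  proof (intro conjI allI impI)
    show "M1 v 0 < n" using rk_less[OF v] by (simp add: m0)
    show "M1 v 1 < q" unfolding m0 using id_less g(1) q0 by auto
    show "v < M1 v 1" if "Suc (M1 v 0) < n"
    proof -
      have lt: "Suc (rank V v) < n" using that by (simp add: m0)
      have "\<not> ?g (Suc (rank V v)) \<le> v"
      proof
        assume "?g (Suc (rank V v)) \<le> v"
        then have "rank V (?g (Suc (rank V v))) \<le> rank V v"
          using rank_strict_mono[OF fV g(1)[OF lt], of v] by (cases "?g (Suc (rank V v)) = v") auto
        then show False using g(2)[OF lt] by simp
      qed
      then show ?thesis using lt unfolding m0 by simp
    qed
    show "M1 v (2 + s) < n" if "s < 8" for s using \<sigma>n[OF that v] ms(1)[OF that] by simp
    fix e :: nat assume e: "e < 8"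
    define m where "m = e * n + rank V v"
    have m: "m < 8 * n" unfolding m_def using block_index_less[OF e rk_less[OF v]] .
    have "[int (M1 v (18 + (8 + e))) = coeff (hash_poly M1 * coin_poly M1) ((8 + e) * n + rank V v)] (mod int q)" by (rule Y)
    also have "(8 + e) * n + rank V v = 8 * n + m" by (simp add: m_def algebra_simps)
    also have "[coeff (hash_poly M1 * coin_poly M1) (8 * n + m)
       = toeplitz (8 * n) (tuple_hash n X \<omega>) (\<lambda>i. int (\<omega> (n + i))) m] (mod int q)"
    proof (rule coeff_product[OF m0(1) b2 _ \<rho>(2) _ m])
      show "\<rho> s (M1 v (2 + s)) = v" if "s < 8" "v \<in> V" for s v using \<rho>\<sigma>[OF that] ms(1)[OF that(1)] by simp
      show "[int (M1 v (10 + s)) = int (\<omega> (M1 v (2 + s)))] (mod int q)" if "s < 8" "v \<in> V" for s v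
        using ms[OF that(1)] by simp
    qed
    finally have "[int (M1 v (26 + e)) - int (c1 v (17 + e))
      = toeplitz (8 * n) (tuple_hash n X \<omega>) (\<lambda>i. int (\<omega> (n + i))) m - int (c1 v (17 + e))] (mod int q)"
      by (intro cong_diff cong_refl) simp
    moreover have "c1 v (17 + e) = \<omega> (17 * n + m)"
      using c1[OF v, of "17 + e"] e by (simp add: m_def algebra_simps)
    ultimately show "(int (M1 v (26 + e)) - int (c1 v (17 + e))) mod int q < int (W (e * n + M1 v 0))"
      using hit m unfolding hits_def m0 m_def[symmetric] by (simp add: cong_def)
  qed
  have "\<exists>M2. (\<forall>v\<in>V. \<forall>i. M2 v i < Q) \<and> (\<forall>v\<in>V. second_check n q v (nbrs V E v) (c1 v) (C v) (M1 v) (M2 v) M1 M2)" for C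
  proof -
    define r where "r = nat ((\<Sum>v\<in>V. int (C v)) mod int q)"
    define \<zeta> where "\<zeta> = nat (poly (hash_poly M1) (int r) mod int q)"
    show ?thesis
    proof (rule honest_second_message[of C M1 r \<zeta>])
      show "r < q" "\<zeta> < q" using q0 by (simp_all add: r_def \<zeta>_def nat_less_iff)
      fix f :: nat assume f: "f < 21"
      show "int q dvd (\<Sum>v\<in>V. summand n v (nbrs V E v) (c1 v) (C v) (M1 v) M1 (int r) (int \<zeta>) f)"
      proof (rule honest_sum[OF m0(1) _ b2 _ Y _ _ f])
        show "M1 v 1 = ?g (Suc (rank V v))" if "Suc (rank V v) < n" for v using that unfolding m0 by simp
        show "M1 v (10 + s) = \<omega> (M1 v (2 + s))" if "s < 8" for s v using ms[OF that] by simp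
        show "[int r = (\<Sum>v\<in>V. int (C v))] (mod int q)" using q0 by (simp add: r_def cong_def)
        show "[int \<zeta> = poly (hash_poly M1) (int r)] (mod int q)" using q0 by (simp add: \<zeta>_def cong_def)
      qed
    qed
  qed
  with bnd fc show ?thesis by blast
qed

end

text \<open>With all entries but entry 0 fixed, the sum is one coin plus a constant. The first
  \<open>n\<close> entries are the coins of slot 0, one per node; all others stay outside the
  sum.\<close>

lemma card_sum_coins_root:
  fixes F :: "int poly"
  assumes "prime q" "\<not> (\<forall>i. int q dvd coeff F i)" and n: "0 < n" "n \<le> m"
  shows "card {\<omega> \<in> {..<m} \<rightarrow>\<^sub>E {..<Q}. int q dvd poly F (\<Sum>j<n. int (\<omega> j))}
     \<le> Q ^ (m - 1) * (degree F * (Q div q + 1))"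
proof -
  have u: "{..<m} = {1..<m} \<union> {0}" using n by auto
  have "card {\<omega> \<in> {..<m} \<rightarrow>\<^sub>E {..<Q}. int q dvd poly F (\<Sum>j<n. int (\<omega> j))}
    = (\<Sum>\<alpha>\<in>{1..<m} \<rightarrow>\<^sub>E {..<Q}. card {\<beta> \<in> {0} \<rightarrow>\<^sub>E {..<Q}.
        int q dvd poly F (\<Sum>j<n. int (if j \<in> {1..<m} then \<alpha> j else \<beta> j))})"
    unfolding u by (rule card_PiE_split) auto
  also have "\<dots> \<le> (\<Sum>\<alpha>\<in>{1..<m} \<rightarrow>\<^sub>E {..<Q}. degree F * (Q div q + 1))"
  proof (rule sum_mono)
    fix \<alpha> :: "nat \<Rightarrow> nat"
    define s where "s = (\<Sum>j\<in>{1..<n}. int (\<alpha> j))"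
    have "(\<Sum>j<n. int (if j \<in> {1..<m} then \<alpha> j else \<beta> j)) = int (\<beta> 0) + s" for \<beta> :: "nat \<Rightarrow> nat"
    proof -
      have "{..<n} = insert 0 {1..<n}" using n by auto
      then have "(\<Sum>j<n. int (if j \<in> {1..<m} then \<alpha> j else \<beta> j))
        = int (\<beta> 0) + (\<Sum>j\<in>{1..<n}. int (if j \<in> {1..<m} then \<alpha> j else \<beta> j))" by simp
      also have "(\<Sum>j\<in>{1..<n}. int (if j \<in> {1..<m} then \<alpha> j else \<beta> j)) = s"
        unfolding s_def by (intro sum.cong) (use n in auto)
      finally show ?thesis .
    qed
    then have "card {\<beta> \<in> {0} \<rightarrow>\<^sub>E {..<Q}. int q dvd poly F (\<Sum>j<n. int (if j \<in> {1..<m} then \<alpha> j else \<beta> j))}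
       = card {\<beta> \<in> {0::nat} \<rightarrow>\<^sub>E {..<Q}. \<forall>i\<in>{0}. int q dvd poly F (int (\<beta> i) + s)}" by simp
    also have "\<dots> = card {c \<in> {..<Q}. int q dvd poly F (int c + s)}"
      by (subst card_PiE_box) auto
    also have "\<dots> \<le> degree F * (Q div q + 1)" by (rule card_coin_roots[OF assms(1,2)])
    finally show "card {\<beta> \<in> {0} \<rightarrow>\<^sub>E {..<Q}. int q dvd poly F (\<Sum>j<n. int (if j \<in> {1..<m} then \<alpha> j else \<beta> j))}
       \<le> degree F * (Q div q + 1)" .
  qed
  also have "\<dots> = Q ^ (m - 1) * (degree F * (Q div q + 1))" by (simp add: card_PiE)
  finally show ?thesis .
qed

section \<open>Choice of the parameters\<close>

text \<open>In j = (c + 20) e the summand c makes room for n^c, and 20 covers 10000 < 2^14 and n^3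
  as well as 48 n. From q <= 4^j and 48 n <= 2^j follows 48 n q <= 2^(3j), hence the width 3 j of a
  slot.\<close>

lemma exists_hash_parameters:
  assumes n: "2 \<le> n" and e: "n < 2 ^ e"
  shows "\<exists>q W. hash_parameters n q (2 ^ (3 * ((c + 20) * e))) W \<and> n ^ c \<le> q"
proof -
  define j where "j = (c + 20) * e"
  have e0: "e \<ge> 1" using n e by (cases e) auto
  have "(c + 20) * 1 \<le> j" unfolding j_def using e0 by (rule mult_le_mono2)
  then have j4: "4 \<le> j" by simp
  obtain q :: nat where q: "prime q" "2 ^ j < q" "q \<le> 4 ^ j" using exists_prime_between_powers[OF j4] by blast
  have p2: "(2::nat) ^ a \<le> 2 ^ b" if "a \<le> b" for a b using that by (intro power_increasing) auto
  have nc: "n ^ k \<le> 2 ^ (e * k)" for k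
    using power_mono[of n "2 ^ e" k] e by (simp add: power_mult)
  have "n ^ c \<le> 2 ^ (e * c)" by (rule nc)
  also have "\<dots> \<le> 2 ^ j" by (rule p2) (simp add: j_def)
  finally have ncq: "n ^ c \<le> q" using q(2) by simp
  have "10000 * n ^ 3 \<le> 2 ^ 14 * 2 ^ (e * 3)" by (intro mult_mono nc) auto
  also have "\<dots> = 2 ^ (14 + e * 3)" by (simp only: power_add)
  also have "\<dots> \<le> 2 ^ j"
  proof (rule p2)
    have "14 + e * 3 \<le> 17 * e" using e0 by simp
    also have "\<dots> \<le> j" unfolding j_def by (intro mult_le_mono1) simp
    finally show "14 + e * 3 \<le> j" .
  qed
  finally have nq: "10000 * n ^ 3 \<le> q" using q(2) by simp
  have "48 * n \<le> 2 ^ 6 * 2 ^ e" using e by (intro mult_mono) auto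
  also have "\<dots> = 2 ^ (6 + e)" by (simp only: power_add)
  also have "\<dots> \<le> 2 ^ j"
  proof (rule p2)
    have "6 + e \<le> 7 * e" using e0 by simp
    also have "\<dots> \<le> j" unfolding j_def by (intro mult_le_mono1) simp
    finally show "6 + e \<le> j" .
  qed
  finally have "48 * n * q \<le> 2 ^ j * 4 ^ j" using q(3) by (intro mult_mono) auto
  also have "\<dots> = 2 ^ (3 * j)"
    by (simp add: power_mult power_mult_distrib[symmetric])
  finally have Q: "48 * n * q \<le> 2 ^ (3 * j)" .
  \<comment> \<open>The volume for which n!^8 tuples have 16 expected hits; rounding at most doubles
    it. It is at least 1 because n! <= q^n, and at most q^(8n) because n!^8 >= 2^8.\<close>
  define A where "A = 16 * real q ^ (8 * n) / fact n ^ 8"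
  have q0: "q > 0" using q(2) by simp
  have fpos: "(fact n :: real) ^ 8 > 0" by simp
  have "1 \<le> A"
  proof -
    have "n \<le> q"
    proof -
      have "n \<le> 10000 * n ^ 3" using self_le_power[of n 3] n by linarith
      then show ?thesis using nq by linarith
    qed
    have "fact n \<le> real n ^ n" using fact_le_power[of n, where 'a = real] by simp
    also have "\<dots> \<le> real q ^ n" using \<open>n \<le> q\<close> by (intro power_mono) auto
    finally have "(fact n :: real) ^ 8 \<le> (real q ^ n) ^ 8" by (intro power_mono) auto
    also have "\<dots> = real q ^ (8 * n)" by (simp add: power_mult[symmetric] mult.commute)
    also have "\<dots> \<le> 16 * real q ^ (8 * n)" by simp
    finally show ?thesis using fpos by (simp add: A_def field_simps)
  qed
  moreover have "A \<le> real q ^ (8 * n)"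
  proof -
    have "(fact 2 :: real) \<le> fact n" using n by (rule fact_mono)
    then have "(2 :: real) ^ 8 \<le> fact n ^ 8" by (intro power_mono) (auto simp: fact_numeral)
    then have "16 \<le> (fact n :: real) ^ 8" by simp
    then have "16 * real q ^ (8 * n) \<le> fact n ^ 8 * real q ^ (8 * n)" by (intro mult_right_mono) auto
    then show ?thesis using fpos by (simp add: A_def field_simps)
  qed
  ultimately obtain W where W: "\<forall>m. 1 \<le> W m \<and> W m \<le> q" "A \<le> real (\<Prod>m<8 * n. W m)"
    "real (\<Prod>m<8 * n. W m) \<le> 2 * A"
    using exists_box_of_volume[of A q "8 * n"] q0 by auto
  have "hash_parameters n q (2 ^ (3 * j)) W"
  proof
    show "16 * real q ^ (8 * n) \<le> real (\<Prod>m<8 * n. W m) * fact n ^ 8"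
      using W(2) fpos by (simp add: A_def field_simps del: of_nat_prod)
    show "real (\<Prod>m<8 * n. W m) * fact n ^ 8 \<le> 32 * real q ^ (8 * n)"
      using W(3) fpos by (simp add: A_def field_simps del: of_nat_prod)
  qed (use n q nq Q W in auto)
  with ncq show ?thesis unfolding j_def by blast
qed

section \<open>Strings, slots and the coin vector\<close>

text \<open>Decisions may be arbitrary functions, so a bijection obtained by counting serves as well
  as an explicit binary code. Being a bijection, it keeps uniform coins uniform.\<close>

lemma exists_string_decoding:
  "\<exists>d :: bool list \<Rightarrow> nat \<Rightarrow> nat. bij_betw d {xs. length xs = w * L} ({..<L} \<rightarrow>\<^sub>E {..<2 ^ w})"
proof -
  have eq: "{xs :: bool list. length xs = w * L} = {xs. set xs \<subseteq> UNIV \<and> length xs = w * L}" by simp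
  have "card {xs :: bool list. length xs = w * L} = 2 ^ (w * L)"
    unfolding eq by (subst card_lists_length_eq) auto
  also have "\<dots> = card ({..<L} \<rightarrow>\<^sub>E {..<(2::nat) ^ w})" by (simp add: card_PiE power_mult)
  finally have card: "card {xs :: bool list. length xs = w * L} = card ({..<L} \<rightarrow>\<^sub>E {..<(2::nat) ^ w})" .
  have "finite {xs :: bool list. length xs = w * L}" unfolding eq by (rule finite_lists_length_eq) simp
  moreover have "finite ({..<L} \<rightarrow>\<^sub>E {..<(2::nat) ^ w})" by (intro finite_PiE) auto
  ultimately show ?thesis using card by (rule finite_same_card_bij)
qed

lemma finite_coins: "finite V \<Longrightarrow> finite (coins V k)"
  using finite_lists_length_eq[of "UNIV :: bool set" k] unfolding coins_def by (intro finite_PiE) auto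

lemma card_coins: "finite V \<Longrightarrow> card (coins V k) = (2 ^ k) ^ card V"
  using card_lists_length_eq[of "UNIV :: bool set" k] unfolding coins_def by (simp add: card_PiE)

text \<open>Coin i of the node of rank j becomes entry i n + j of one long vector.\<close>

definition flatten :: "nat set \<Rightarrow> nat \<Rightarrow> (bool list \<Rightarrow> nat \<Rightarrow> nat) \<Rightarrow> (nat \<Rightarrow> bool list) \<Rightarrow> nat \<Rightarrow> nat" where
  "flatten V L d r = restrict (\<lambda>m. d (r (inv_into V (rank V) (m mod card V))) (m div card V)) {..<L * card V}"

lemma flatten_apply:
  assumes "finite V" "v \<in> V" "i < L"
  shows "flatten V L d r (i * card V + rank V v) = d (r v) i"
proof -
  have b: "bij_betw (rank V) V {..<card V}" by (rule rank_bij[OF assms(1)])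
  have lt: "rank V v < card V" using bij_betwE[OF b] assms(2) by auto
  have "inv_into V (rank V) (rank V v) = v" using inv_into_f_f[OF bij_betw_imp_inj_on[OF b] assms(2)] .
  then show ?thesis using lt block_index_less[OF assms(3) lt] by (simp add: flatten_def)
qed

lemma bij_betw_flatten:
  assumes fin: "finite V" and d: "bij_betw d {xs. length xs = w * L} ({..<L} \<rightarrow>\<^sub>E {..<2 ^ w})"
  shows "bij_betw (flatten V L d) (coins V (w * L)) ({..<L * card V} \<rightarrow>\<^sub>E {..<2 ^ w})"
proof -
  let ?n = "card V" and ?T = "{..<L * card V} \<rightarrow>\<^sub>E {..<(2::nat) ^ w}"
  have b: "bij_betw (rank V) V {..<?n}" by (rule rank_bij[OF fin])
  have dT: "d xs \<in> {..<L} \<rightarrow>\<^sub>E {..<2 ^ w}" if "length xs = w * L" for xs using bij_betwE[OF d] that by auto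
  have inj: "inj_on (flatten V L d) (coins V (w * L))"
  proof (rule inj_onI)
    fix r r' assume r: "r \<in> coins V (w * L)" and r': "r' \<in> coins V (w * L)" and eq: "flatten V L d r = flatten V L d r'"
    show "r = r'"
    proof (rule PiE_ext[OF r[unfolded coins_def] r'[unfolded coins_def]])
      fix v assume v: "v \<in> V"
      have len: "length (r v) = w * L" "length (r' v) = w * L" using r r' v unfolding coins_def by auto
      have "d (r v) = d (r' v)"
      proof (rule PiE_ext[OF dT[OF len(1)] dT[OF len(2)]])
        fix i assume "i \<in> {..<L}"
        then show "d (r v) i = d (r' v) i" using flatten_apply[OF fin v, of i L d] eq by (metis lessThan_iff)
      qed
      then show "r v = r' v" using len bij_betw_imp_inj_on[OF d] by (auto dest: inj_onD)
    qed
  qed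
  have sub: "flatten V L d ` coins V (w * L) \<subseteq> ?T"
  proof
    fix y assume "y \<in> flatten V L d ` coins V (w * L)"
    then obtain r where r: "r \<in> coins V (w * L)" "y = flatten V L d r" by blast
    have "d (r (inv_into V (rank V) (m mod ?n))) (m div ?n) < 2 ^ w" if m: "m < L * ?n" for m
    proof -
      have n0: "?n > 0" using m by (cases "?n") auto
      then have "m mod ?n \<in> rank V ` V" using b unfolding bij_betw_def by simp
      then have "inv_into V (rank V) (m mod ?n) \<in> V" by (rule inv_into_into)
      then have "length (r (inv_into V (rank V) (m mod ?n))) = w * L" using r(1) unfolding coins_def by auto
      moreover have "m div ?n < L" using m by (simp add: less_mult_imp_div_less)
      ultimately show ?thesis using dT by (auto simp: PiE_def Pi_def)
    qed
    then show "y \<in> ?T" unfolding r(2) flatten_def by auto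
  qed
  have "card (flatten V L d ` coins V (w * L)) = card ?T"
    using inj fin by (simp add: card_image card_coins card_PiE power_mult[symmetric] mult.assoc)
  then have "flatten V L d ` coins V (w * L) = ?T"
    using sub by (intro card_subset_eq finite_PiE) auto
  with inj show ?thesis by (simp add: bij_betw_def)
qed

lemma card_flatten:
  assumes "finite V" "bij_betw d {xs. length xs = w * L} ({..<L} \<rightarrow>\<^sub>E {..<2 ^ w})"
  shows "card {r \<in> coins V (w * L). P (flatten V L d r)} = card {\<omega> \<in> {..<L * card V} \<rightarrow>\<^sub>E {..<2 ^ w}. P \<omega>}"
proof -
  note b = bij_betw_flatten[OF assms]
  have "bij_betw (flatten V L d) {r \<in> coins V (w * L). P (flatten V L d r)} {\<omega> \<in> {..<L * card V} \<rightarrow>\<^sub>E {..<2 ^ w}. P \<omega>}"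
    using b unfolding bij_betw_def by (auto intro: inj_on_subset)
  then show ?thesis by (rule bij_betw_same_card)
qed

section \<open>The decision of a node and the error probabilities\<close>

text \<open>The lengths are tested because the decoding will be a bijection on strings of full
  length only. A graph with one node has no non-trivial automorphism and is accepted outright; the
  parameters start at n = 2.\<close>

definition asym_decision :: "(nat \<Rightarrow> nat) \<Rightarrow> (nat \<Rightarrow> nat \<Rightarrow> nat) \<Rightarrow> (nat \<Rightarrow> nat)
    \<Rightarrow> (nat \<Rightarrow> bool list \<Rightarrow> nat \<Rightarrow> nat) \<Rightarrow> (nat \<Rightarrow> bool list \<Rightarrow> nat \<Rightarrow> nat) \<Rightarrow> decision" where
  "asym_decision q W l dc dm n v N x1 x2 y1 y2 nb \<longleftrightarrow> n \<le> 1 \<or>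
     length y1 = l n \<and> length y2 = l n \<and> first_check n (q n) (W n) v (dc n x1) (dm n y1) \<and>
     second_check n (q n) v N (dc n x1) (dc n x2 0) (dm n y1) (dm n y2)
       (\<lambda>u. dm n (fst (nb u))) (\<lambda>u. dm n (snd (nb u)))"

lemma all_accept_asym_decision:
  assumes "2 \<le> card V"
  shows "all_accept V E (asym_decision q W l dc dm) r1 r2 m1 m2 \<longleftrightarrow>
    (\<forall>v\<in>V. length (m1 v) = l (card V) \<and> length (m2 v) = l (card V)
       \<and> first_check (card V) (q (card V)) (W (card V)) v (dc (card V) (r1 v)) (dm (card V) (m1 v))
       \<and> second_check (card V) (q (card V)) v (nbrs V E v) (dc (card V) (r1 v)) (dc (card V) (r2 v) 0)
          (dm (card V) (m1 v)) (dm (card V) (m2 v)) (\<lambda>u. dm (card V) (m1 u)) (\<lambda>u. dm (card V) (m2 u)))"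
proof -
  let ?nb = "\<lambda>v u. if u \<in> nbrs V E v then (m1 u, m2 u) else ([], [])"
  have "second_check (card V) (q (card V)) v (nbrs V E v) (dc (card V) (r1 v)) (dc (card V) (r2 v) 0)
          (dm (card V) (m1 v)) (dm (card V) (m2 v)) (\<lambda>u. dm (card V) (fst (?nb v u))) (\<lambda>u. dm (card V) (snd (?nb v u)))
      = second_check (card V) (q (card V)) v (nbrs V E v) (dc (card V) (r1 v)) (dc (card V) (r2 v) 0)
          (dm (card V) (m1 v)) (dm (card V) (m2 v)) (\<lambda>u. dm (card V) (m1 u)) (\<lambda>u. dm (card V) (m2 u))" for v
    by (rule second_check_cong) simp_all
  then show ?thesis using assms unfolding all_accept_def asym_decision_def by auto
qed

lemma first_check_restrict:
  "first_check n q W v c1 (restrict m1 {..<42}) = first_check n q W v c1 m1"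
  by (auto simp: first_check_def)

text \<open>Honest messages are built as functions on all numbers, whereas a string decodes to 42
  slots. The last slot that is read is 41 in round 2 and 23 in round 4.\<close>

lemma second_check_restrict:
  "second_check n q v N c1 c (restrict m1 {..<42}) (restrict m2 {..<42})
     (\<lambda>u. restrict (M1 u) {..<42}) (\<lambda>u. restrict (M2 u) {..<42})
   = second_check n q v N c1 c m1 m2 M1 M2"
proof -
  let ?r = "\<lambda>m. restrict m {..<42::nat}"
  have lh: "local_hash N (?r m1) (\<lambda>u. ?r (M1 u)) s = local_hash N m1 M1 s" if "s < 8" for s
    using that by (simp add: local_hash_def)
  have "summand n v N c1 c (?r m1) (\<lambda>u. ?r (M1 u)) r \<zeta> f = summand n v N c1 c m1 M1 r \<zeta> f" if "f < 21" for r \<zeta> f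
    using that lh unfolding summand_def by auto
  then show ?thesis unfolding second_check_def by auto
qed

locale asym_protocol = hash_parameters n q "2 ^ w" W for n q w W +
  fixes c V E and qf :: "nat \<Rightarrow> nat" and Wf lf and dcf dmf :: "nat \<Rightarrow> bool list \<Rightarrow> nat \<Rightarrow> nat"
  assumes inst: "is_instance c V E" and cV: "card V = n" and ids: "n ^ c \<le> q"
    and qf: "qf n = q" and Wf: "Wf n = W" and lf: "lf n = w * 42"
    and dc: "bij_betw (dcf n) {xs :: bool list. length xs = w * 25} ({..<25} \<rightarrow>\<^sub>E {..<2 ^ w})"
    and dm: "bij_betw (dmf n) {xs :: bool list. length xs = w * 42} ({..<42} \<rightarrow>\<^sub>E {..<2 ^ w})"
begin

abbreviation "D \<equiv> asym_decision qf Wf lf dcf dmf"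
abbreviation "flat \<equiv> flatten V 25 (dcf n)"
abbreviation "C \<equiv> coins V (w * 25)"
abbreviation "lucky_coins r \<equiv> lucky n q W V E (flat r)"

lemma fV: "finite V" using inst by (simp add: is_instance_def)

lemma fC: "finite C" by (rule finite_coins[OF fV])

lemma cC: "card C = (2 ^ w) ^ (25 * n)"
  by (simp add: card_coins fV cV power_mult[symmetric] mult.assoc)

lemma flat: "v \<in> V \<Longrightarrow> i < 25 \<Longrightarrow> flat r (i * n + rank V v) = dcf n (r v) i"
  using flatten_apply[OF fV, of v i 25] cV by simp

lemma card_flat: "card {r \<in> C. P (flat r)} = card {\<omega> \<in> {..<25 * n} \<rightarrow>\<^sub>E {..<2 ^ w}. P \<omega>}"
  using card_flatten[OF fV dc] cV by simp

lemma flat_less: "r \<in> C \<Longrightarrow> i < 25 * n \<Longrightarrow> flat r i < 2 ^ w"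
  using bij_betwE[OF bij_betw_flatten[OF fV dc]] cV by (auto simp: PiE_def Pi_def)

lemma protocol_instance: "protocol_instance n q (2 ^ w) W c V E (flat r) (\<lambda>v. dcf n (r v))"
  by unfold_locales (use inst cV ids flat in auto)

lemma accept_iff:
  "all_accept V E D r1 r2 m1 m2 \<longleftrightarrow>
    (\<forall>v\<in>V. length (m1 v) = w * 42 \<and> length (m2 v) = w * 42
       \<and> first_check n q W v (dcf n (r1 v)) (dmf n (m1 v))
       \<and> second_check n q v (nbrs V E v) (dcf n (r1 v)) (dcf n (r2 v) 0)
          (dmf n (m1 v)) (dmf n (m2 v)) (\<lambda>u. dmf n (m1 u)) (\<lambda>u. dmf n (m2 u)))"
  using all_accept_asym_decision[of V E qf Wf lf dcf dmf r1 r2 m1 m2] n2 unfolding cV qf Wf lf by blast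

text \<open>Some identity \<open>F\<close> fails, and it depends on \<open>r1\<close> and
  \<open>m1\<close> only. Whatever \<open>m2\<close> is, acceptance forces \<open>F\<close> to
  vanish at the sum of the coins, which has probability at most 24n * 2/q <= 1/20.\<close>

lemma card_accept_unlucky:
  assumes "\<not> lucky_coins r1"
  shows "real (card {r2 \<in> C. \<exists>m2. all_accept V E D r1 r2 m1 m2}) \<le> real (card C) / 20"
    (is "real (card ?B) \<le> _")
proof (cases "\<forall>v\<in>V. first_check n q W v (dcf n (r1 v)) (dmf n (m1 v))")
  case False
  then have none: "?B = {}" unfolding accept_iff by blast
  show ?thesis unfolding none by simp
next
  case True
  interpret protocol_instance n q "2 ^ w" W c V E "flat r1" "\<lambda>v. dcf n (r1 v)" by (rule protocol_instance)
  let ?M1 = "\<lambda>v. dmf n (m1 v)"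
  obtain F where F: "F \<in> identities ?M1" "\<not> (\<forall>i. int q dvd coeff F i)"
    using identities_imp_lucky[of ?M1] True assms by blast
  have dF: "degree F \<le> 24 * n" using degree_identities[OF _ F(1)] True by blast
  have sub: "?B
    \<subseteq> {r2 \<in> C. int q dvd poly F (\<Sum>j<n. int (flat r2 j))}"
  proof safe
    fix r2 m2 assume r2: "r2 \<in> C" and acc: "all_accept V E D r1 r2 m1 m2"
    have "int q dvd poly F (\<Sum>v\<in>V. int (dcf n (r2 v) 0))"
      by (rule checks_imp_root[OF _ F(1), where ?M2.0 = "\<lambda>v. dmf n (m2 v)"]) (use acc in \<open>simp add: accept_iff\<close>)
    also have "(\<Sum>v\<in>V. int (dcf n (r2 v) 0)) = (\<Sum>v\<in>V. int (flat r2 (rank V v)))"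
      by (intro sum.cong refl) (use flat[of _ 0 r2] in simp)
    also have "\<dots> = (\<Sum>j<n. int (flat r2 j))" by (rule sum.reindex_bij_betw[OF rk])
    finally show "int q dvd poly F (\<Sum>j<n. int (flat r2 j))" .
  qed
  then have "card ?B
    \<le> card {r2 \<in> C. int q dvd poly F (\<Sum>j<n. int (flat r2 j))}" using fC by (intro card_mono) auto
  also have "\<dots> = card {\<omega> \<in> {..<25 * n} \<rightarrow>\<^sub>E {..<2 ^ w}. int q dvd poly F (\<Sum>j<n. int (\<omega> j))}" by (rule card_flat)
  also have "\<dots> \<le> (2 ^ w) ^ (25 * n - 1) * (degree F * (2 ^ w div q + 1))"
    using n2 by (intro card_sum_coins_root[OF pq F(2)]) auto
  also have "\<dots> \<le> (2 ^ w) ^ (25 * n - 1) * (24 * n * (2 ^ w div q + 1))"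
    using dF by (intro mult_le_mono2 mult_le_mono1)
  finally have "real (card ?B)
     \<le> real ((2 ^ w) ^ (25 * n - 1) * (24 * n * (2 ^ w div q + 1)))" by (rule of_nat_mono)
  also have "\<dots> = real (2 ^ w) ^ (25 * n - 1) * (24 * real n * real ((2 ^ w div q + 1) * q) / real q)"
    using q0 by (simp add: field_simps)
  also have "\<dots> \<le> real (2 ^ w) ^ (25 * n - 1) * (24 * real n * (2 * real (2 ^ w)) / real q)"
    using fibre_power[of 1] n2 by (intro mult_left_mono divide_right_mono) auto
  also have "\<dots> = real (2 ^ w) ^ Suc (25 * n - 1) * (48 * real n / real q)" by simp
  also have "Suc (25 * n - 1) = 25 * n" using n2 by simp
  also have "real (2 ^ w) ^ (25 * n) * (48 * real n / real q) \<le> real (2 ^ w) ^ (25 * n) * (1 / 20)"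
  proof (intro mult_left_mono)
    have "960 * n \<le> 10000 * n ^ 3" using self_le_power[of n 3] n2 by linarith
    then have "960 * n \<le> q" using q_large by linarith
    then have "960 * real n \<le> real q" by linarith
    then show "48 * real n / real q \<le> 1 / 20" using q0 by (simp add: field_simps)
  qed simp
  finally show ?thesis by (simp add: cC)
qed

text \<open>Lucky coins are conceded to the prover at a cost of 1/4. All others cost 1/20, and 3/10
  is below 1/3.\<close>

lemma soundness:
  assumes "\<not> Asym V E"
  shows "accept_prob V E (w * 25) D P1 P2 < 1 / 3"
proof -
  let ?L = "{r \<in> C. lucky_coins r}"
  let ?A = "{(r1, r2). r1 \<in> C \<and> r2 \<in> C \<and> all_accept V E D r1 r2 (P1 r1) (P2 r1 r2)}"
  let ?B = "\<lambda>r1. {r2 \<in> C. \<exists>m2. all_accept V E D r1 r2 (P1 r1) m2}"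
  have L: "real (card ?L) \<le> real (card C) / 4"
    unfolding card_flat using card_lucky_le[OF inst cV assms] by (simp add: cC)
  have C0: "real (card C) > 0" by (simp add: cC)
  have "?A
     \<subseteq> ?L \<times> C \<union> (SIGMA r1:C - ?L. ?B r1)" by auto
  then have "card ?A
     \<le> card (?L \<times> C \<union> (SIGMA r1:C - ?L. ?B r1))" using fC by (intro card_mono) auto
  also have "\<dots> \<le> card (?L \<times> C) + card (SIGMA r1:C - ?L. ?B r1)" by (rule card_Un_le)
  also have "\<dots> = card ?L * card C + (\<Sum>r1\<in>C - ?L. card (?B r1))"
    using fC by (simp add: card_cartesian_product)
  finally have "real (card ?A)
     \<le> real (card ?L * card C + (\<Sum>r1\<in>C - ?L. card (?B r1)))" by (rule of_nat_mono)
  also have "\<dots> = real (card ?L) * real (card C) + (\<Sum>r1\<in>C - ?L. real (card (?B r1)))" by simp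
  also have "\<dots> \<le> real (card C) / 4 * real (card C) + (\<Sum>r1\<in>C. real (card C) / 20)"
  proof (intro add_mono mult_right_mono L)
    have "(\<Sum>r1\<in>C - ?L. real (card (?B r1))) \<le> (\<Sum>r1\<in>C - ?L. real (card C) / 20)"
      by (intro sum_mono card_accept_unlucky) auto
    also have "\<dots> \<le> (\<Sum>r1\<in>C. real (card C) / 20)" using fC by (intro sum_mono2) auto
    finally show "(\<Sum>r1\<in>C - ?L. real (card (?B r1))) \<le> (\<Sum>r1\<in>C. real (card C) / 20)" .
  qed simp
  also have "\<dots> = 3 / 10 * real (card (C \<times> C))" by (simp add: card_cartesian_product)
  also have "\<dots> < 1 / 3 * real (card (C \<times> C))" using C0 by (simp add: card_cartesian_product)
  finally show ?thesis unfolding accept_prob_def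
    using C0 by (simp add: card_cartesian_product divide_less_eq)
qed

lemma honest_strings:
  assumes r1: "r1 \<in> C" and lucky: "lucky_coins r1"
  shows "\<exists>m1. (\<forall>v\<in>V. length (m1 v) = w * 42)
    \<and> (\<forall>r2. \<exists>m2. (\<forall>v\<in>V. length (m2 v) = w * 42) \<and> all_accept V E D r1 r2 m1 m2)"
proof -
  interpret protocol_instance n q "2 ^ w" W c V E "flat r1" "\<lambda>v. dcf n (r1 v)" by (rule protocol_instance)
  define enc where "enc m = inv_into {xs :: bool list. length xs = w * 42} (dmf n) (restrict m {..<42})" for m
  have enc: "length (enc m) = w * 42" "dmf n (enc m) = restrict m {..<42}" if "\<forall>i. m i < 2 ^ w" for m
  proof -
    have "restrict m {..<42} \<in> {..<42} \<rightarrow>\<^sub>E {..<2 ^ w}" using that by auto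
    then have img: "restrict m {..<42} \<in> dmf n ` {xs. length xs = w * 42}" using dm by (simp add: bij_betw_def)
    show "length (enc m) = w * 42" using inv_into_into[OF img] by (simp add: enc_def)
    show "dmf n (enc m) = restrict m {..<42}" unfolding enc_def by (rule f_inv_into_f[OF img])
  qed
  obtain M1 where M1: "\<forall>v\<in>V. \<forall>i. M1 v i < 2 ^ w" and fc: "\<forall>v\<in>V. first_check n q W v (dcf n (r1 v)) (M1 v)"
    and sc: "\<And>C. \<exists>M2. (\<forall>v\<in>V. \<forall>i. M2 v i < 2 ^ w)
       \<and> (\<forall>v\<in>V. second_check n q v (nbrs V E v) (dcf n (r1 v)) (C v) (M1 v) (M2 v) M1 M2)"
    using lucky_imp_messages[OF lucky flat_less[OF r1]] by blast
  show ?thesis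
  proof (rule exI[of _ "\<lambda>v. enc (M1 v)"], intro conjI allI)
    show "\<forall>v\<in>V. length (enc (M1 v)) = w * 42" using enc M1 by blast
    fix r2
    obtain M2 where M2: "\<forall>v\<in>V. \<forall>i. M2 v i < 2 ^ w" and
      sc: "\<forall>v\<in>V. second_check n q v (nbrs V E v) (dcf n (r1 v)) (dcf n (r2 v) 0) (M1 v) (M2 v) M1 M2"
      using sc[of "\<lambda>v. dcf n (r2 v) 0"] by blast
    have e1: "dmf n (enc (M1 v)) = restrict (M1 v) {..<42}" if "v \<in> V" for v using enc M1 that by blast
    have e2: "dmf n (enc (M2 v)) = restrict (M2 v) {..<42}" if "v \<in> V" for v using enc M2 that by blast
    show "\<exists>m2. (\<forall>v\<in>V. length (m2 v) = w * 42) \<and> all_accept V E D r1 r2 (\<lambda>v. enc (M1 v)) m2"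
    proof (intro exI[of _ "\<lambda>v. enc (M2 v)"] conjI)
      show len2: "\<forall>v\<in>V. length (enc (M2 v)) = w * 42" using enc M2 by blast
      show "all_accept V E D r1 r2 (\<lambda>v. enc (M1 v)) (\<lambda>v. enc (M2 v))"
        unfolding accept_iff
      proof (intro ballI conjI)
        fix v assume v: "v \<in> V"
        show "length (enc (M1 v)) = w * 42" "length (enc (M2 v)) = w * 42" using enc M1 len2 v by blast+
        show "first_check n q W v (dcf n (r1 v)) (dmf n (enc (M1 v)))"
          unfolding e1[OF v] first_check_restrict using fc v by blast
        have "second_check n q v (nbrs V E v) (dcf n (r1 v)) (dcf n (r2 v) 0) (dmf n (enc (M1 v))) (dmf n (enc (M2 v)))
            (\<lambda>u. dmf n (enc (M1 u))) (\<lambda>u. dmf n (enc (M2 u)))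
          = second_check n q v (nbrs V E v) (dcf n (r1 v)) (dcf n (r2 v) 0) (restrict (M1 v) {..<42}) (restrict (M2 v) {..<42})
            (\<lambda>u. restrict (M1 u) {..<42}) (\<lambda>u. restrict (M2 u) {..<42})"
          unfolding e1[OF v] e2[OF v] by (rule second_check_cong) (auto simp: nbrs_def e1 e2)
        then show "second_check n q v (nbrs V E v) (dcf n (r1 v)) (dcf n (r2 v) 0) (dmf n (enc (M1 v))) (dmf n (enc (M2 v)))
            (\<lambda>u. dmf n (enc (M1 u))) (\<lambda>u. dmf n (enc (M2 u)))"
          unfolding second_check_restrict using sc v by blast
      qed
    qed
  qed
qed

text \<open>On lucky coins the honest strings are accepted for all coins of round 3, so 7/10 is
  reached. On the others the prover sends empty strings, which respect the length bound.\<close>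

lemma completeness:
  assumes "Asym V E"
  shows "\<exists>P1 P2. valid_prover V (w * 25) (w * 42) P1 P2 \<and> accept_prob V E (w * 25) D P1 P2 > 2 / 3"
proof -
  let ?ok = "\<lambda>r1. r1 \<in> C \<and> lucky_coins r1"
  have "\<forall>r1. \<exists>m1. (\<forall>v\<in>V. length (m1 v) \<le> w * 42)
    \<and> (?ok r1 \<longrightarrow> (\<forall>r2. \<exists>m2. (\<forall>v\<in>V. length (m2 v) \<le> w * 42) \<and> all_accept V E D r1 r2 m1 m2))"
  proof
    fix r1
    show "\<exists>m1. (\<forall>v\<in>V. length (m1 v) \<le> w * 42)
      \<and> (?ok r1 \<longrightarrow> (\<forall>r2. \<exists>m2. (\<forall>v\<in>V. length (m2 v) \<le> w * 42) \<and> all_accept V E D r1 r2 m1 m2))"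
    proof (cases "?ok r1")
      case True
      then show ?thesis using honest_strings[of r1] by (metis order_refl)
    next
      case False
      then show ?thesis by (intro exI[of _ "\<lambda>_. []"]) auto
    qed
  qed
  from choice[OF this] obtain P1 where P1: "\<And>r1 v. v \<in> V \<Longrightarrow> length (P1 r1 v) \<le> w * 42"
    "\<And>r1 r2. ?ok r1 \<Longrightarrow> \<exists>m2. (\<forall>v\<in>V. length (m2 v) \<le> w * 42) \<and> all_accept V E D r1 r2 (P1 r1) m2" by blast
  have "\<forall>r1 r2. \<exists>m2. (\<forall>v\<in>V. length (m2 v) \<le> w * 42) \<and> (?ok r1 \<longrightarrow> all_accept V E D r1 r2 (P1 r1) m2)"
  proof (intro allI)
    fix r1 r2
    show "\<exists>m2. (\<forall>v\<in>V. length (m2 v) \<le> w * 42) \<and> (?ok r1 \<longrightarrow> all_accept V E D r1 r2 (P1 r1) m2)"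
    proof (cases "?ok r1")
      case True
      then show ?thesis using P1(2)[of r1 r2] by blast
    next
      case False
      then show ?thesis by (intro exI[of _ "\<lambda>_. []"]) auto
    qed
  qed
  then obtain P2 where P2: "\<And>r1 r2 v. v \<in> V \<Longrightarrow> length (P2 r1 r2 v) \<le> w * 42"
    "\<And>r1 r2. ?ok r1 \<Longrightarrow> all_accept V E D r1 r2 (P1 r1) (P2 r1 r2)"
    using choice[of "\<lambda>r1 f. \<forall>r2. (\<forall>v\<in>V. length (f r2 v) \<le> w * 42) \<and> (?ok r1 \<longrightarrow> all_accept V E D r1 r2 (P1 r1) (f r2))"]
    by (metis (no_types, lifting))
  let ?A = "{(r1, r2). r1 \<in> C \<and> r2 \<in> C \<and> all_accept V E D r1 r2 (P1 r1) (P2 r1 r2)}"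
  have C0: "real (card C) > 0" by (simp add: cC)
  have "card {r \<in> C. lucky_coins r} = card C - card {r \<in> C. \<not> lucky_coins r}"
  proof -
    have "{r \<in> C. lucky_coins r} = C - {r \<in> C. \<not> lucky_coins r}" by auto
    then show ?thesis using fC by (simp add: card_Diff_subset)
  qed
  moreover have "card {r \<in> C. \<not> lucky_coins r} \<le> card C" using fC by (intro card_mono) auto
  moreover have "real (card {r \<in> C. \<not> lucky_coins r}) \<le> 3 / 10 * real (card C)"
    unfolding card_flat[of "\<lambda>\<omega>. \<not> lucky n q W V E \<omega>"] using card_unlucky_le[OF inst cV assms] by (simp add: cC)
  ultimately have L: "real (card {r \<in> C. lucky_coins r}) \<ge> 7 / 10 * real (card C)" by (simp add: of_nat_diff)
  have "{r \<in> C. lucky_coins r} \<times> C \<subseteq> ?A"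
    using P2(2) by auto
  moreover have "finite ?A"
    by (rule finite_subset[of _ "C \<times> C"]) (use fC in auto)
  ultimately have "card ({r \<in> C. lucky_coins r} \<times> C)
    \<le> card ?A" by (intro card_mono)
  then have le: "real (card {r \<in> C. lucky_coins r} * card C)
    \<le> real (card ?A)"
    unfolding card_cartesian_product by (rule of_nat_mono)
  have "2 / 3 * real (card (C \<times> C)) < 7 / 10 * real (card C) * real (card C)"
    using C0 by (simp add: card_cartesian_product)
  also have "\<dots> \<le> real (card {r \<in> C. lucky_coins r} * card C)"
    using mult_right_mono[OF L, of "real (card C)"] by simp
  also note le
  finally have "accept_prob V E (w * 25) D P1 P2 > 2 / 3" unfolding accept_prob_def
    using C0 by (simp add: card_cartesian_product less_divide_eq)
  moreover have "valid_prover V (w * 25) (w * 42) P1 P2" using P1(1) P2(1) by (simp add: valid_prover_def)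
  ultimately show ?thesis by blast
qed

end

lemma Asym_singleton: "card V = 1 \<Longrightarrow> Asym V E"
  unfolding Asym_def is_automorphism_def by (auto simp: card_1_singleton_iff bij_betw_def)

lemma accept_prob_singleton:
  assumes "finite V" "card V = 1"
  shows "accept_prob V E k (asym_decision q W l dc dm) P1 P2 = 1"
proof -
  have "{(r1, r2). r1 \<in> coins V k \<and> r2 \<in> coins V k \<and>
     all_accept V E (asym_decision q W l dc dm) r1 r2 (P1 r1) (P2 r1 r2)} = coins V k \<times> coins V k"
    using assms(2) by (auto simp: all_accept_def asym_decision_def)
  then show ?thesis unfolding accept_prob_def
    using assms by (simp add: card_cartesian_product card_coins)
qed

text \<open>Minimality gives 2^(e-1) <= n, and then 2^e <= n^2 because n >= 2.\<close>

lemma bit_length_le: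
  assumes "2 \<le> n"
  shows "real (LEAST e. n < 2 ^ e) \<le> 2 / ln 2 * ln (real n)"
proof -
  define e where "e = (LEAST e. n < (2::nat) ^ e)"
  have "n < 2 ^ e" unfolding e_def by (rule LeastI[of _ n]) simp
  then obtain e' where e': "e = Suc e'" using assms by (cases e) auto
  have "\<not> n < 2 ^ e'" using not_less_Least[of e' "\<lambda>e. n < (2::nat) ^ e"] e' unfolding e_def by simp
  then have "(2::nat) ^ e \<le> n * n" using e' assms by (metis mult_le_mono not_less power_Suc)
  then have "real (2 ^ e) \<le> real (n * n)" using of_nat_mono by blast
  then have "(2 :: real) ^ e \<le> real n * real n" by simp
  then have "ln ((2 :: real) ^ e) \<le> ln (real n * real n)" using assms by (subst ln_le_cancel_iff) auto
  then have "real e * ln 2 \<le> 2 * ln (real n)" using assms by (simp add: ln_realpow ln_mult)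
  then show ?thesis unfolding e_def[symmetric] by (simp add: field_simps)
qed

theorem mainTheorem2:
  fixes c :: nat
  shows "in_dAMAM_log c Asym"
proof -
  define e where "e n = (LEAST e. n < (2::nat) ^ e)" for n
  have e: "n < 2 ^ e n" for n unfolding e_def by (rule LeastI[of _ n]) simp
  define w where "w n = 3 * ((c + 20) * e n)" for n
  have "\<forall>n. \<exists>qW. 2 \<le> n \<longrightarrow> hash_parameters n (fst qW) (2 ^ w n) (snd qW) \<and> n ^ c \<le> fst qW"
    using exists_hash_parameters[OF _ e] unfolding w_def by force
  from choice[OF this] obtain qW where
    qW: "\<And>n. 2 \<le> n \<Longrightarrow> hash_parameters n (fst (qW n)) (2 ^ w n) (snd (qW n)) \<and> n ^ c \<le> fst (qW n)" by blast
  have "\<forall>n. \<exists>d :: bool list \<Rightarrow> nat \<Rightarrow> nat. bij_betw d {xs. length xs = w n * 25} ({..<25} \<rightarrow>\<^sub>E {..<2 ^ w n})"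
    by (intro allI exists_string_decoding)
  from choice[OF this] obtain dc where
    dc: "\<And>n. bij_betw (dc n) {xs :: bool list. length xs = w n * 25} ({..<25::nat} \<rightarrow>\<^sub>E {..<(2::nat) ^ w n})" by blast
  have "\<forall>n. \<exists>d :: bool list \<Rightarrow> nat \<Rightarrow> nat. bij_betw d {xs. length xs = w n * 42} ({..<42} \<rightarrow>\<^sub>E {..<2 ^ w n})"
    by (intro allI exists_string_decoding)
  from choice[OF this] obtain dm where
    dm: "\<And>n. bij_betw (dm n) {xs :: bool list. length xs = w n * 42} ({..<42::nat} \<rightarrow>\<^sub>E {..<(2::nat) ^ w n})" by blast
  define l where "l n = w n * 42" for n
  define k where "k n = w n * 25" for n
  define D where "D = asym_decision (\<lambda>n. fst (qW n)) (\<lambda>n. snd (qW n)) l dc dm"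
  have "(\<lambda>n. real (l n)) \<in> O(\<lambda>n. ln (real n))"
  proof (rule bigoI[of _ "126 * real (c + 20) * (2 / ln 2)"], rule eventually_mono[OF eventually_ge_at_top[of 2]])
    fix n :: nat assume n: "2 \<le> n"
    \<comment> \<open>126 is 3 * 42: there are 42 slots of 3 (c + 20) e bits each.\<close>
    have "real (l n) = 126 * real (c + 20) * real (e n)" by (simp add: l_def w_def)
    also have "\<dots> \<le> 126 * real (c + 20) * (2 / ln 2 * ln (real n))"
      unfolding e_def by (intro mult_left_mono bit_length_le n) auto
    also have "\<dots> = 126 * real (c + 20) * (2 / ln 2) * norm (ln (real n))" using n by simp
    finally show "norm (real (l n)) \<le> 126 * real (c + 20) * (2 / ln 2) * norm (ln (real n))" by simp
  qed
  moreover have "dAMAM_protocol c Asym l k D"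
    unfolding dAMAM_protocol_def
  proof (intro conjI allI impI)
    show "k n \<le> l n" for n by (simp add: k_def l_def)
    fix V E assume inst: "is_instance c V E"
    then have V: "finite V" "V \<noteq> {}" by (auto simp: is_instance_def)
    then have "card V \<noteq> 0" by simp
    then consider "card V = 1" | "2 \<le> card V" by linarith
    then have "(Asym V E \<longrightarrow> (\<exists>P1 P2. valid_prover V (k (card V)) (l (card V)) P1 P2
         \<and> 2 / 3 < accept_prob V E (k (card V)) D P1 P2))
      \<and> (\<not> Asym V E \<longrightarrow> (\<forall>P1 P2. accept_prob V E (k (card V)) D P1 P2 < 1 / 3))"
    proof cases
      case 1
      have "valid_prover V (k (card V)) (l (card V)) (\<lambda>_ _. []) (\<lambda>_ _ _. [])" by (simp add: valid_prover_def)
      moreover have "2 / 3 < accept_prob V E (k (card V)) D P1 P2" for P1 P2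
        unfolding D_def accept_prob_singleton[OF V(1) 1] by simp
      ultimately show ?thesis using Asym_singleton[OF 1] by blast
    next
      case 2
      interpret hash_parameters "card V" "fst (qW (card V))" "2 ^ w (card V)" "snd (qW (card V))"
        using qW[OF 2] by blast
      interpret asym_protocol "card V" "fst (qW (card V))" "w (card V)" "snd (qW (card V))" c V E
        "\<lambda>n. fst (qW n)" "\<lambda>n. snd (qW n)" l dc dm
        by unfold_locales (use inst qW[OF 2] dc dm in \<open>auto simp: l_def\<close>)
      show ?thesis using completeness soundness unfolding D_def l_def k_def by blast
    qed
    then show "Asym V E \<Longrightarrow> \<exists>P1 P2. valid_prover V (k (card V)) (l (card V)) P1 P2
         \<and> 2 / 3 < accept_prob V E (k (card V)) D P1 P2"
      and "\<And>P1 P2. \<not> Asym V E \<Longrightarrow> accept_prob V E (k (card V)) D P1 P2 < 1 / 3" by blast+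
  qed
  ultimately show ?thesis unfolding in_dAMAM_log_def by blast
qed

end
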